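(* Let $D=(-1,1)$, let $\varrho$ be the uniform probability measure on $D$ (i.e. $\mathrm{d}\varrho(x)=\frac12\mathrm{d}x$), let $n\in\mathbb{N}$ and let $\mathcal{P}=\mathbb{P}_{n-1}$ be the space of (complex) algebraic polynomials of degree less than $n$. Let $c:(-1,1)\to(0,\infty)$ be a (measurable) cost function satisfying $c(x)\lesssim(1-x^2)^{-\alpha}$, $x\in(-1,1)$, for some $\alpha\geq0$. Define the sampling measure $$\mathrm{d}\mu(x)=\frac{1}{(1-\sigma)\pi}\left(1-\left(\frac{x}{1-\sigma}\right)^2\right)^{-1/2}\mathbb{I}_{(-1+\sigma,1-\sigma)}(x)\,\mathrm{d}x,\qquad \sigma=\sigma(n)=\frac{(2^{1/n}-1)^2}{16}.$$ Let $w=1/v$, $v=\mathrm{d}\mu/\mathrm{d}\varrho$. Let $f\in L^2_{\varrho}(D)$ and $0<\epsilon<1$. Then there is a number of samples $m\geq n$ whose expected evaluation cost $C_{\mathsf{exp}}=m\int_D c(x)\,\mathrm{d}\mu(x)$ satisfies $$C_{\mathsf{exp}}\lesssim_{\alpha}n^{\max\{1,2\alpha\}}\cdot\log(3n/\epsilon),$$ and such that, for $x_1,\ldots,x_m$ drawn i.i.d. from $\mu$, the following holds with probability at least $1-\epsilon$. For any $e\in\mathbb{C}^m$, the weighted least-squares estimator $$\hat f\in\operatorname*{argmin}_{p\in\mathcal{P}}\frac1m\sum_{i=1}^m w(x_i)|y_i-p(x_i)|^2,\qquad y_i=f(x_i)+e_i,$$ is unique and satisfies $$\|f-\hat f\|_{L^2_{\varrho}(D)}\lesssim\frac{n}{\sqrt{\epsilon}}\left(\|f-f_n\|_{L^2_{\varrho}(D)}+\|e\|_2\right),$$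 $$\|f-\hat f\|_{L^{\infty}_{\varrho}(D)}\lesssim\|f-f_n\|_{L^{\infty}_{\varrho}(D)}+\frac{n}{\sqrt{\epsilon}}\left(\|f-f_n\|_{L^2_{\varrho}(D)}+\|e\|_2\right),$$ where $f_n\in\mathcal{P}$ is the best approximation to $f$ from $\mathcal{P}$ in the $L^2_{\varrho}(D)$-norm.
   Context: Functions are complex-valued. $\mathbb{I}_A$ is the indicator function of $A$. $A\lesssim B$ means $A\leq C\,B$ for a constant $C>0$; in the error bounds the constant is universal, and in the bound on $C_{\mathsf{exp}}$ the constant depends only on $\alpha$ (and on the implied constant in the hypothesis $c(x)\lesssim(1-x^2)^{-\alpha}$), in particular not on $n$, $\epsilon$ or $f$. The total cost is the random variable $C_{\mathsf{tot}}=c(x_1)+\cdots+c(x_m)$ and $C_{\mathsf{exp}}=\mathbb{E}(C_{\mathsf{tot}})=m\int_D c\,\mathrm{d}\mu$. The weight $w$ takes the value $+\infty$ where $v=0$; with probability one no sample point falls there. $\|e\|_2$ is the Euclidean norm. *)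

theory Defs
  imports "HOL-Probability.Probability" "HOL-Computational_Algebra.Polynomial"
begin

definition unit_ivl :: "real set" where
  "unit_ivl = {-1<..<1}"

definition rho :: "real measure" where
  "rho = density (lebesgue_on unit_ivl) (\<lambda>x. ennreal (1/2))"

definition sigma :: "nat \<Rightarrow> real" where
  "sigma n = (2 powr (1 / real n) - 1)\<^sup>2 / 16"

definition mu :: "nat \<Rightarrow> real measure" where
  "mu n = density (lebesgue_on unit_ivl)
     (\<lambda>x. ennreal (1 / ((1 - sigma n) * pi) * (1 - (x / (1 - sigma n))\<^sup>2) powr (-1/2)
        * indicator {-1 + sigma n<..<1 - sigma n} x))"

text \<open>The weight takes values in the extended nonnegative reals, where \<open>1 / 0 = \<infinity>\<close>.\<close>

definition weight :: "nat \<Rightarrow> real \<Rightarrow> ennreal" where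
  "weight n x = 1 / RN_deriv rho (mu n) x"

definition polys :: "nat \<Rightarrow> complex poly set" where
  "polys n = {p. degree p < n}"

definition pfun :: "complex poly \<Rightarrow> real \<Rightarrow> complex" where
  "pfun p x = poly p (complex_of_real x)"

definition L2_space :: "'a measure \<Rightarrow> ('a \<Rightarrow> complex) set" where
  "L2_space M = {g. g \<in> borel_measurable M \<and> integrable M (\<lambda>x. (cmod (g x))\<^sup>2)}"

definition L2_norm :: "'a measure \<Rightarrow> ('a \<Rightarrow> complex) \<Rightarrow> real" where
  "L2_norm M g = sqrt (\<integral>x. (cmod (g x))\<^sup>2 \<partial>M)"

text \<open>Extended-real valued, since functions in \<open>L2_space M\<close> need not be essentially bounded.\<close>

definition Linf_norm :: "'a measure \<Rightarrow> ('a \<Rightarrow> complex) \<Rightarrow> ereal" where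
  "Linf_norm M g = esssup M (\<lambda>x. ereal (cmod (g x)))"

definition best_L2_approx :: "nat \<Rightarrow> (real \<Rightarrow> complex) \<Rightarrow> complex poly \<Rightarrow> bool" where
  "best_L2_approx n f =
     is_arg_min (\<lambda>p. L2_norm rho (\<lambda>x. f x - pfun p x)) (\<lambda>p. p \<in> polys n)"

text \<open>Samples, noise and data are indexed by \<open>{..<m}\<close>.\<close>

definition ls_objective ::
    "nat \<Rightarrow> nat \<Rightarrow> (nat \<Rightarrow> real) \<Rightarrow> (nat \<Rightarrow> complex) \<Rightarrow> complex poly \<Rightarrow> ennreal" where
  "ls_objective n m x y p =
     1 / of_nat m * (\<Sum>i<m. weight n (x i) * ennreal ((cmod (y i - pfun p (x i)))\<^sup>2))"

definition wls_estimator ::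
    "nat \<Rightarrow> nat \<Rightarrow> (nat \<Rightarrow> real) \<Rightarrow> (nat \<Rightarrow> complex) \<Rightarrow> complex poly \<Rightarrow> bool" where
  "wls_estimator n m x y = is_arg_min (ls_objective n m x y) (\<lambda>p. p \<in> polys n)"

definition expected_cost :: "nat \<Rightarrow> nat \<Rightarrow> (real \<Rightarrow> real) \<Rightarrow> ennreal" where
  "expected_cost n m c = of_nat m * (\<integral>\<^sup>+x. ennreal (c x) \<partial>mu n)"

text \<open>The joint law of \<open>m\<close> independent samples from \<open>mu n\<close>.\<close>

definition sample_law :: "nat \<Rightarrow> nat \<Rightarrow> (nat \<Rightarrow> real) measure" where
  "sample_law n m = (\<Pi>\<^sub>M i\<in>{..<m}. mu n)"

text \<open>\<open>Q\<close> contains a measurable event of probability at least \<open>p\<close>. This avoids presupposing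
  that \<open>Q\<close>, which may quantify over uncountable sets, is itself measurable.\<close>

definition holds_with_prob_ge :: "'a measure \<Rightarrow> real \<Rightarrow> ('a \<Rightarrow> bool) \<Rightarrow> bool" where
  "holds_with_prob_ge M p Q \<longleftrightarrow> (\<exists>E\<in>sets M. measure M E \<ge> p \<and> (\<forall>x\<in>E. Q x))"

end

theory Submission imports Defs "HOL-Complex_Analysis.Complex_Analysis"
begin

text \<open>
  Write \<open>x = r cos \<theta>\<close> with \<open>r = 1 - sigma n\<close>, so that \<open>\<theta>\<close> is uniform under \<open>mu n\<close>, and use \<open>m = C n M\<close>
  samples, where \<open>M\<close> is about \<open>1 + ln (1 / \<epsilon>) / n\<close>. This is fewer than the usual \<open>n ln (n / \<epsilon>)\<close>, which
  would exceed the cost bound at \<open>\<alpha> = 1/2\<close>, where the mean cost of a sample is of order \<open>ln n\<close>. With so few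
  samples the smallest eigenvalue of the Gram matrix is not bounded below, since gaps of length
  \<open>ln n / n\<close> occur, and matrix concentration is replaced by a local argument.

  Cut \<open>[0, \<pi>]\<close> into cells of length proportional to \<open>1 / n\<close>. If \<open>d\<close> cells of a window of \<open>2 d\<close> cells next to the
  maximum of \<open>p\<close> contain at least \<open>M\<close> samples each, then Taylor expansion and Lagrange interpolation
  bound the maximum by \<open>2 * 72 ^ d\<close> times \<open>|p|\<close> at all samples of one of these cells. The
  probability that such a window fails to contain \<open>d\<close> full cells is at most \<open>exp (- 42 d M)\<close>, which
  beats this amplification. Summing over positions and window sizes gives a random factor \<open>A\<close> with
  \<open>(max |p|)\<^sup>2 \<le> A n\<^sup>2 \<close> times the empirical norm, such that \<open>A\<close> times an empirical mean of \<open>h\<close> has expectation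
  at most a constant times the integral of \<open>h\<close>. Markov's inequality for \<open>h = w |f - f\<^sub>n|\<^sup>2\<close> and for \<open>h = 1\<close> bounds the
  contributions of the approximation error and of the noise.
\<close>

section \<open>Growth and local sampling of polynomials\<close>

text \<open>The amplification and the empirical size of the approximation error depend on the same
  samples. Markov's inequality for each of them separately would leave a product of order 1 /
  \<epsilon>^2; the expectation of their product leaves 1 / \<epsilon>, hence
  \<open>1 / sqrt \<epsilon>\<close> after the square root. This is why the failure of a window is
  majorised by products over the samples: such an expression can be multiplied by a sum over the
  samples and still be integrated by independence. The maximum may lie in any of about n cells, and
  a plain union bound over them would cost another factor n. It is avoided because at
  \<open>e\<close> cells from the endpoint the weight is of order e / n: an amplification matters
  only once it exceeds \<open>e\<close>, and the surplus decay of the probability turns 1 / e into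
  the summable 1 / e^2. Only the cells at the endpoints force the factor n^2. The constants follow
  each other: the cell length is dictated by the Taylor remainder, the amplification 72 by
  interpolation, and the number of samples by the requirement that the failure probability beat the
  cube of 72^(2 d).\<close>

lemma bernstein_walsh_joukowsky:
  fixes P :: "complex poly" and \<zeta> :: complex
  assumes deg: "degree P \<le> n" and S: "\<And>x::real. \<bar>x\<bar> \<le> 1 \<Longrightarrow> cmod (poly P (of_real x)) \<le> S"
    and z: "\<zeta> \<noteq> 0" "cmod \<zeta> \<le> 1"
  shows "cmod (poly P ((\<zeta> + 1/\<zeta>) / 2)) * cmod \<zeta> ^ n \<le> S"
proof -
  \<comment> \<open>\<open>w ^ n * poly P ((w + 1/w) / 2)\<close> with its denominators cleared,
    hence a polynomial in \<open>w\<close>. On the unit circle the Joukowsky map takes the value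
    \<open>Re w\<close> in [-1, 1], and the maximum modulus principle carries the bound into the
    disc.\<close>
  define H where "H = (\<lambda>w::complex. \<Sum>k\<le>degree P. coeff P k * (w ^ (n - k) * ((w\<^sup>2 + 1) / 2) ^ k))"
  have H: "H w = w ^ n * poly P ((w + 1/w) / 2)" if "w \<noteq> 0" for w
  proof -
    have "w ^ (n - k) * ((w\<^sup>2 + 1) / 2) ^ k = w ^ n * ((w + 1/w) / 2) ^ k" if "k \<le> degree P" for k
    proof -
      have "w ^ n = w ^ (n - k) * w ^ k"
        using that deg by (simp flip: power_add)
      moreover have "((w\<^sup>2 + 1) / 2) ^ k = w ^ k * ((w + 1/w) / 2) ^ k"
        using \<open>w \<noteq> 0\<close> by (simp add: power_mult_distrib[symmetric] distrib_left power2_eq_square)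
      ultimately show ?thesis by simp
    qed
    then show ?thesis
      unfolding H_def poly_altdef sum_distrib_left by (intro sum.cong) (auto simp: algebra_simps)
  qed
  have bd: "cmod (H w) \<le> S" if "cmod w = 1" for w
  proof -
    have w0: "w \<noteq> 0" using that by auto
    have "1 / w = cnj w"
      using that w0 by (metis complex_div_cnj div_by_1 mult_1 of_real_1 one_power2)
    then have "(w + 1/w) / 2 = of_real (Re w)"
      by (simp add: complex_eq_iff)
    moreover have "\<bar>Re w\<bar> \<le> 1" using that abs_Re_le_cmod[of w] by simp
    ultimately show ?thesis
      using H[OF w0] S[of "Re w"] that by (simp add: norm_mult norm_power)
  qed
  have "cmod (H \<zeta>) \<le> S"
  proof (rule maximum_modulus_frontier[of H "cball 0 1"])
    show "H holomorphic_on interior (cball 0 1)" unfolding H_def by (intro holomorphic_intros) auto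
    show "continuous_on (closure (cball 0 1)) H" unfolding H_def by (intro continuous_intros) auto
  qed (use z bd in auto)
  then show ?thesis using H[OF z(1)] by (simp add: norm_mult norm_power mult.commute)
qed

text \<open>\<open>\<zeta> = exp (\<i> * z)\<close> turns the cosine into the Joukowsky map, with
  modulus \<open>exp (- Im z)\<close>; evenness of the cosine covers the lower half plane.\<close>

lemma bernstein_walsh_cos:
  fixes P :: "complex poly" and z :: complex
  assumes deg: "degree P \<le> n" and S: "\<And>x::real. \<bar>x\<bar> \<le> 1 \<Longrightarrow> cmod (poly P (of_real x)) \<le> S"
  shows "cmod (poly P (cos z)) \<le> exp (real n * \<bar>Im z\<bar>) * S"
proof -
  have *: "cmod (poly P (cos w)) \<le> exp (real n * \<bar>Im w\<bar>) * S" if "Im w \<ge> 0" for w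
  proof -
    have c: "cos w = (exp (\<i> * w) + 1 / exp (\<i> * w)) / 2"
      by (simp add: cos_exp_eq exp_minus inverse_eq_divide)
    have n: "cmod (exp (\<i> * w)) = exp (- Im w)" by (simp add: norm_exp_eq_Re)
    have "cmod (poly P (cos w)) * exp (- Im w) ^ n \<le> S"
      using bernstein_walsh_joukowsky[OF deg S, of "exp (\<i> * w)"] that unfolding c[symmetric] n by simp
    then have "cmod (poly P (cos w)) * exp (- (real n * Im w)) \<le> S"
      by (simp flip: exp_of_nat_mult)
    then have "cmod (poly P (cos w)) * exp (- (real n * Im w)) * exp (real n * Im w) \<le> S * exp (real n * Im w)"
      by (rule mult_right_mono) simp
    moreover have "exp (- (real n * Im w)) * exp (real n * Im w) = 1" by (simp flip: exp_add)
    ultimately show ?thesis using that by (simp add: mult.assoc) (simp add: mult.commute)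
  qed
  show ?thesis
  proof (cases "Im z \<ge> 0")
    case True then show ?thesis by (rule *)
  next
    case False
    then show ?thesis using *[of "- z"] by simp
  qed
qed

section \<open>Passing from the support of the sampling measure to the whole interval\<close>

lemma sigma_bounds:
  assumes n: "n \<ge> 1"
  shows "0 < sigma n" "sigma n \<le> 1/16"
proof -
  have "2 powr (1 / real n) > 1" using n by simp
  moreover have "2 powr (1 / real n) \<le> 2 powr 1" using n by (intro powr_mono) (auto simp: field_simps)
  ultimately have "0 < 2 powr (1 / real n) - 1" "2 powr (1 / real n) - 1 \<le> 1" by simp_all
  then have "0 < (2 powr (1 / real n) - 1)\<^sup>2" and "(2 powr (1 / real n) - 1)\<^sup>2 \<le> 1\<^sup>2"
    using power_mono[of "2 powr (1 / real n) - 1" 1 2] by (auto simp only: zero_less_power)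
  then show "0 < sigma n" "sigma n \<le> 1/16" by (simp_all add: sigma_def)
qed

text \<open>Keeps the support at a distance of order 1 / n^2 from the endpoints, which bounds the
  cost of a sample there.\<close>

lemma sigma_lower: assumes "n \<ge> 1" shows "sigma n \<ge> 1 / (64 * (real n)\<^sup>2)"
proof -
  have "2 powr (1 / real n) = exp (ln 2 / real n)" by (simp add: powr_def)
  also have "\<dots> \<ge> 1 + ln 2 / real n" by (rule exp_ge_add_one_self)
  finally have 1: "2 powr (1 / real n) - 1 \<ge> ln 2 / real n" by simp
  have "ln (2::real) \<ge> 1/2" using ln2_ge_two_thirds by simp
  then have "ln 2 / real n \<ge> (1/2) / real n" using assms by (intro divide_right_mono) auto
  with 1 have "2 powr (1 / real n) - 1 \<ge> (1/2) / real n" by linarith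
  then have "(2 powr (1 / real n) - 1)\<^sup>2 \<ge> ((1/2) / real n)\<^sup>2" by (intro power_mono) auto
  then show ?thesis by (simp add: sigma_def power_divide field_simps)
qed

text \<open>\<open>sigma\<close> is tuned for this bound: with
  \<open>1 + a = 2 powr (1 / n)\<close>, the rescaled endpoint \<open>1 / r\<close> is at most the
  Joukowsky image of \<open>1 + a\<close>, so the growth outside the support is at most
  \<open>(1 + a) ^ n = 2\<close>.\<close>

lemma poly_bound_extend:
  fixes p :: "complex poly"
  assumes n: "n \<ge> 1" and deg: "degree p \<le> n"
    and S: "\<And>x. \<bar>x\<bar> \<le> 1 - sigma n \<Longrightarrow> cmod (poly p (of_real x)) \<le> S" and t: "\<bar>t\<bar> \<le> 1"
  shows "cmod (poly p (of_real t)) \<le> 2 * S"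
proof -
  define r where "r = 1 - sigma n"
  define a where "a = 2 powr (1 / real n) - 1"
  have r: "15/16 \<le> r" "r < 1" using sigma_bounds[OF n] by (auto simp: r_def)
  have S0: "S \<ge> 0" using S[of 0] r by (auto simp: r_def intro: order_trans[OF norm_ge_zero])
  show ?thesis
  proof (cases "\<bar>t\<bar> \<le> r")
    case True
    then show ?thesis using S[of t] S0 by (auto simp: r_def)
  next
    case False
    define x where "x = t / r"
    define s where "s = sgn t"
    have x1: "\<bar>x\<bar> > 1" using False r by (auto simp: x_def field_simps)
    have xu: "\<bar>x\<bar> \<le> 1 / r" using t r by (auto simp: x_def field_simps)
    \<comment> \<open>The Joukowsky preimage of \<open>\<bar>x\<bar>\<close> inside the unit disc;
      \<open>1 / y\<close> is the growth per degree.\<close>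
    define y where "y = \<bar>x\<bar> - sqrt (x\<^sup>2 - 1)"
    have q: "sqrt (x\<^sup>2 - 1) < \<bar>x\<bar>" by (metis diff_less_eq less_add_same_cancel1 real_sqrt_abs real_sqrt_less_mono zero_less_one add.commute)
    have y: "0 < y" using q by (simp add: y_def)
    have x21: "x\<^sup>2 \<ge> 1" using x1 by (metis abs_one less_eq_real_def one_power2 power2_le_iff_abs_le abs_ge_zero abs_le_square_iff)
    have yinv: "1 / y = \<bar>x\<bar> + sqrt (x\<^sup>2 - 1)"
    proof -
      have "(\<bar>x\<bar> + sqrt (x\<^sup>2 - 1)) * y = 1"
        using x21 by (simp add: y_def algebra_simps power2_eq_square[symmetric])
      then show ?thesis using y by (simp add: field_simps)
    qed
    have sq0: "sqrt (x\<^sup>2 - 1) \<ge> 0" using x21 by simp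
    have y1: "y \<le> 1"
      using yinv x1 y sq0 by (smt (verit) divide_less_eq_1)
    have a: "0 < a" "a \<le> 1"
    proof -
      have "2 powr (1 / real n) > 1" using n by simp
      moreover have "2 powr (1 / real n) \<le> 2 powr 1" using n by (intro powr_mono) (auto simp: field_simps)
      ultimately show "0 < a" "a \<le> 1" by (auto simp: a_def)
    qed
    have ra: "r = 1 - a\<^sup>2 / 16" by (simp add: r_def sigma_def a_def)
    have a2: "a\<^sup>2 \<le> 1" using a by (simp add: power_le_one)
    have "1 / r \<le> 1 + a\<^sup>2 / 4"
    proof -
      have "(1 + a\<^sup>2 / 4) * r = 1 + a\<^sup>2 * (12 - a\<^sup>2) / 64"
        unfolding ra by (simp add: field_simps)
      moreover have "a\<^sup>2 * (12 - a\<^sup>2) \<ge> 0" using a2 by (intro mult_nonneg_nonneg) auto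
      ultimately have "1 \<le> (1 + a\<^sup>2 / 4) * r" by simp
      then show ?thesis using r by (simp add: field_simps)
    qed
    moreover have "1 + a\<^sup>2 / 4 \<le> ((1 + a) + 1 / (1 + a)) / 2"
    proof -
      have "((1 + a) + 1 / (1 + a)) / 2 = 1 + a\<^sup>2 / (2 * (1 + a))"
        using a by (simp add: field_simps power2_eq_square)
      moreover have "a\<^sup>2 / 4 \<le> a\<^sup>2 / (2 * (1 + a))"
        using a by (intro divide_left_mono) auto
      ultimately show ?thesis by linarith
    qed
    ultimately have ch: "\<bar>x\<bar> \<le> ((1 + a) + 1 / (1 + a)) / 2" using xu by linarith
    have ya: "1 / y \<le> 1 + a"
    proof (rule ccontr)
      assume "\<not> 1 / y \<le> 1 + a"
      then have gt: "1 / y > 1 + a" by simp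
      have "\<bar>x\<bar> = (1/y + y) / 2" unfolding yinv by (simp add: y_def)
      then have le: "1/y + y \<le> (1 + a) + 1 / (1 + a)" using ch by simp
      define u where "u = 1 / y"
      have u: "u > 1 + a" "y = 1 / u" using gt by (auto simp: u_def)
      \<comment> \<open>This factorisation expresses that \<open>u + 1/u\<close> increases for u >
        1, so an inequality between Joukowsky images gives one between preimages.\<close>
      have "u + 1/u - ((1 + a) + 1 / (1 + a)) = (u - (1 + a)) * (1 - 1 / (u * (1 + a)))"
        using u a unfolding u(2) by (simp add: divide_simps) (simp add: algebra_simps)
      moreover have "u * (1 + a) > 1" using u a by (smt (verit) mult_less_cancel_right2 mult_pos_pos one_less_mult)
      then have "(u - (1 + a)) * (1 - 1 / (u * (1 + a))) > 0" using u by (intro mult_pos_pos) auto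
      ultimately show False using le u by simp
    qed
    define P where "P = pcompose p [:0, of_real r:]"
    have Pp: "poly P w = poly p (of_real r * w)" for w by (simp add: P_def poly_pcompose mult.commute)
    have degP: "degree P \<le> n" using deg r by (simp add: P_def degree_pcompose)
    define \<zeta> where "\<zeta> = complex_of_real (s * y)"
    have s: "s = 1 \<or> s = -1" "t = s * \<bar>t\<bar>" using False r by (auto simp: s_def sgn_if)
    have nz: "cmod \<zeta> = y" using s y by (auto simp: \<zeta>_def norm_mult)
    have J: "(\<zeta> + 1/\<zeta>) / 2 = of_real x"
    proof -
      have "(s * y + 1 / (s * y)) / 2 = s * ((y + 1 / y) / 2)" using s by auto
      also have "(y + 1 / y) / 2 = \<bar>x\<bar>" unfolding yinv by (simp add: y_def)
      also have "s * \<bar>x\<bar> = x" using s r by (auto simp: x_def)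
      finally have "complex_of_real ((s * y + 1 / (s * y)) / 2) = of_real x" by simp
      then show ?thesis unfolding \<zeta>_def by simp
    qed
    have "cmod (poly P ((\<zeta> + 1/\<zeta>) / 2)) * cmod \<zeta> ^ n \<le> S"
    proof (rule bernstein_walsh_joukowsky[OF degP])
      fix v :: real assume "\<bar>v\<bar> \<le> 1"
      then have "\<bar>r * v\<bar> \<le> 1 - sigma n" using r by (auto simp: abs_mult r_def[symmetric] mult_left_le)
      then show "cmod (poly P (of_real v)) \<le> S" using S[of "r * v"] by (simp add: Pp)
    qed (use nz y y1 in auto)
    then have "cmod (poly p (of_real t)) * y ^ n \<le> S"
      unfolding J nz Pp using r by (simp add: x_def)
    then have "cmod (poly p (of_real t)) \<le> S * (1 / y) ^ n"
      using y by (simp add: field_simps)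
    also have "\<dots> \<le> S * (1 + a) ^ n"
      using ya y S0 by (intro mult_left_mono power_mono) auto
    also have "(1 + a) ^ n = 2"
      using n by (simp add: a_def powr_realpow[symmetric] powr_powr)
    finally show ?thesis by simp
  qed
qed

section \<open>Taylor expansion and interpolation in the angle\<close>

text \<open>\<open>poly P (cos z)\<close> is entire and at most \<open>exp (n * \<rho>) * S\<close>
  on the disc of radius \<rho> about \<phi>, so Cauchy's inequalities bound its coefficients. For
  \<open>\<bar>u\<bar> \<le> \<rho> / 2\<close> the tail from index \<open>d\<close> on is dominated
  by a geometric series of ratio 1/2, whence the factor 2.\<close>

lemma poly_cos_taylor:
  fixes P :: "complex poly" and \<phi> :: real
  assumes deg: "degree P \<le> n" and S: "\<And>x::real. \<bar>x\<bar> \<le> 1 \<Longrightarrow> cmod (poly P (of_real x)) \<le> S"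
    and \<rho>: "\<rho> > 0" and d: "d \<ge> 1"
  obtains T :: "complex poly" where "degree T < d" "poly T 0 = poly P (of_real (cos \<phi>))"
    "\<And>u::real. \<bar>u\<bar> \<le> \<rho> / 2 \<Longrightarrow>
      cmod (poly P (of_real (cos (\<phi> + u))) - poly T (of_real u)) \<le> 2 * exp (n * \<rho>) * S * (\<bar>u\<bar> / \<rho>) ^ d"
proof -
  define F where "F = (\<lambda>z::complex. poly P (cos z))"
  define a where "a = (\<lambda>j. (deriv ^^ j) F (of_real \<phi>) / fact j)"
  define T where "T = (\<Sum>j<d. monom (a j) j)"
  have hol: "F holomorphic_on A" for A unfolding F_def poly_altdef by (intro holomorphic_intros)
  have a: "cmod (a j) \<le> exp (n * \<rho>) * S / \<rho> ^ j" for j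
  proof -
    have S0: "0 \<le> S" using S[of 0] by (auto intro: order_trans[OF norm_ge_zero])
    have "cmod ((deriv ^^ j) F (of_real \<phi>)) \<le> fact j * (exp (n * \<rho>) * S) / \<rho> ^ j"
    proof (rule Cauchy_inequality[OF hol _ \<rho>])
      show "continuous_on (cball (complex_of_real \<phi>) \<rho>) F"
        by (intro holomorphic_on_imp_continuous_on hol)
      fix x assume "cmod (of_real \<phi> - x) = \<rho>"
      then have "\<bar>Im x\<bar> \<le> \<rho>" using abs_Im_le_cmod[of "of_real \<phi> - x"] by simp
      then have "exp (real n * \<bar>Im x\<bar>) * S \<le> exp (real n * \<rho>) * S"
        using S0 by (intro mult_right_mono) (auto intro: mult_left_mono)
      then show "cmod (F x) \<le> exp (real n * \<rho>) * S"
        unfolding F_def using bernstein_walsh_cos[OF deg S, of x] by linarith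
    qed
    then show ?thesis by (simp add: a_def norm_divide field_simps)
  qed
  have "cmod (poly P (of_real (cos (\<phi> + u))) - poly T (of_real u)) \<le> 2 * exp (n * \<rho>) * S * (\<bar>u\<bar> / \<rho>) ^ d"
    if u: "\<bar>u\<bar> \<le> \<rho> / 2" for u
  proof -
    have S0: "0 \<le> S" using S[of 0] by (auto intro: order_trans[OF norm_ge_zero])
    define q where "q = \<bar>u\<bar> / \<rho>"
    have q: "0 \<le> q" "q \<le> 1/2" using u \<rho> by (auto simp: q_def field_simps)
    have "(\<lambda>j. a j * (of_real (\<phi> + u) - of_real \<phi>) ^ j) sums F (of_real (\<phi> + u))"
      unfolding a_def by (rule holomorphic_power_series[OF hol[of "ball (of_real \<phi>) \<rho>"]])
        (use u \<rho> in \<open>auto simp: dist_norm simp flip: of_real_diff of_real_add\<close>)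
    then have "(\<lambda>j. a j * of_real u ^ j) sums F (of_real (\<phi> + u))" by simp
    then have "(\<lambda>j. a (j + d) * of_real u ^ (j + d)) sums (F (of_real (\<phi> + u)) - (\<Sum>j<d. a j * of_real u ^ j))"
      by (subst sums_iff_shift) simp
    then have s1: "(\<lambda>j. a (j + d) * of_real u ^ (j + d)) sums (F (of_real (\<phi> + u)) - poly T (of_real u))"
      by (simp add: T_def poly_sum poly_monom)
    have bd: "cmod (a (j + d) * of_real u ^ (j + d)) \<le> exp (n * \<rho>) * S * q ^ d * (1/2) ^ j" for j
    proof -
      have "cmod (a (j + d) * of_real u ^ (j + d)) \<le> exp (n * \<rho>) * S / \<rho> ^ (j + d) * \<bar>u\<bar> ^ (j + d)"
        using mult_right_mono[OF a[of "j + d"], of "\<bar>u\<bar> ^ (j + d)"] by (simp add: norm_mult norm_power)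
      also have "\<dots> = exp (n * \<rho>) * S * q ^ (j + d)" by (simp add: q_def power_divide)
      also have "\<dots> = exp (n * \<rho>) * S * q ^ d * q ^ j" by (simp add: power_add)
      also have "\<dots> \<le> exp (n * \<rho>) * S * q ^ d * (1/2) ^ j"
        using q S0 by (intro mult_left_mono power_mono) auto
      finally show ?thesis .
    qed
    have s2: "(\<lambda>j. exp (n * \<rho>) * S * q ^ d * (1/2) ^ j) sums (exp (n * \<rho>) * S * q ^ d * 2)"
      using sums_mult[OF geometric_sums[of "1/2::real"]] by simp
    have "cmod (F (of_real (\<phi> + u)) - poly T (of_real u)) \<le> exp (n * \<rho>) * S * q ^ d * 2"
      using norm_suminf_le[OF bd sums_summable[OF s2]] sums_unique[OF s1] sums_unique[OF s2] by simp
    moreover have "F (of_real (\<phi> + u)) = poly P (of_real (cos (\<phi> + u)))"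
      unfolding F_def by (simp only: cos_of_real)
    ultimately show ?thesis by (simp add: q_def mult_ac)
  qed
  moreover have "poly T 0 = poly P (of_real (cos \<phi>))"
  proof -
    have "poly T 0 = (\<Sum>j<d. if j = 0 then a 0 else 0)"
      unfolding T_def poly_sum poly_monom by (intro sum.cong) auto
    also have "\<dots> = a 0" using d by (simp add: sum.delta)
    finally show ?thesis by (simp add: a_def F_def cos_of_real)
  qed
  moreover have "degree T < d"
    unfolding T_def using d by (intro degree_sum_less) (auto intro: le_less_trans[OF degree_monom_le])
  ultimately show thesis using that by blast
qed

lemma lagrange_interpolation:
  fixes T :: "'a::field poly" and u :: "'b \<Rightarrow> 'a"
  assumes fin: "finite I" and inj: "inj_on u I" and deg: "degree T < card I"
  shows "poly T x = (\<Sum>i\<in>I. poly T (u i) * (\<Prod>l\<in>I - {i}. (x - u l) / (u i - u l)))"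
proof -
  define L where "L = (\<Sum>i\<in>I. smult (poly T (u i)) (\<Prod>l\<in>I - {i}. smult (1 / (u i - u l)) [:- u l, 1:]))"
  have pL: "poly L y = (\<Sum>i\<in>I. poly T (u i) * (\<Prod>l\<in>I - {i}. (y - u l) / (u i - u l)))" for y
    unfolding L_def poly_sum poly_smult poly_prod
    by (intro sum.cong prod.cong arg_cong2[of _ _ _ _ times]) (simp_all add: diff_divide_distrib)
  have card0: "card I > 0" using deg by simp
  have degL: "degree L < card I" unfolding L_def
  proof (rule degree_sum_less[OF _ card0])
    fix i assume i: "i \<in> I"
    have "degree (\<Prod>l\<in>I - {i}. smult (1 / (u i - u l)) [:- u l, 1:])
        \<le> (\<Sum>l\<in>I - {i}. degree (smult (1 / (u i - u l)) [:- u l, 1:]))"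
      using degree_prod_sum_le[of "I - {i}" "\<lambda>l. smult (1 / (u i - u l)) [:- u l, 1:]"] fin by (simp add: o_def)
    also have "\<dots> \<le> (\<Sum>l\<in>I - {i}. 1)"
      by (intro sum_mono order_trans[OF degree_smult_le]) auto
    also have "\<dots> < card I" using fin i card0 by (simp add: card_Diff_singleton)
    finally show "degree (smult (poly T (u i)) (\<Prod>l\<in>I - {i}. smult (1 / (u i - u l)) [:- u l, 1:])) < card I"
      by (rule le_less_trans[OF degree_smult_le])
  qed
  have eq: "poly L (u j) = poly T (u j)" if j: "j \<in> I" for j
  proof -
    have "poly L (u j) = (\<Sum>i\<in>I. if i = j then poly T (u j) else 0)"
      unfolding pL
    proof (intro sum.cong refl)
      fix i assume i: "i \<in> I"
      show "poly T (u i) * (\<Prod>l\<in>I - {i}. (u j - u l) / (u i - u l)) = (if i = j then poly T (u j) else 0)"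
      proof (cases "i = j")
        case True
        have "(\<Prod>l\<in>I - {i}. (u j - u l) / (u i - u l)) = 1"
          using inj i True by (intro prod.neutral) (auto simp: inj_on_def)
        then show ?thesis using True by simp
      next
        case False
        then have "(\<Prod>l\<in>I - {i}. (u j - u l) / (u i - u l)) = 0"
          using fin j by (intro prod_zero) auto
        then show ?thesis using False by simp
      qed
    qed
    also have "\<dots> = poly T (u j)" using fin j by (simp add: sum.delta)
    finally show ?thesis .
  qed
  have "L - T = 0"
  proof (rule ccontr)
    assume nz: "L - T \<noteq> 0"
    have "card I = card (u ` I)" using inj by (simp add: card_image)
    also have "\<dots> \<le> card {z. poly (L - T) z = 0}"
      using eq by (intro card_mono poly_roots_finite nz) auto
    also have "\<dots> \<le> degree (L - T)" using nz by (rule card_poly_roots_bound)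
    also have "\<dots> < card I" using degL deg by (intro degree_diff_less)
    finally show False by simp
  qed
  then show ?thesis using pL[of x] by simp
qed

text \<open>Only 2 k nonzero integers have absolute value at most k, so \<open>card A\<close> is at
  most twice the largest absolute value in \<open>A\<close>; induction removes an element attaining
  it. The bound serves for the denominators of the Lagrange coefficients.\<close>

lemma fact_card_le_prod_abs:
  fixes A :: "int set"
  assumes "finite A" "0 \<notin> A"
  shows "fact (card A) \<le> 2 ^ card A * (\<Prod>x\<in>A. real_of_int \<bar>x\<bar>)"
  using assms
proof (induction "card A" arbitrary: A)
  case 0
  then show ?case by simp
next
  case (Suc a)
  then have ne: "A \<noteq> {}" by auto
  define m where "m = Max (abs ` A)"
  have "m \<in> abs ` A" unfolding m_def using Suc ne by (intro Max_in) auto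
  then obtain x where x: "x \<in> A" "m = \<bar>x\<bar>" by auto
  have "y \<in> {- \<bar>x\<bar>..\<bar>x\<bar>} - {0}" if "y \<in> A" for y
  proof -
    have "\<bar>y\<bar> \<le> m" unfolding m_def using Suc that by (intro Max_ge) auto
    then show ?thesis using x that Suc by auto
  qed
  then have "card A \<le> card ({- \<bar>x\<bar>..\<bar>x\<bar>} - {0})" by (intro card_mono) auto
  also have "\<dots> = nat (2 * \<bar>x\<bar>)" by (subst card_Diff_singleton) auto
  finally have "real (Suc a) \<le> 2 * real_of_int \<bar>x\<bar>" using Suc by linarith
  moreover have c: "a = card (A - {x})" using Suc x by (simp add: card_Diff_singleton)
  then have "fact a \<le> 2 ^ a * (\<Prod>x\<in>A - {x}. real_of_int \<bar>x\<bar>)"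
    using Suc(1)[OF c] Suc by simp
  ultimately have "real (Suc a) * fact a \<le> (2 * real_of_int \<bar>x\<bar>) * (2 ^ a * (\<Prod>x\<in>A - {x}. real_of_int \<bar>x\<bar>))"
    by (intro mult_mono) auto
  moreover have "(\<Prod>x\<in>A. real_of_int \<bar>x\<bar>) = real_of_int \<bar>x\<bar> * (\<Prod>x\<in>A - {x}. real_of_int \<bar>x\<bar>)"
    using Suc x by (intro prod.remove) auto
  ultimately show ?case unfolding Suc(2)[symmetric] by (simp add: mult_ac)
qed

text \<open>\<open>real d ^ d / fact d\<close> is a single term of the exponential series at
  \<open>d\<close>.\<close>

lemma power_self_le_exp_fact: "real d ^ d \<le> exp (real d) * fact d"
proof -
  have "(\<Sum>k\<in>{d}. real d ^ k /\<^sub>R fact k) \<le> (\<Sum>k. real d ^ k /\<^sub>R fact k)"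
    using exp_converges[of "real d"] by (intro sum_le_suminf) (auto simp: sums_iff)
  also have "\<dots> = exp (real d)" using exp_converges[of "real d"] by (simp add: sums_iff)
  finally show ?thesis by (simp add: field_simps)
qed

text \<open>Taylor expansion at \<open>\<phi>\<close> replaces the trigonometric polynomial by one of degree less than \<open>d\<close>,
  which \<open>d\<close> separated nodes determine with an amplification exponential in \<open>d\<close> only.\<close>
lemma local_sampling:
  fixes P :: "complex poly" and \<theta> :: "nat \<Rightarrow> real"
  assumes n: "n \<ge> 1" and deg: "degree P \<le> n"
    and S: "\<And>x::real. \<bar>x\<bar> \<le> 1 \<Longrightarrow> cmod (poly P (of_real x)) \<le> S"
    and attained: "cmod (poly P (of_real (cos \<phi>))) = S"
    and I: "finite I" "card I = d" "d \<ge> 1"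
    and h: "h = pi / (16384 * real n)"
    and near: "\<And>i. i \<in> I \<Longrightarrow> \<bar>\<theta> i - \<phi>\<bar> \<le> 3 * real d * h"
    and sep: "\<And>i j. i \<in> I \<Longrightarrow> j \<in> I \<Longrightarrow> \<bar>\<theta> i - \<theta> j\<bar> \<ge> \<bar>real i - real j\<bar> * (h / 2)"
  shows "\<exists>i\<in>I. S \<le> 2 * 72 ^ d * cmod (poly P (of_real (cos (\<theta> i))))"
proof (rule ccontr)
  assume "\<not> ?thesis"
  then have small: "2 * 72 ^ d * cmod (poly P (of_real (cos (\<theta> i)))) < S" if "i \<in> I" for i
    using that by force
  obtain i0 where i0: "i0 \<in> I" using I by (metis card.empty ex_in_conv not_one_le_zero)
  have S0: "S > 0" using small[OF i0] by (smt (verit) norm_ge_zero zero_le_mult_iff zero_le_power)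
  have h0: "h > 0" using n by (simp add: h)
  \<comment> \<open>With this radius the growth \<open>exp (n * \<rho>)\<close> is exp 1 to the
    power \<open>d\<close>, and the distance \<open>3 * d * h\<close> to the nodes is the same small
    fraction of \<rho> for all \<open>n\<close> and \<open>d\<close>.\<close>
  define \<rho> where "\<rho> = real d / real n"
  have \<rho>: "\<rho> > 0" using I n by (simp add: \<rho>_def)
  obtain T where T: "degree T < d" "poly T 0 = poly P (of_real (cos \<phi>))"
    and R: "\<And>u::real. \<bar>u\<bar> \<le> \<rho> / 2 \<Longrightarrow>
      cmod (poly P (of_real (cos (\<phi> + u))) - poly T (of_real u)) \<le> 2 * exp (n * \<rho>) * S * (\<bar>u\<bar> / \<rho>) ^ d"
    using poly_cos_taylor[OF deg S \<rho> I(3)] by metis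
  define u where "u = (\<lambda>i. \<theta> i - \<phi>)"
  have ub: "\<bar>u i\<bar> \<le> 3 * real d * h" if "i \<in> I" for i using near[OF that] by (simp add: u_def)
  have ratio: "3 * real d * h / \<rho> = 3 * pi / 16384" using n I by (simp add: h \<rho>_def)
  have ur: "\<bar>u i\<bar> / \<rho> \<le> 12 / 16384" if "i \<in> I" for i
  proof -
    have "\<bar>u i\<bar> / \<rho> \<le> 3 * real d * h / \<rho>" using ub[OF that] \<rho> by (intro divide_right_mono) auto
    also have "\<dots> \<le> 12 / 16384" unfolding ratio using pi_less_4 by simp
    finally show ?thesis .
  qed
  have TU: "cmod (poly T (of_real (u i))) \<le> S / (2 * 72 ^ d) + 2 * S * (36 / 16384) ^ d" if i: "i \<in> I" for i
  proof -
    have "\<bar>u i\<bar> \<le> \<rho> / 2" using ur[OF i] \<rho> by (simp add: field_simps)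
    from R[OF this] have "cmod (poly P (of_real (cos (\<theta> i))) - poly T (of_real (u i)))
        \<le> 2 * exp (n * \<rho>) * S * (\<bar>u i\<bar> / \<rho>) ^ d" by (simp add: u_def)
    also have "\<dots> \<le> 2 * 3 ^ d * S * (12 / 16384) ^ d"
    proof -
      have "exp (n * \<rho>) = exp 1 ^ d" using n by (simp add: \<rho>_def flip: exp_of_nat_mult)
      also have "\<dots> \<le> 3 ^ d" using exp_le by (intro power_mono) auto
      finally show ?thesis using ur[OF i] S0 \<rho> by (intro mult_mono power_mono) auto
    qed
    also have "\<dots> = 2 * S * (36 / 16384) ^ d" by (simp add: mult_ac flip: power_mult_distrib)
    finally have 1: "cmod (poly P (of_real (cos (\<theta> i))) - poly T (of_real (u i))) \<le> 2 * S * (36 / 16384) ^ d" .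
    have 2: "cmod (poly P (of_real (cos (\<theta> i)))) \<le> S / (2 * 72 ^ d)"
      using small[OF i] by (simp add: field_simps)
    show ?thesis using 1 2 norm_triangle_ineq4[of "poly P (of_real (cos (\<theta> i)))" "poly P (of_real (cos (\<theta> i))) - poly T (of_real (u i))"]
      by simp
  qed
  have sep': "u i \<noteq> u j" if "i \<in> I" "j \<in> I" "i \<noteq> j" for i j
  proof
    assume "u i = u j"
    then have "\<bar>real i - real j\<bar> * (h / 2) \<le> 0" using sep[OF that(1,2)] by (simp add: u_def)
    moreover have "\<bar>real i - real j\<bar> * (h / 2) > 0" using that h0 by (intro mult_pos_pos) auto
    ultimately show False by simp
  qed
  \<comment> \<open>Every numerator is at most \<open>3 * d * h\<close> and the denominators are at
    least \<open>h / 2\<close> times index differences, whose product is at least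
    \<open>fact (d - 1) / 2 ^ (d - 1)\<close>. Together with
    \<open>d ^ d / fact d \<le> 3 ^ d\<close> this gives \<open>12 ^ d * 3 ^ d\<close>.\<close>
  have coef: "cmod (\<Prod>l\<in>I - {i}. (0 - complex_of_real (u l)) / (of_real (u i) - of_real (u l))) \<le> 36 ^ d" if i: "i \<in> I" for i
  proof -
    define A where "A = (\<lambda>l. int i - int l) ` (I - {i})"
    have injA: "inj_on (\<lambda>l. int i - int l) (I - {i})" by (auto simp: inj_on_def)
    have cA: "card A = d - 1" unfolding A_def card_image[OF injA] using I i by (simp add: card_Diff_singleton)
    have pA: "(\<Prod>x\<in>A. real_of_int \<bar>x\<bar>) = (\<Prod>l\<in>I - {i}. \<bar>real i - real l\<bar>)"
      unfolding A_def prod.reindex[OF injA] by (intro prod.cong) auto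
    have A0: "0 \<notin> A" by (auto simp: A_def)
    have f: "fact (d - 1) \<le> 2 ^ (d - 1) * (\<Prod>l\<in>I - {i}. \<bar>real i - real l\<bar>)"
      using fact_card_le_prod_abs[OF _ A0] I unfolding cA pA by (simp add: A_def)
    have ppos: "(\<Prod>l\<in>I - {i}. \<bar>real i - real l\<bar>) > 0" by (intro prod_pos) auto
    have "cmod (\<Prod>l\<in>I - {i}. (0 - complex_of_real (u l)) / (of_real (u i) - of_real (u l)))
        = (\<Prod>l\<in>I - {i}. \<bar>u l\<bar> / \<bar>u i - u l\<bar>)"
      by (simp add: norm_divide flip: prod_norm of_real_diff)
    also have "\<dots> \<le> (\<Prod>l\<in>I - {i}. (6 * real d) / \<bar>real i - real l\<bar>)"
    proof (intro prod_mono conjI)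
      fix l assume l: "l \<in> I - {i}"
      have p: "\<bar>real i - real l\<bar> > 0" using l by auto
      have "\<bar>u l\<bar> / \<bar>u i - u l\<bar> \<le> (3 * real d * h) / (\<bar>real i - real l\<bar> * (h / 2))"
        using ub[of l] sep[of i l] i l p h0 by (intro frac_le) (auto simp: u_def)
      also have "\<dots> = (6 * real d) / \<bar>real i - real l\<bar>" using h0 p by (simp add: field_simps)
      finally show "\<bar>u l\<bar> / \<bar>u i - u l\<bar> \<le> (6 * real d) / \<bar>real i - real l\<bar>" .
    qed auto
    also have "\<dots> = (6 * real d) ^ (d - 1) / (\<Prod>l\<in>I - {i}. \<bar>real i - real l\<bar>)"
      using I i by (simp add: prod_dividef card_Diff_singleton)
    also have "\<dots> \<le> (6 * real d) ^ (d - 1) / (fact (d - 1) / 2 ^ (d - 1))"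
      using f ppos by (intro divide_left_mono mult_pos_pos) (auto simp: field_simps)
    also have "\<dots> = 12 ^ (d - 1) * (real d ^ (d - 1) / fact (d - 1))"
    proof -
      have "(12::real) ^ (d - 1) = 6 ^ (d - 1) * 2 ^ (d - 1)" by (simp flip: power_mult_distrib)
      then show ?thesis by (simp add: power_mult_distrib)
    qed
    also have "real d ^ (d - 1) / fact (d - 1) = real d ^ d / fact d"
      using I(3) by (cases d) (simp_all add: fact_Suc del: of_nat_Suc)
    also have "\<dots> \<le> 3 ^ d"
    proof -
      have "real d ^ d / fact d \<le> exp (real d)" using power_self_le_exp_fact[of d] by (simp add: field_simps)
      also have "exp (real d) = exp 1 ^ d" by (simp flip: exp_of_nat_mult)
      also have "\<dots> \<le> 3 ^ d" using exp_le by (intro power_mono) auto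
      finally show ?thesis .
    qed
    also have "12 ^ (d - 1) * (3::real) ^ d \<le> 12 ^ d * 3 ^ d" by (intro mult_right_mono power_increasing) auto
    also have "\<dots> = 36 ^ d" by (simp flip: power_mult_distrib)
    finally show ?thesis by simp
  qed
  have inj: "inj_on (\<lambda>i. complex_of_real (u i)) I" using sep' by (auto simp: inj_on_def)
  \<comment> \<open>Since \<open>d \<le> 2 ^ d\<close>, the values at the nodes contribute at most S
    / 2 after amplification by \<open>d * 36 ^ d\<close>, which is why 72 appears in the claim. The
    Taylor remainders contribute \<open>2 * S * (2592 / 16384) ^ d\<close>, which is below S /
    2.\<close>
  have "S = cmod (poly T 0)" using T attained by simp
  also have "\<dots> = cmod (\<Sum>i\<in>I. poly T (of_real (u i)) * (\<Prod>l\<in>I - {i}. (0 - complex_of_real (u l)) / (of_real (u i) - of_real (u l))))"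
    using lagrange_interpolation[OF I(1) inj, of T 0] T I by simp
  also have "\<dots> \<le> (\<Sum>i\<in>I. (S / (2 * 72 ^ d) + 2 * S * (36 / 16384) ^ d) * 36 ^ d)"
    using TU coef S0 by (intro order_trans[OF norm_sum] sum_mono) (auto simp: norm_mult intro!: mult_mono)
  also have "\<dots> = real d * 36 ^ d * (S / (2 * 72 ^ d) + 2 * S * (36 / 16384) ^ d)" by (simp add: I mult_ac)
  also have "\<dots> \<le> 2 ^ d * 36 ^ d * (S / (2 * 72 ^ d) + 2 * S * (36 / 16384) ^ d)"
  proof (intro mult_right_mono)
    show "real d \<le> 2 ^ d" using less_exp[of d] by (metis less_imp_le of_nat_le_iff of_nat_numeral of_nat_power)
  qed (use S0 in auto)
  also have "\<dots> = S / 2 + 2 * S * ((72 * 36) / 16384) ^ d"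
    by (simp add: field_simps flip: power_mult_distrib)
  also have "\<dots> \<le> S / 2 + 2 * S * ((72 * 36) / 16384)"
    using S0 I power_decreasing[of 1 d "72 * 36 / 16384::real"] by auto
  also have "\<dots> < S" using S0 by simp
  finally show False by simp
qed

section \<open>The sampling measure\<close>

definition radius :: "nat \<Rightarrow> real" where
  "radius n = 1 - sigma n"

lemma radius_bounds:
  assumes "n \<ge> 1" shows "15/16 \<le> radius n" "radius n < 1" "0 < radius n"
  using sigma_bounds[OF assms] by (auto simp: radius_def)

definition mu_density :: "nat \<Rightarrow> real \<Rightarrow> real" where
  "mu_density n x = 1 / (radius n * pi) * (1 - (x / radius n)\<^sup>2) powr (-1/2)
     * indicator {- radius n<..<radius n} x"

lemma mu_eq: "mu n = density (lebesgue_on unit_ivl) (\<lambda>x. ennreal (mu_density n x))"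
proof -
  have "-1 + sigma n = - (1 - sigma n)" by simp
  then show ?thesis by (simp only: mu_def mu_density_def radius_def)
qed

lemma mu_density_nonneg: "n \<ge> 1 \<Longrightarrow> 0 \<le> mu_density n x"
  using radius_bounds[of n] by (simp add: mu_density_def)

lemma mu_density_borel [measurable]: "mu_density n \<in> borel_measurable borel"
  unfolding mu_density_def by measurable

lemma unit_ivl_borel [measurable]: "unit_ivl \<in> sets borel" "unit_ivl \<in> sets lebesgue"
  by (auto simp: unit_ivl_def)

lemma borel_imp_lebesgue_on:
  "f \<in> borel_measurable borel \<Longrightarrow> f \<in> borel_measurable (lebesgue_on unit_ivl)"
  for f :: "real \<Rightarrow> 'a::topological_space"
  by (intro measurable_restrict_space1 measurable_completion) simp

lemma space_mu [simp]: "space (mu n) = unit_ivl" and sets_mu [measurable_cong]: "sets (mu n) = sets (lebesgue_on unit_ivl)"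
  by (simp_all add: mu_eq space_restrict_space)

lemma space_rho [simp]: "space rho = unit_ivl" and sets_rho [measurable_cong]: "sets rho = sets (lebesgue_on unit_ivl)"
  by (simp_all add: rho_def space_restrict_space)

lemma borel_sets_mu: "A \<in> sets borel \<Longrightarrow> A \<subseteq> unit_ivl \<Longrightarrow> A \<in> sets (mu n)"
  by (auto simp: sets_mu sets_restrict_space_iff)

lemma nn_integral_mu_borel:
  assumes f: "f \<in> borel_measurable borel"
  shows "(\<integral>\<^sup>+x. f x \<partial>mu n) = (\<integral>\<^sup>+x. ennreal (mu_density n x) * f x * indicator unit_ivl x \<partial>lborel)"
proof -
  have "(\<integral>\<^sup>+x. f x \<partial>mu n) = (\<integral>\<^sup>+x. ennreal (mu_density n x) * f x \<partial>lebesgue_on unit_ivl)"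
    unfolding mu_eq by (intro nn_integral_density borel_imp_lebesgue_on f) measurable
  also have "\<dots> = (\<integral>\<^sup>+x. ennreal (mu_density n x) * f x * indicator unit_ivl x \<partial>lebesgue)"
    by (intro nn_integral_restrict_space) auto
  also have "\<dots> = (\<integral>\<^sup>+x. ennreal (mu_density n x) * f x * indicator unit_ivl x \<partial>lborel)"
    using f by (intro nn_integral_completion) measurable
  finally show ?thesis .
qed

text \<open>The primitive is \<open>arcsin (x / r) / pi\<close>. The density is unbounded at the
  ends of the support, so the improper fundamental theorem for nonnegative integrands is used, with
  one-sided limits of the primitive.\<close>

lemma mu_density_FTC:
  assumes n: "n \<ge> 1" and uv: "- radius n \<le> u" "u < v" "v \<le> radius n"
  shows "(\<integral>\<^sup>+x. ennreal (mu_density n x) * indicator {u<..<v} x \<partial>lborel)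
    = ennreal ((arcsin (v / radius n) - arcsin (u / radius n)) / pi)"
proof -
  let ?r = "radius n"
  have r: "?r > 0" using radius_bounds[OF n] by simp
  define F where "F = (\<lambda>x. arcsin (x / ?r) / pi)"
  have cont: "continuous_on {u..v} F" unfolding F_def
    using uv r by (intro continuous_intros) (auto simp: field_simps)
  have A: "((F \<circ> real_of_ereal) \<longlongrightarrow> F u) (at_right (ereal u))"
    and B: "((F \<circ> real_of_ereal) \<longlongrightarrow> F v) (at_left (ereal v))"
    unfolding ereal_tendsto_simps
    using continuous_on_Icc_at_rightD[OF cont uv(2)] continuous_on_Icc_at_leftD[OF cont uv(2)] by auto
  have inside: "- 1 < x / ?r" "x / ?r < 1" "(x / ?r)\<^sup>2 < 1" if "u < x" "x < v" for x
  proof -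
    show 1: "- 1 < x / ?r" "x / ?r < 1" using that uv r by (auto simp: field_simps)
    then show "(x / ?r)\<^sup>2 < 1" by (simp add: abs_square_less_1)
  qed
  have dens: "mu_density n x = inverse (sqrt (1 - (x / ?r)\<^sup>2)) / (?r * pi)" if "u < x" "x < v" for x
    using inside[OF that] that uv
    by (simp add: mu_density_def powr_minus powr_half_sqrt[symmetric] field_simps)
  have D: "DERIV F x :> inverse (sqrt (1 - (x / ?r)\<^sup>2)) / (?r * pi)" if "u < x" "x < v" for x
    unfolding F_def using inside[OF that] r
    by (auto intro!: derivative_eq_intros simp: field_simps)
  let ?f = "\<lambda>x. inverse (sqrt (1 - (x / ?r)\<^sup>2)) / (?r * pi)"
  have ae: "AE x in lborel. ereal u < ereal x \<longrightarrow> ereal x < ereal v \<longrightarrow> 0 \<le> ?f x"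
    using inside r by (auto simp: less_imp_le)
  have ic: "isCont ?f x" if "ereal u < ereal x" "ereal x < ereal v" for x
    using inside[of x] that r by (auto intro!: continuous_intros)
  have si: "set_integrable lborel (einterval (ereal u) (ereal v)) ?f"
    by (rule interval_integral_FTC_nonneg(1)[where F = F, OF _ _ ic ae A B]) (use uv D in auto)
  have iv: "(LBINT x=ereal u..ereal v. ?f x) = F v - F u"
    by (rule interval_integral_FTC_nonneg(2)[where F = F, OF _ _ ic ae A B]) (use uv D in auto)
  have "(\<integral>\<^sup>+x. ennreal (mu_density n x) * indicator {u<..<v} x \<partial>lborel)
      = (\<integral>\<^sup>+x. ennreal (indicator {u<..<v} x * ?f x) \<partial>lborel)"
    by (intro nn_integral_cong) (auto simp: dens indicator_def)
  also have "\<dots> = ennreal (\<integral>x. indicator {u<..<v} x * ?f x \<partial>lborel)"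
    using si ae by (intro nn_integral_eq_integral) (auto simp: set_integrable_def indicator_def)
  also have "(\<integral>x. indicator {u<..<v} x * ?f x \<partial>lborel) = F v - F u"
    using iv uv by (simp add: interval_lebesgue_integral_def set_lebesgue_integral_def)
  finally show ?thesis by (simp add: F_def diff_divide_distrib)
qed

text \<open>This is the uniformity of the angle: the arcsine primitive at \<open>r * cos t\<close>
  is an affine function of \<open>t\<close>.\<close>

lemma emeasure_mu_interval:
  assumes n: "n \<ge> 1" and ab: "0 \<le> a" "a < b" "b \<le> pi"
  shows "emeasure (mu n) {radius n * cos b<..radius n * cos a} = ennreal ((b - a) / pi)"
proof -
  let ?r = "radius n"
  have r: "?r > 0" "?r < 1" using radius_bounds[OF n] by auto
  have c: "cos b < cos a" using ab by (intro cos_monotone_0_pi) auto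
  have cb: "-1 \<le> cos b" "cos a \<le> 1" by auto
  have uv: "- ?r \<le> ?r * cos b" "?r * cos b < ?r * cos a" "?r * cos a \<le> ?r"
    using r c mult_left_mono[OF cb(1), of ?r] mult_left_mono[OF cb(2), of ?r] by auto
  have sub: "{?r * cos b<..?r * cos a} \<subseteq> unit_ivl" 
  proof
    fix x assume "x \<in> {?r * cos b<..?r * cos a}"
    then have "?r * cos b < x" "x \<le> ?r * cos a" by auto
    with uv r have "-1 < x" "x < 1" by linarith+
    then show "x \<in> unit_ivl" by (simp add: unit_ivl_def)
  qed
  have "emeasure (mu n) {?r * cos b<..?r * cos a} = (\<integral>\<^sup>+x. indicator {?r * cos b<..?r * cos a} x \<partial>mu n)"
    using sub by (intro nn_integral_indicator[symmetric] borel_sets_mu) auto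
  also have "\<dots> = (\<integral>\<^sup>+x. ennreal (mu_density n x) * indicator {?r * cos b<..?r * cos a} x * indicator unit_ivl x \<partial>lborel)"
    by (intro nn_integral_mu_borel) auto
  also have "\<dots> = (\<integral>\<^sup>+x. ennreal (mu_density n x) * indicator {?r * cos b<..<?r * cos a} x \<partial>lborel)"
  proof (intro nn_integral_cong_AE)
    have "AE x in lborel. x \<noteq> ?r * cos a" by (rule AE_lborel_singleton)
    then show "AE x in lborel. ennreal (mu_density n x) * indicator {?r * cos b<..?r * cos a} x * indicator unit_ivl x
        = ennreal (mu_density n x) * indicator {?r * cos b<..<?r * cos a} x"
    proof eventually_elim
      case (elim x)
      show ?case
      proof (cases "x \<in> {?r * cos b<..?r * cos a}")
        case True
        then have "x \<in> unit_ivl" using sub by blast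
        then show ?thesis using elim True by (simp add: indicator_def)
      next
        case False
        then show ?thesis by (auto simp: indicator_def)
      qed
    qed
  qed
  also have "\<dots> = ennreal ((arcsin (?r * cos a / ?r) - arcsin (?r * cos b / ?r)) / pi)"
    by (rule mu_density_FTC[OF n uv])
  also have "arcsin (?r * cos a / ?r) - arcsin (?r * cos b / ?r) = b - a"
  proof -
    have "arcsin (cos t) = pi / 2 - t" if "0 \<le> t" "t \<le> pi" for t
      using that arcsin_sin[of "pi / 2 - t"] by (simp add: cos_sin_eq)
    then show ?thesis using r ab by simp
  qed
  finally show ?thesis .
qed

lemma AE_mu_inside:
  assumes "n \<ge> 1" shows "AE x in mu n. \<bar>x\<bar> < radius n"
  unfolding mu_eq by (subst AE_density, intro borel_imp_lebesgue_on, measurable) (auto simp: mu_density_def indicator_def abs_less_iff)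

lemma prob_space_mu:
  assumes n: "n \<ge> 1" shows "prob_space (mu n)"
proof
  have "emeasure (mu n) (space (mu n)) = emeasure (mu n) {radius n * cos pi<..radius n * cos 0}"
  proof (rule emeasure_eq_AE)
    show "AE x in mu n. (x \<in> space (mu n)) = (x \<in> {radius n * cos pi<..radius n * cos 0})"
      using AE_mu_inside[OF n] by eventually_elim (use radius_bounds[OF n] in \<open>auto simp: unit_ivl_def\<close>)
    show "{radius n * cos pi<..radius n * cos 0} \<in> sets (mu n)"
      using radius_bounds[OF n] by (intro borel_sets_mu) (auto simp: unit_ivl_def)
  qed (auto intro: borel_sets_mu)
  also have "\<dots> = 1" by (subst emeasure_mu_interval[OF n]) auto
  finally show "emeasure (mu n) (space (mu n)) = 1" .
qed

lemma prob_space_rho: "prob_space rho"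
proof
  have "emeasure rho (space rho) = (\<integral>\<^sup>+x. ennreal (1/2) * indicator unit_ivl x \<partial>lebesgue_on unit_ivl)"
    unfolding space_rho unfolding rho_def by (intro emeasure_density) (auto simp: sets_restrict_space_iff)
  also have "\<dots> = ennreal (1/2) * emeasure (lebesgue_on unit_ivl) unit_ivl"
    by (intro nn_integral_cmult_indicator) (auto simp: sets_restrict_space_iff)
  also have "\<dots> = ennreal (1/2) * emeasure lborel {-1<..<1::real}"
    by (simp add: space_restrict_space emeasure_restrict_space unit_ivl_def)
  also have "emeasure lborel {-1<..<1::real} = ennreal 2" by simp
  also have "ennreal (1/2) * ennreal 2 = 1" by (subst ennreal_mult[symmetric]) auto
  finally show "emeasure rho (space rho) = 1" .
qed

text \<open>An explicit real-valued version of \<open>weight\<close> on the support, needed because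
  the Radon-Nikodym derivative is determined only almost everywhere.\<close>

definition sample_weight :: "nat \<Rightarrow> real \<Rightarrow> real" where
  "sample_weight n x = pi * radius n / 2 * sqrt (1 - (x / radius n)\<^sup>2)"

lemma sample_weight_borel [measurable]: "sample_weight n \<in> borel_measurable borel"
  unfolding sample_weight_def by measurable

lemma sample_weight_density:
  assumes n: "n \<ge> 1" and x: "\<bar>x\<bar> < radius n"
  shows "sample_weight n x * mu_density n x = 1/2" "0 < sample_weight n x" "sample_weight n x \<le> 2"
proof -
  have r: "radius n > 0" "radius n < 1" using radius_bounds[OF n] by auto
  have "\<bar>x / radius n\<bar> < 1" using x r by simp
  then have s: "(x / radius n)\<^sup>2 < 1" by (simp add: abs_square_less_1)
  show "0 < sample_weight n x" using s r by (simp add: sample_weight_def)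
  show "sample_weight n x * mu_density n x = 1/2"
    using s r x by (auto simp: sample_weight_def mu_density_def indicator_def abs_less_iff powr_minus powr_half_sqrt field_simps)
  have "sample_weight n x \<le> pi * 1 / 2 * 1"
    unfolding sample_weight_def using r s by (intro mult_mono) auto
  then show "sample_weight n x \<le> 2" using pi_less_4 by simp
qed

text \<open>\<open>mu n\<close> has density \<open>2 * mu_density n\<close> with respect to
  \<open>rho\<close>, and uniqueness of the Radon-Nikodym derivative identifies the two outside a
  \<open>rho\<close>-null set. Absolute continuity makes the exceptional set null for
  \<open>mu n\<close> as well.\<close>

lemma weight_eq_sample_weight:
  assumes n: "n \<ge> 1"
  shows "AE x in mu n. \<bar>x\<bar> < radius n \<and> weight n x = ennreal (sample_weight n x)"
proof -
  interpret rho: prob_space rho by (rule prob_space_rho)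
  have e: "ennreal (1/2) * ennreal (2 * mu_density n x) = ennreal (mu_density n x)" for x
    using mu_density_nonneg[OF n, of x] by (subst ennreal_mult[symmetric]) auto
  have d: "density rho (\<lambda>x. ennreal (2 * mu_density n x)) = mu n"
    unfolding rho_def mu_eq
    by (subst density_density_eq) (auto simp only: e intro!: borel_imp_lebesgue_on, measurable)
  have m: "(\<lambda>x. ennreal (2 * mu_density n x)) \<in> borel_measurable rho"
    unfolding measurable_cong_sets[OF sets_rho refl] by (intro borel_imp_lebesgue_on) measurable
  have "AE x in rho. ennreal (2 * mu_density n x) = RN_deriv rho (mu n) x"
    by (rule rho.RN_deriv_unique[OF m d])
  then have "AE x in mu n. ennreal (2 * mu_density n x) = RN_deriv rho (mu n) x"
    by (subst (2) d[symmetric]) (auto simp: AE_density[OF m])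
  with AE_mu_inside[OF n] show ?thesis
  proof eventually_elim
    case (elim x)
    have p: "0 < mu_density n x" using sample_weight_density[OF n, of x] elim
      by (smt (verit) mult_neg_pos zero_less_divide_1_iff mult_nonneg_nonpos)
    have "weight n x = 1 / ennreal (2 * mu_density n x)" using elim by (simp add: weight_def)
    also have "\<dots> = ennreal (1 / (2 * mu_density n x))" using p by (simp add: divide_ennreal flip: ennreal_1)
    also have "1 / (2 * mu_density n x) = sample_weight n x"
      using sample_weight_density(1)[OF n, of x] elim p by (simp add: field_simps)
    finally show ?case using elim by simp
  qed
qed

text \<open>Weight and density cancel to 1/2 on the support. Outside it the density vanishes and the
  mass of \<open>rho\<close> there is lost, hence an inequality.\<close>

lemma nn_integral_sample_weight_le:
  assumes n: "n \<ge> 1" and g: "g \<in> borel_measurable rho"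
  shows "(\<integral>\<^sup>+x. ennreal (sample_weight n x) * g x \<partial>mu n) \<le> (\<integral>\<^sup>+x. g x \<partial>rho)"
proof -
  have g' [measurable]: "g \<in> borel_measurable (lebesgue_on unit_ivl)" using g measurable_cong_sets[OF sets_rho refl] by blast
  have m [measurable]: "(\<lambda>x. ennreal (sample_weight n x)) \<in> borel_measurable (lebesgue_on unit_ivl)"
     "(\<lambda>x. ennreal (mu_density n x)) \<in> borel_measurable (lebesgue_on unit_ivl)"
    by (intro borel_imp_lebesgue_on, measurable)+
  have "(\<integral>\<^sup>+x. ennreal (sample_weight n x) * g x \<partial>mu n)
      = (\<integral>\<^sup>+x. ennreal (mu_density n x) * (ennreal (sample_weight n x) * g x) \<partial>lebesgue_on unit_ivl)"
    unfolding mu_eq by (rule nn_integral_density) measurable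
  also have "\<dots> \<le> (\<integral>\<^sup>+x. ennreal (1/2) * g x \<partial>lebesgue_on unit_ivl)"
  proof (intro nn_integral_mono)
    fix x
    have "ennreal (mu_density n x) * ennreal (sample_weight n x) \<le> ennreal (1/2)"
    proof (cases "\<bar>x\<bar> < radius n")
      case True
      have "ennreal (mu_density n x) * ennreal (sample_weight n x) = ennreal (sample_weight n x * mu_density n x)"
        using sample_weight_density(2)[OF n True] mu_density_nonneg[OF n, of x]
        by (subst mult.commute, subst ennreal_mult) auto
      then show ?thesis unfolding sample_weight_density(1)[OF n True] by simp
    next
      case False
      then have "mu_density n x = 0" by (auto simp: mu_density_def indicator_def)
      then show ?thesis by simp
    qed
    then show "ennreal (mu_density n x) * (ennreal (sample_weight n x) * g x) \<le> ennreal (1/2) * g x"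
      unfolding mult.assoc[symmetric] by (rule mult_right_mono) simp
  qed
  also have "\<dots> = (\<integral>\<^sup>+x. g x \<partial>rho)"
    unfolding rho_def by (intro nn_integral_density[symmetric] g') measurable
  finally show ?thesis .
qed

section \<open>Expectations over independent samples\<close>

text \<open>After expanding the sum, coordinate \<open>i\<close> carries
  \<open>u * h \<le> h\<close> and the other \<open>m - 1\<close> coordinates carry
  \<open>u\<close>, so the integral factorises. Multiplication by a sum over the samples thus costs
  the product only one of its factors.\<close>

lemma nn_integral_PiM_prod_sum_le:
  fixes u h :: "'a \<Rightarrow> ennreal"
  assumes M: "prob_space M" and u: "u \<in> borel_measurable M" and h: "h \<in> borel_measurable M"
    and u1: "\<And>x. u x \<le> 1"
  shows "(\<integral>\<^sup>+X. (\<Prod>j<m. u (X j)) * (\<Sum>i<m. h (X i)) \<partial>(\<Pi>\<^sub>M i\<in>{..<m}. M))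
    \<le> of_nat m * (\<integral>\<^sup>+x. h x \<partial>M) * (\<integral>\<^sup>+x. u x \<partial>M) ^ (m - 1)"
proof -
  interpret M: prob_space M by fact
  interpret product_sigma_finite "\<lambda>_. M" by (unfold_locales)
  define v where "v = (\<lambda>(i::nat) (j::nat) x. if j = i then u x * h x else u x)"
  have v: "v i j \<in> borel_measurable M" for i j using u h by (cases "j = i") (auto simp: v_def)
  have eq: "(\<Prod>j<m. u (X j)) * (\<Sum>i<m. h (X i)) = (\<Sum>i<m. \<Prod>j<m. v i j (X j))" for X :: "nat \<Rightarrow> 'a"
    unfolding sum_distrib_left
  proof (intro sum.cong refl)
    fix i assume i: "i \<in> {..<m}"
    have "(\<Prod>j<m. v i j (X j)) = v i i (X i) * (\<Prod>j\<in>{..<m} - {i}. v i j (X j))"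
      using i by (intro prod.remove) auto
    also have "(\<Prod>j\<in>{..<m} - {i}. v i j (X j)) = (\<Prod>j\<in>{..<m} - {i}. u (X j))"
      by (intro prod.cong) (auto simp: v_def)
    also have "v i i (X i) * \<dots> = (u (X i) * (\<Prod>j\<in>{..<m} - {i}. u (X j))) * h (X i)"
      by (simp add: v_def mult_ac)
    also have "u (X i) * (\<Prod>j\<in>{..<m} - {i}. u (X j)) = (\<Prod>j<m. u (X j))"
      using i by (intro prod.remove[symmetric]) auto
    finally show "(\<Prod>j<m. u (X j)) * h (X i) = (\<Prod>j<m. v i j (X j))" by simp
  qed
  have "(\<integral>\<^sup>+X. (\<Prod>j<m. u (X j)) * (\<Sum>i<m. h (X i)) \<partial>(\<Pi>\<^sub>M i\<in>{..<m}. M))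
      = (\<Sum>i<m. \<integral>\<^sup>+X. (\<Prod>j<m. v i j (X j)) \<partial>(\<Pi>\<^sub>M i\<in>{..<m}. M))"
    unfolding eq using v
    by (intro nn_integral_sum borel_measurable_prod measurable_compose[OF measurable_component_singleton]) auto
  also have "\<dots> = (\<Sum>i<m. \<Prod>j<m. \<integral>\<^sup>+x. v i j x \<partial>M)"
    using v by (intro sum.cong product_nn_integral_prod) auto
  also have "\<dots> \<le> (\<Sum>i<m. (\<integral>\<^sup>+x. h x \<partial>M) * (\<integral>\<^sup>+x. u x \<partial>M) ^ (m - 1))"
  proof (intro sum_mono)
    fix i assume i: "i \<in> {..<m}"
    have "(\<Prod>j<m. \<integral>\<^sup>+x. v i j x \<partial>M) = (\<integral>\<^sup>+x. v i i x \<partial>M) * (\<Prod>j\<in>{..<m} - {i}. \<integral>\<^sup>+x. v i j x \<partial>M)"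
      using i by (intro prod.remove) auto
    also have "(\<Prod>j\<in>{..<m} - {i}. \<integral>\<^sup>+x. v i j x \<partial>M) = (\<Prod>j\<in>{..<m} - {i}. \<integral>\<^sup>+x. u x \<partial>M)"
      by (intro prod.cong) (auto simp: v_def)
    also have "\<dots> = (\<integral>\<^sup>+x. u x \<partial>M) ^ (m - 1)" using i by (simp add: card_Diff_singleton)
    also have "(\<integral>\<^sup>+x. v i i x \<partial>M) \<le> (\<integral>\<^sup>+x. h x \<partial>M)"
      unfolding v_def using mult_right_mono[OF u1] by (intro nn_integral_mono) fastforce
    finally show "(\<Prod>j<m. \<integral>\<^sup>+x. v i j x \<partial>M) \<le> (\<integral>\<^sup>+x. h x \<partial>M) * (\<integral>\<^sup>+x. u x \<partial>M) ^ (m - 1)"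
      by (simp add: mult_right_mono)
  qed
  also have "\<dots> = of_nat m * (\<integral>\<^sup>+x. h x \<partial>M) * (\<integral>\<^sup>+x. u x \<partial>M) ^ (m - 1)" by (simp add: mult.assoc)
  finally show ?thesis .
qed

text \<open>The Laplace transform of an indicator at parameter 1:
  \<open>1 - (1 - exp (-1)) * p \<le> 1 - p / 2 \<le> exp (- p / 2)\<close>.\<close>

lemma nn_integral_damped_le:
  assumes M: "prob_space M" and S: "S \<in> sets M" and p: "emeasure M S = ennreal p" "0 \<le> p"
  shows "(\<integral>\<^sup>+x. (if x \<in> S then ennreal (exp (-1)) else 1) \<partial>M) \<le> ennreal (exp (- p / 2))"
proof -
  interpret prob_space M by fact
  have pr: "prob S = p" using p by (simp add: measure_def)
  have "(\<integral>\<^sup>+x. (if x \<in> S then ennreal (exp (-1)) else 1) \<partial>M)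
      = (\<integral>\<^sup>+x. ennreal (exp (-1)) * indicator S x + indicator (space M - S) x \<partial>M)"
    by (intro nn_integral_cong) (auto simp: indicator_def)
  also have "\<dots> = ennreal (exp (-1)) * emeasure M S + emeasure M (space M - S)"
    using S by (subst nn_integral_add) (auto simp: nn_integral_cmult_indicator)
  also have "\<dots> = ennreal (exp (-1) * p + (1 - p))"
    using p prob_compl[OF S] pr prob_le_1[of S]
    by (simp add: emeasure_eq_measure flip: ennreal_mult ennreal_plus)
  also have "exp (-1) * p + (1 - p) \<le> exp (- p / 2)"
  proof -
    have "exp (1::real) \<ge> 1 + 1" by (rule exp_ge_add_one_self)
    then have "exp (-1::real) \<le> 1/2" by (simp add: exp_minus field_simps)
    then have "exp (-1) * p \<le> 1/2 * p" using p by (intro mult_right_mono)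
    moreover have "1 + (- p / 2) \<le> exp (- p / 2)" by (rule exp_ge_add_one_self)
    ultimately show ?thesis by simp
  qed
  finally show ?thesis by (auto intro: ennreal_leI)
qed

section \<open>Cells and windows\<close>

text \<open>The constant makes a cell so short that the Taylor remainder in \<open>local_sampling\<close> is absorbed. Each \<open>cell\<close> is
  only half of a grid interval, which separates samples in adjacent cells.\<close>
definition cells :: "nat \<Rightarrow> nat" where
  "cells n = 16384 * n"

definition cell :: "nat \<Rightarrow> nat \<Rightarrow> real set" where
  "cell n c = {radius n * cos ((real c + 1) * (pi / cells n))<..radius n * cos ((real c + 1/2) * (pi / cells n))}"

text \<open>The number of grid intervals between interval \<open>k\<close> and the nearer end of
  [0, pi].\<close>

definition edge :: "nat \<Rightarrow> nat \<Rightarrow> nat" where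
  "edge n k = min k (cells n - 1 - k)"

text \<open>The window extends from cell \<open>k\<close> towards the centre, where the weight does not degenerate.\<close>
definition window :: "nat \<Rightarrow> nat \<Rightarrow> nat \<Rightarrow> nat set" where
  "window n k d = (if k < 8192 * n then {k + 1..k + 2 * d} else {k - 2 * d..<k})"

text \<open>Of the \<open>2 * d\<close> cells of a window only \<open>d\<close> have to be full. The
  slack of \<open>d\<close> cells makes failure exponentially unlikely in \<open>d * M\<close>: it
  requires \<open>d\<close> deficient cells at once.\<close>

definition sparse :: "nat \<Rightarrow> nat \<Rightarrow> nat \<Rightarrow> (nat \<Rightarrow> real) \<Rightarrow> nat \<Rightarrow> nat \<Rightarrow> bool" where
  "sparse n m M X k d \<longleftrightarrow> card {c \<in> window n k d. M \<le> card {i. i < m \<and> X i \<in> cell n c}} < d"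

lemma finite_window [simp]: "finite (window n k d)"
  by (simp add: window_def)

text \<open>The bound on \<open>d\<close> keeps the window within a quarter of all cells, so that a
  window starting in one half and directed to the centre stays away from both ends.\<close>

lemma window_props:
  assumes "d \<le> 2048 * n" "k < cells n"
  shows "card (window n k d) = 2 * d"
    and "c \<in> window n k d \<Longrightarrow> 1 \<le> c \<and> c + 1 < cells n \<and> c \<le> k + 2 * d \<and> k \<le> c + 2 * d \<and> c \<noteq> k"
  using assms by (auto simp: window_def cells_def split: if_splits)

lemma cell_angle:
  assumes n: "n \<ge> 1" and x: "x \<in> cell n c" and c: "c < cells n"
  obtains \<theta> where "x = radius n * cos \<theta>" "(real c + 1/2) * (pi / cells n) \<le> \<theta>"
    "\<theta> < (real c + 1) * (pi / cells n)"
proof -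
  have r: "radius n > 0" using radius_bounds[OF n] by simp
  define h where "h = pi / cells n"
  have h: "h > 0" "real (cells n) * h = pi" using c by (auto simp: h_def)
  have c1: "real c + 1 \<le> cells n" using c by linarith
  have b: "0 \<le> (real c + 1/2) * h" "(real c + 1/2) * h \<le> (real c + 1) * h" "(real c + 1) * h \<le> pi"
    using h mult_right_mono[OF c1, of h] by (auto intro: mult_right_mono)
  have xx: "cos ((real c + 1) * h) < x / radius n" "x / radius n \<le> cos ((real c + 1/2) * h)"
    using x r by (auto simp: cell_def h_def field_simps)
  define \<theta> where "\<theta> = arccos (x / radius n)"
  have x1: "-1 \<le> x / radius n" "x / radius n \<le> 1"
    using xx cos_ge_minus_one[of "(real c + 1) * h"] cos_le_one[of "(real c + 1/2) * h"] by linarith+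
  have \<theta>: "cos \<theta> = x / radius n" "0 \<le> \<theta>" "\<theta> \<le> pi"
    unfolding \<theta>_def using x1 by (auto simp: cos_arccos arccos_lbound arccos_ubound)
  have "(real c + 1/2) * h \<le> \<theta>"
    using xx(2) \<theta> b by (subst cos_mono_le_eq[symmetric]) auto
  moreover have "\<theta> < (real c + 1) * h"
    using xx(1) \<theta> b by (subst cos_mono_less_eq[symmetric]) auto
  moreover have "x = radius n * cos \<theta>" using \<theta> r by simp
  ultimately show thesis using that unfolding h_def by blast
qed

text \<open>Since t is at most 2, the cubic Taylor remainder \<open>t ^ 3 / 6\<close> is at most 2 t
  / 3.\<close>

lemma sin_ge_third:
  assumes "0 \<le> t" "t \<le> pi / 2" shows "t / 3 \<le> sin t"
proof -
  have "t \<le> 2" using assms pi_less_4 by simp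
  have "\<bar>sin t - t\<bar> \<le> t * (t * t) / 6"
    using Maclaurin_sin_bound[of t 3] assms by (simp add: eval_nat_numeral sin_coeff_def field_simps)
  moreover have "t * t \<le> 2 * 2" using \<open>t \<le> 2\<close> assms by (intro mult_mono) auto
  then have "t * (t * t) \<le> t * 4" using assms by (intro mult_left_mono) auto
  ultimately show ?thesis by linarith
qed

text \<open>In the angle the weight is proportional to \<open>sin \<theta>\<close>, hence comparable
  with the distance of \<theta> to the nearer end of [0, pi].\<close>

lemma sample_weight_window:
  assumes n: "n \<ge> 1" and k: "k < cells n" and d: "d \<le> 2048 * n"
    and c: "c \<in> window n k d" and x: "x \<in> cell n c"
  shows "(real (edge n k) + 1) / (2 * cells n) \<le> sample_weight n x"
proof -
  have r: "15/16 \<le> radius n" "radius n < 1" using radius_bounds[OF n] by auto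
  have cK: "c < cells n" using window_props(2)[OF d k c] by simp
  obtain \<theta> where \<theta>: "x = radius n * cos \<theta>" "(real c + 1/2) * (pi / cells n) \<le> \<theta>"
    "\<theta> < (real c + 1) * (pi / cells n)" using cell_angle[OF n x cK] by blast
  define h where "h = pi / cells n"
  have h: "h > 0" "real (cells n) * h = pi" using cK by (auto simp: h_def)
  define \<tau> where "\<tau> = \<theta> / h"
  have \<tau>: "real c + 1/2 \<le> \<tau>" "\<tau> < real c + 1" using \<theta> h by (auto simp: \<tau>_def h_def[symmetric] field_simps)
  have \<theta>\<tau>: "\<theta> = \<tau> * h" using h by (simp add: \<tau>_def)
  define e where "e = real (edge n k) + 1"
  \<comment> \<open>At its near end the window is at least \<open>e\<close> grid intervals away from
    the boundary. At its far end at least 4096 n intervals remain, and \<open>e\<close> is at most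
    8192 n; this case is the reason for halving.\<close>
  have "e / 2 \<le> \<tau> \<and> e / 2 \<le> real (cells n) - \<tau>"
  proof (cases "k < 8192 * n")
    case True
    then have "k + 1 \<le> c" "c \<le> k + 2 * d" "edge n k = k" using c by (auto simp: window_def edge_def cells_def)
    then show ?thesis using True d \<tau> by (simp add: e_def cells_def)
  next
    case False
    then have "k \<le> c + 2 * d" "c + 1 \<le> k" "real (edge n k) = real (cells n) - 1 - real k"
      using c k by (auto simp: window_def edge_def cells_def)
    then show ?thesis using False d \<tau> k by (simp add: e_def cells_def)
  qed
  then have "e / 2 * h \<le> \<tau> * h" "e / 2 * h \<le> (real (cells n) - \<tau>) * h" using h by (auto intro: mult_right_mono)
  then have lo: "e * h / 2 \<le> \<theta>" "e * h / 2 \<le> pi - \<theta>" using h by (auto simp: \<theta>\<tau> algebra_simps)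
  have e0: "e > 0" by (simp add: e_def)
  have eh0: "e * h > 0" using e0 h by simp
  have sin: "sin \<theta> \<ge> e * h / 6"
  proof (cases "\<theta> \<le> pi / 2")
    case True
    then show ?thesis using sin_ge_third[of \<theta>] lo eh0 by linarith
  next
    case False
    then show ?thesis using sin_ge_third[of "pi - \<theta>"] lo eh0 by simp
  qed
  have "sqrt (1 - (x / radius n)\<^sup>2) = sin \<theta>"
  proof -
    have "1 - (x / radius n)\<^sup>2 = (sin \<theta>)\<^sup>2" using r by (simp add: \<theta>(1) sin_squared_eq)
    then show ?thesis using sin eh0 by simp
  qed
  then have w: "sample_weight n x = pi * radius n / 2 * sin \<theta>" by (simp add: sample_weight_def)
  have "3 * (15/16) / 2 \<le> pi * radius n / 2" using r pi_gt3 by (intro divide_right_mono mult_mono) auto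
  then have "(3 * (15/16) / 2) * (e * h / 6) \<le> sample_weight n x"
    unfolding w using sin eh0 by (intro mult_mono) auto
  moreover define q where "q = e / cells n"
  have "q * 3 \<le> e * h" using e0 pi_gt3 by (simp add: h_def q_def divide_right_mono)
  moreover have "q \<ge> 0" using e0 by (simp add: q_def)
  ultimately have "q / 2 \<le> sample_weight n x" by (simp add: algebra_simps)
  then show ?thesis unfolding e_def[symmetric] by (simp add: q_def)
qed

text \<open>If each of \<open>d\<close> full cells contained a sample where \<open>p\<close> is
  small, one such sample per cell would contradict \<open>local_sampling\<close>. Hence in some full
  cell \<open>p\<close> is large at every sample, and these at least \<open>M\<close> samples alone
  make the weighted sum large.\<close>

lemma full_window_bound:
  fixes p :: "complex poly"
  assumes n: "n \<ge> 1" and deg: "degree p < n" and k: "k < cells n"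
    and \<phi>: "real k * (pi / cells n) \<le> \<phi>" "\<phi> \<le> (real k + 1) * (pi / cells n)"
    and d: "1 \<le> d" "d \<le> 2048 * n"
    and S: "\<And>x. \<bar>x\<bar> \<le> radius n \<Longrightarrow> cmod (poly p (of_real x)) \<le> S"
    and attained: "cmod (poly p (of_real (radius n * cos \<phi>))) = S"
    and full: "\<not> sparse n m M X k d"
  shows "real M * ((real (edge n k) + 1) / (2 * cells n)) * S\<^sup>2
    \<le> 4 * 5184 ^ d * (\<Sum>i | i < m \<and> \<bar>X i\<bar> < radius n. sample_weight n (X i) * (cmod (poly p (of_real (X i))))\<^sup>2)"
proof -
  have r: "15/16 \<le> radius n" "radius n < 1" using radius_bounds[OF n] by auto
  define h where "h = pi / cells n"
  have h: "h > 0" "real (cells n) * h = pi" using k by (auto simp: h_def)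
  have S0: "0 \<le> S" using attained norm_ge_zero by metis
  have "d \<le> card {c \<in> window n k d. M \<le> card {i. i < m \<and> X i \<in> cell n c}}"
    using full by (simp add: sparse_def)
  then obtain Z where Z: "Z \<subseteq> {c \<in> window n k d. M \<le> card {i. i < m \<and> X i \<in> cell n c}}" "card Z = d" "finite Z"
    by (rule obtain_subset_with_card_n)
  have "\<exists>c\<in>Z. \<forall>i<m. X i \<in> cell n c \<longrightarrow> S \<le> 2 * 72 ^ d * cmod (poly p (of_real (X i)))"
  proof (rule ccontr)
    assume "\<not> ?thesis"
    then have "\<forall>c\<in>Z. \<exists>i. i < m \<and> X i \<in> cell n c \<and> 2 * 72 ^ d * cmod (poly p (of_real (X i))) < S"
      by (auto simp: not_le)
    then obtain \<iota> where \<iota>: "\<And>c. c \<in> Z \<Longrightarrow> \<iota> c < m \<and> X (\<iota> c) \<in> cell n c \<and> 2 * 72 ^ d * cmod (poly p (of_real (X (\<iota> c)))) < S"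
      by metis
    have W: "c < cells n" "c \<le> k + 2 * d" "k \<le> c + 2 * d" if "c \<in> Z" for c
      using window_props(2)[OF d(2) k, of c] Z that by auto
    have "\<exists>\<theta>. X (\<iota> c) = radius n * cos \<theta> \<and> (real c + 1/2) * h \<le> \<theta> \<and> \<theta> < (real c + 1) * h" if c: "c \<in> Z" for c
    proof -
      have "X (\<iota> c) \<in> cell n c" using \<iota>[OF c] by simp
      then obtain t where "X (\<iota> c) = radius n * cos t" "(real c + 1/2) * h \<le> t" "t < (real c + 1) * h"
        using cell_angle[OF n _ W(1)[OF c]] unfolding h_def by metis
      then show ?thesis by blast
    qed
    then obtain \<theta> where \<theta>: "\<And>c. c \<in> Z \<Longrightarrow> X (\<iota> c) = radius n * cos (\<theta> c) \<and> (real c + 1/2) * h \<le> \<theta> c \<and> \<theta> c < (real c + 1) * h"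
      by metis
    define P where "P = pcompose p [:0, of_real (radius n):]"
    have Pp: "poly P (of_real t) = poly p (of_real (radius n * t))" for t
      by (simp add: P_def poly_pcompose mult.commute)
    have degP: "degree P \<le> n" using deg r by (simp add: P_def degree_pcompose)
    define \<tau> where "\<tau> = (\<lambda>c. \<theta> c / h)"
    have \<theta>\<tau>: "\<theta> c = \<tau> c * h" for c using h by (simp add: \<tau>_def)
    have \<tau>: "real c + 1/2 \<le> \<tau> c" "\<tau> c < real c + 1" if "c \<in> Z" for c
      using \<theta>[OF that] h by (auto simp: \<tau>_def field_simps)
    define f where "f = \<phi> / h"
    have \<phi>f: "\<phi> = f * h" using h by (simp add: f_def)
    have f: "real k \<le> f" "f \<le> real k + 1" using \<phi> h unfolding h_def[symmetric] by (auto simp: f_def field_simps)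
    have "\<exists>c\<in>Z. S \<le> 2 * 72 ^ d * cmod (poly P (of_real (cos (\<theta> c))))"
    proof (rule local_sampling[OF n degP _ _ Z(3,2) d(1)])
      fix x :: real assume x: "\<bar>x\<bar> \<le> 1"
      have "\<bar>radius n * x\<bar> \<le> radius n * 1" unfolding abs_mult using r x by (intro mult_mono) auto
      then show "cmod (poly P (of_real x)) \<le> S" unfolding Pp by (intro S) simp
    next
      show "cmod (poly P (of_real (cos \<phi>))) = S" unfolding Pp by (rule attained)
    next
      show "h = pi / (16384 * real n)" by (simp add: h_def cells_def)
    next
      fix c assume c: "c \<in> Z"
      \<comment> \<open>The cells are at most 2 d apart in index and the positions inside them add
        at most 1; d \<ge> 1 absorbs this into 3 d.\<close>
      have "\<bar>\<tau> c - f\<bar> \<le> 3 * real d" using \<tau>[OF c] f W[OF c] d by linarith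
      then have "\<bar>\<tau> c - f\<bar> * h \<le> 3 * real d * h" using h by (intro mult_right_mono) auto
      moreover have "\<theta> c - \<phi> = (\<tau> c - f) * h" by (simp add: \<theta>\<tau> \<phi>f left_diff_distrib)
      ultimately show "\<bar>\<theta> c - \<phi>\<bar> \<le> 3 * real d * h" using h by (simp add: abs_mult)
    next
      fix c c' assume c: "c \<in> Z" "c' \<in> Z"
      \<comment> \<open>Only the second half of a grid interval is used, so points of distinct cells
        differ by at least the index difference minus 1/2 in units of \<open>h\<close>, which is at
        least half of that difference.\<close>
      have "\<bar>real c - real c'\<bar> / 2 \<le> \<bar>\<tau> c - \<tau> c'\<bar>"
        using \<tau>[OF c(1)] \<tau>[OF c(2)] by (cases c c' rule: linorder_cases) auto
      then have "\<bar>real c - real c'\<bar> / 2 * h \<le> \<bar>\<tau> c - \<tau> c'\<bar> * h" using h by (intro mult_right_mono) auto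
      moreover have "\<theta> c - \<theta> c' = (\<tau> c - \<tau> c') * h" by (simp add: \<theta>\<tau> left_diff_distrib)
      ultimately show "\<bar>real c - real c'\<bar> * (h / 2) \<le> \<bar>\<theta> c - \<theta> c'\<bar>" using h by (simp add: abs_mult)
    qed
    then obtain c where c: "c \<in> Z" "S \<le> 2 * 72 ^ d * cmod (poly P (of_real (cos (\<theta> c))))" by auto
    then have "S \<le> 2 * 72 ^ d * cmod (poly p (of_real (X (\<iota> c))))"
      unfolding Pp using \<theta>[OF c(1)] by simp
    then show False using \<iota>[OF c(1)] by simp
  qed
  then obtain c where c: "c \<in> Z" and cS: "\<And>i. i < m \<Longrightarrow> X i \<in> cell n c \<Longrightarrow> S \<le> 2 * 72 ^ d * cmod (poly p (of_real (X i)))"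
    by auto
  let ?J = "{i. i < m \<and> X i \<in> cell n c}"
  let ?e = "(real (edge n k) + 1) / (2 * cells n)"
  have cw: "c \<in> window n k d" and cM: "M \<le> card ?J" using c Z by auto
  have sub: "?J \<subseteq> {i. i < m \<and> \<bar>X i\<bar> < radius n}"
  proof safe
    fix i assume i: "X i \<in> cell n c"
    have cK: "c < cells n" "1 \<le> c" "c + 1 < cells n" using window_props(2)[OF d(2) k cw] by auto
    obtain t where t: "X i = radius n * cos t" "(real c + 1/2) * h \<le> t" "t < (real c + 1) * h"
      using cell_angle[OF n i cK(1)] unfolding h_def by metis
    have "0 < (real c + 1/2) * h" using h by simp
    moreover have "(real c + 1) * h \<le> real (cells n) * h" using cK h by (intro mult_right_mono) linarith+
    ultimately have "0 < t" "t < pi" using t h by linarith+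
    then have "cos t < cos 0" "cos pi < cos t" by (auto intro!: cos_monotone_0_pi simp del: cos_zero cos_pi)
    then have "\<bar>cos t\<bar> < 1" by auto
    then show "\<bar>X i\<bar> < radius n" using t r by (simp add: abs_mult)
  qed
  have "real M * ?e * S\<^sup>2 \<le> real (card ?J) * (?e * S\<^sup>2)"
    unfolding mult.assoc using cM by (intro mult_right_mono mult_nonneg_nonneg) auto
  also have "\<dots> = (\<Sum>i\<in>?J. ?e * S\<^sup>2)" by simp
  also have "\<dots> \<le> (\<Sum>i\<in>?J. 4 * 5184 ^ d * (sample_weight n (X i) * (cmod (poly p (of_real (X i))))\<^sup>2))"
  proof (rule sum_mono)
    fix i assume i: "i \<in> ?J"
    have "S\<^sup>2 \<le> (2 * 72 ^ d * cmod (poly p (of_real (X i))))\<^sup>2" using cS[of i] i S0 by (intro power_mono) auto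
    also have "\<dots> = 4 * 5184 ^ d * (cmod (poly p (of_real (X i))))\<^sup>2"
    proof -
      have "((72::real) ^ d)\<^sup>2 = (72\<^sup>2) ^ d" by (simp only: power_mult[symmetric] mult.commute)
      then show ?thesis by (simp add: power_mult_distrib)
    qed
    finally have "?e * S\<^sup>2 \<le> sample_weight n (X i) * (4 * 5184 ^ d * (cmod (poly p (of_real (X i))))\<^sup>2)"
      using sample_weight_window[OF n k d(2) cw, of "X i"] i by (intro mult_mono) (auto intro: order_trans[rotated])
    then show "?e * S\<^sup>2 \<le> 4 * 5184 ^ d * (sample_weight n (X i) * (cmod (poly p (of_real (X i))))\<^sup>2)"
      by (simp add: mult_ac)
  qed
  also have "\<dots> = 4 * 5184 ^ d * (\<Sum>i\<in>?J. sample_weight n (X i) * (cmod (poly p (of_real (X i))))\<^sup>2)"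
    by (simp add: sum_distrib_left)
  also have "\<dots> \<le> 4 * 5184 ^ d * (\<Sum>i | i < m \<and> \<bar>X i\<bar> < radius n. sample_weight n (X i) * (cmod (poly p (of_real (X i))))\<^sup>2)"
  proof (intro mult_left_mono sum_mono2 sub)
    fix i assume "i \<in> {i. i < m \<and> \<bar>X i\<bar> < radius n} - ?J"
    then have "\<bar>X i / radius n\<bar> < 1" using r by simp
    then have "(X i / radius n)\<^sup>2 \<le> 1" by (simp add: abs_square_le_1)
    then show "0 \<le> sample_weight n (X i) * (cmod (poly p (of_real (X i))))\<^sup>2" 
      using r by (simp add: sample_weight_def)
  qed auto
  finally show ?thesis .
qed

section \<open>The random amplification factor\<close>

text \<open>The factor contributed by one sample at Chernoff parameter 1: the product over all
  samples is the exponential of minus the number of samples in the cells of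
  \<open>Z\<close>.\<close>

definition damping :: "nat \<Rightarrow> nat set \<Rightarrow> real \<Rightarrow> ennreal" where
  "damping n Z x = (if x \<in> (\<Union>c\<in>Z. cell n c) then ennreal (exp (-1)) else 1)"

text \<open>A Chernoff-type majorant of the indicator of \<open>sparse\<close>. Its product form keeps expectations
  explicit also when multiplied by a sum over the samples.\<close>
definition sparse_weight :: "nat \<Rightarrow> nat \<Rightarrow> nat \<Rightarrow> (nat \<Rightarrow> real) \<Rightarrow> nat \<Rightarrow> nat \<Rightarrow> ennreal" where
  "sparse_weight n m M X k d = (\<Sum>Z | Z \<subseteq> window n k d \<and> card Z = d.
     ennreal (exp (real (d * M))) * (\<Prod>j<m. damping n Z (X j)))"

text \<open>A sparse window has at least \<open>d\<close> cells with fewer than \<open>M\<close>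
  samples each. For a set \<open>Z\<close> of \<open>d\<close> such cells the damping product is at
  least \<open>exp (- d * M)\<close>, so the summand of this \<open>Z\<close> alone reaches
  1.\<close>

lemma one_le_sparse_weight:
  assumes k: "k < cells n" and d: "d \<le> 2048 * n" and sparse: "sparse n m M X k d"
  shows "1 \<le> sparse_weight n m M X k d"
proof -
  let ?cnt = "\<lambda>c. card {i. i < m \<and> X i \<in> cell n c}"
  let ?full = "{c \<in> window n k d. M \<le> ?cnt c}"
  have "card (window n k d - ?full) = 2 * d - card ?full"
    using window_props(1)[OF d k] by (subst card_Diff_subset) auto
  then have "d \<le> card (window n k d - ?full)" using sparse by (simp add: sparse_def)
  then obtain Z where Z: "Z \<subseteq> window n k d - ?full" "card Z = d" "finite Z"
    by (rule obtain_subset_with_card_n)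
  let ?J = "{j. j < m \<and> X j \<in> (\<Union>c\<in>Z. cell n c)}"
  have "?J = (\<Union>c\<in>Z. {i. i < m \<and> X i \<in> cell n c})" by auto
  then have "card ?J \<le> (\<Sum>c\<in>Z. ?cnt c)" using card_UN_le[OF Z(3)] by simp
  also have "\<dots> \<le> (\<Sum>c\<in>Z. M)" using Z by (intro sum_mono) (auto simp: not_le intro: less_imp_le)
  finally have J: "card ?J \<le> d * M" using Z by simp
  have "(\<Prod>j<m. damping n Z (X j)) = (\<Prod>j<m. if j \<in> ?J then ennreal (exp (-1)) else 1)"
    by (intro prod.cong) (auto simp: damping_def)
  also have "\<dots> = ennreal (exp (-1)) ^ card ({..<m} \<inter> ?J)"
    by (subst prod.If_cases) auto
  also have "{..<m} \<inter> ?J = ?J" by auto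
  also have "ennreal (exp (-1)) ^ card ?J = ennreal (exp (- real (card ?J)))"
    by (simp add: ennreal_power flip: exp_of_nat_mult)
  finally have pr: "(\<Prod>j<m. damping n Z (X j)) = ennreal (exp (- real (card ?J)))" .
  have "real (card ?J) \<le> real (d * M)" using J by (simp only: of_nat_le_iff)
  then have "exp 0 \<le> exp (real (d * M)) * exp (- real (card ?J))"
    by (subst exp_add[symmetric]) (simp del: exp_zero)
  then have "1 \<le> ennreal (exp (real (d * M))) * (\<Prod>j<m. damping n Z (X j))"
    unfolding pr by (subst ennreal_mult[symmetric]) auto
  also have "\<dots> \<le> sparse_weight n m M X k d"
    unfolding sparse_weight_def
    by (rule member_le_sum[where f = "\<lambda>Z. ennreal (exp (real (d * M))) * (\<Prod>j<m. damping n Z (X j))"])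
      (use Z in \<open>auto intro: finite_subset[OF _ finite_Pow_iff[THEN iffD2, OF finite_window[of n k d]]]\<close>)
  finally show ?thesis .
qed

lemma cell_props:
  assumes n: "n \<ge> 1" and c: "c < cells n"
  shows "cell n c \<in> sets (mu n)" "emeasure (mu n) (cell n c) = ennreal (1 / (2 * cells n))"
proof -
  define h where "h = pi / cells n"
  have h: "h > 0" "real (cells n) * h = pi" using c by (auto simp: h_def)
  have c1: "real c + 1 \<le> cells n" using c by linarith
  have b: "0 \<le> (real c + 1/2) * h" "(real c + 1/2) * h < (real c + 1) * h" "(real c + 1) * h \<le> pi"
    using h mult_right_mono[OF c1, of h] by auto
  have "emeasure (mu n) (cell n c) = ennreal (((real c + 1) * h - (real c + 1/2) * h) / pi)"
    unfolding cell_def h_def[symmetric] by (rule emeasure_mu_interval[OF n b])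
  also have "((real c + 1) * h - (real c + 1/2) * h) / pi = 1 / (2 * cells n)"
    using c by (simp add: h_def field_simps)
  finally show "emeasure (mu n) (cell n c) = ennreal (1 / (2 * cells n))" .
  have r: "0 < radius n" "radius n < 1" using radius_bounds[OF n] by auto
  have b': "radius n * cos a \<le> radius n * 1" "radius n * (-1) \<le> radius n * cos a" for a
    using r by (intro mult_left_mono; simp)+
  have "cell n c \<subseteq> unit_ivl"
  proof
    fix x assume "x \<in> cell n c"
    then have "radius n * cos ((real c + 1) * h) < x" "x \<le> radius n * cos ((real c + 1/2) * h)"
      by (auto simp: cell_def h_def)
    then have "-1 < x" "x < 1"
      using b'(2)[of "(real c + 1) * h"] b'(1)[of "(real c + 1/2) * h"] r by linarith+
    then show "x \<in> unit_ivl" by (simp add: unit_ivl_def)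
  qed
  then show "cell n c \<in> sets (mu n)" by (intro borel_sets_mu) (auto simp: cell_def)
qed

lemma cells_disjoint:
  assumes n: "n \<ge> 1" and c: "c < c'" "c' < cells n"
  shows "cell n c \<inter> cell n c' = {}"
proof -
  define h where "h = pi / cells n"
  have h: "h > 0" "real (cells n) * h = pi" using c by (auto simp: h_def)
  have c1: "real c + 1 \<le> real c' + 1/2" "real c' + 1/2 \<le> cells n" using c by linarith+
  have "cos ((real c' + 1/2) * h) \<le> cos ((real c + 1) * h)"
    using h mult_right_mono[OF c1(1), of h] mult_right_mono[OF c1(2), of h]
    by (intro cos_monotone_0_pi_le) auto
  then have "radius n * cos ((real c' + 1/2) * h) \<le> radius n * cos ((real c + 1) * h)"
    using radius_bounds[OF n] by (intro mult_left_mono) auto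
  then show ?thesis by (auto simp: cell_def h_def[symmetric])
qed

text \<open>The cells are disjoint and each fills half a grid interval, so their union has measure
  \<open>card Z / (2 * cells n)\<close>; the Laplace bound halves this once more.\<close>

lemma nn_integral_damping_le:
  assumes n: "n \<ge> 1" and Z: "\<And>c. c \<in> Z \<Longrightarrow> c < cells n" "finite Z"
  shows "damping n Z \<in> borel_measurable (mu n)"
    "(\<integral>\<^sup>+x. damping n Z x \<partial>mu n) \<le> ennreal (exp (- real (card Z) / (4 * cells n)))"
proof -
  let ?U = "\<Union>c\<in>Z. cell n c"
  have U [measurable]: "?U \<in> sets (mu n)" using cell_props[OF n Z(1)] Z(2) by (intro sets.finite_UN) auto
  show "damping n Z \<in> borel_measurable (mu n)" unfolding damping_def[abs_def] by measurable
  have "disjoint_family_on (cell n) Z"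
    using cells_disjoint[OF n] Z unfolding disjoint_family_on_def by (metis Int_commute linorder_neqE_nat)
  then have "emeasure (mu n) ?U = (\<Sum>c\<in>Z. emeasure (mu n) (cell n c))"
    using cell_props[OF n Z(1)] Z(2) by (intro sum_emeasure[symmetric]) auto
  also have "\<dots> = (\<Sum>c\<in>Z. ennreal (1 / (2 * cells n)))" using cell_props[OF n Z(1)] by (intro sum.cong) auto
  also have "\<dots> = ennreal (real (card Z) / (2 * cells n))"
    by (subst sum_ennreal) auto
  finally have U': "emeasure (mu n) ?U = ennreal (real (card Z) / (2 * cells n))" .
  show "(\<integral>\<^sup>+x. damping n Z x \<partial>mu n) \<le> ennreal (exp (- real (card Z) / (4 * cells n)))"
    using nn_integral_damped_le[OF prob_space_mu[OF n] U U'] unfolding damping_def by simp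
qed

lemma component_sample_law:
  "j < m \<Longrightarrow> g \<in> borel_measurable (mu n) \<Longrightarrow> (\<lambda>X. g (X j)) \<in> borel_measurable (sample_law n m)"
  unfolding sample_law_def by (rule measurable_compose[OF measurable_component_singleton]) auto

lemma sparse_weight_measurable:
  assumes n: "n \<ge> 1" and k: "k < cells n" and d: "d \<le> 2048 * n"
  shows "(\<lambda>X. sparse_weight n m M X k d) \<in> borel_measurable (sample_law n m)"
proof -
  have "(\<lambda>X. damping n Z (X j)) \<in> borel_measurable (sample_law n m)" if "Z \<subseteq> window n k d" "j < m" for Z j
  proof (rule component_sample_law[OF that(2)])
    show "damping n Z \<in> borel_measurable (mu n)"
      using that window_props(2)[OF d k] finite_subset[OF that(1)]
      by (intro nn_integral_damping_le[OF n]) fastforce+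
  qed
  then show ?thesis unfolding sparse_weight_def
    by (intro borel_measurable_sum borel_measurable_times_ennreal borel_measurable_prod_ennreal) auto
qed

text \<open>Here \<open>5898240 = 8 * 16384 * 45\<close>: damping then contributes \<open>exp (- 45 d M)\<close>, of which the number of
  subsets \<open>Z\<close> and the factor \<open>exp (d M)\<close> consume at most \<open>exp (3 d M)\<close>.\<close>
lemma nn_integral_sparse_weight_le:
  assumes n: "n \<ge> 1" and m: "m = 5898240 * n * M" and M: "M \<ge> 1"
    and k: "k < cells n" and d: "1 \<le> d" "d \<le> 2048 * n" and h: "h \<in> borel_measurable (mu n)"
  shows "(\<integral>\<^sup>+X. sparse_weight n m M X k d * (\<Sum>i<m. h (X i)) \<partial>sample_law n m)
    \<le> of_nat m * (\<integral>\<^sup>+x. h x \<partial>mu n) * ennreal (exp (- real (42 * d * M)))"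
proof -
  let ?Zs = "{Z. Z \<subseteq> window n k d \<and> card Z = d}"
  let ?I = "of_nat m * (\<integral>\<^sup>+x. h x \<partial>mu n)"
  have fin: "finite ?Zs" by (rule finite_subset[of _ "Pow (window n k d)"]) auto
  have Zc: "c < cells n" if "Z \<in> ?Zs" "c \<in> Z" for Z c
    using that window_props(2)[OF d(2) k, of c] by auto
  have Zf: "finite Z" if "Z \<in> ?Zs" for Z using that finite_subset[OF _ finite_window[of n k d]] by auto
  have damp: "damping n Z \<in> borel_measurable (mu n)"
      "(\<integral>\<^sup>+x. damping n Z x \<partial>mu n) \<le> ennreal (exp (- real (card Z) / (4 * cells n)))" if "Z \<in> ?Zs" for Z
    using nn_integral_damping_le[OF n, of Z] Zc[OF that] Zf[OF that] by auto
  have meas: "(\<lambda>X. (\<Prod>j<m. damping n Z (X j)) * (\<Sum>i<m. h (X i))) \<in> borel_measurable (sample_law n m)" if Z: "Z \<in> ?Zs" for Z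
    by (intro borel_measurable_times_ennreal borel_measurable_prod_ennreal borel_measurable_sum component_sample_law h damp(1)[OF Z]) auto
  have "(\<integral>\<^sup>+X. sparse_weight n m M X k d * (\<Sum>i<m. h (X i)) \<partial>sample_law n m)
      = (\<integral>\<^sup>+X. (\<Sum>Z\<in>?Zs. ennreal (exp (real (d * M))) * ((\<Prod>j<m. damping n Z (X j)) * (\<Sum>i<m. h (X i)))) \<partial>sample_law n m)"
    by (simp add: sparse_weight_def sum_distrib_right mult.assoc)
  also have "\<dots> = (\<Sum>Z\<in>?Zs. \<integral>\<^sup>+X. ennreal (exp (real (d * M))) * ((\<Prod>j<m. damping n Z (X j)) * (\<Sum>i<m. h (X i))) \<partial>sample_law n m)"
    by (intro nn_integral_sum borel_measurable_times_ennreal meas) auto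
  also have "\<dots> \<le> (\<Sum>Z\<in>?Zs. ?I * ennreal (exp (- real (44 * d * M))))"
  proof (rule sum_mono)
    fix Z assume Z: "Z \<in> ?Zs"
    have le1: "damping n Z x \<le> 1" for x by (simp add: damping_def)
    have "(\<integral>\<^sup>+X. (\<Prod>j<m. damping n Z (X j)) * (\<Sum>i<m. h (X i)) \<partial>sample_law n m)
        \<le> ?I * (\<integral>\<^sup>+x. damping n Z x \<partial>mu n) ^ (m - 1)"
      unfolding sample_law_def
      by (rule nn_integral_PiM_prod_sum_le[OF prob_space_mu[OF n] damp(1)[OF Z] h le1])
    also have "\<dots> \<le> ?I * ennreal (exp (- real (card Z) / (4 * cells n))) ^ (m - 1)"
      by (intro mult_left_mono power_mono damp(2)[OF Z]) auto
    also have "ennreal (exp (- real (card Z) / (4 * cells n))) ^ (m - 1)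
        = ennreal (exp (real (m - 1) * (- real d / (4 * cells n))))"
      using Z by (simp add: ennreal_power flip: exp_of_nat_mult)
    also have "\<dots> \<le> ennreal (exp (- real (45 * d * M)))"
    proof (intro ennreal_leI, subst exp_le_cancel_iff)
      \<comment> \<open>One of the \<open>m\<close> damping factors was given up for the summand
        \<open>h\<close>; \<open>m - 1 \<ge> m / 2\<close> costs at most half of the
        exponent.\<close>
      have "m \<ge> 2" using n M by (simp add: m)
      then have "real (m - 1) \<ge> real m / 2" by linarith
      then have "real m / 2 * (real d / (4 * cells n)) \<le> real (m - 1) * (real d / (4 * cells n))"
        by (intro mult_right_mono) auto
      moreover have "real m / 2 * (real d / (4 * cells n)) = real (45 * d * M)"
        using n by (simp add: m cells_def)
      ultimately show "real (m - 1) * (- real d / (4 * cells n)) \<le> - real (45 * d * M)" by simp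
    qed
    finally have 1: "(\<integral>\<^sup>+X. (\<Prod>j<m. damping n Z (X j)) * (\<Sum>i<m. h (X i)) \<partial>sample_law n m)
        \<le> ?I * ennreal (exp (- real (45 * d * M)))" by (simp add: mult_left_mono)
    have "(\<integral>\<^sup>+X. ennreal (exp (real (d * M))) * ((\<Prod>j<m. damping n Z (X j)) * (\<Sum>i<m. h (X i))) \<partial>sample_law n m)
        = ennreal (exp (real (d * M))) * (\<integral>\<^sup>+X. (\<Prod>j<m. damping n Z (X j)) * (\<Sum>i<m. h (X i)) \<partial>sample_law n m)"
      by (rule nn_integral_cmult[OF meas[OF Z]])
    also have "\<dots> \<le> ennreal (exp (real (d * M))) * (?I * ennreal (exp (- real (45 * d * M))))"
      by (intro mult_left_mono 1) auto
    also have "\<dots> = ?I * (ennreal (exp (real (d * M))) * ennreal (exp (- real (45 * d * M))))" by (simp add: mult_ac)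
    also have "ennreal (exp (real (d * M))) * ennreal (exp (- real (45 * d * M))) = ennreal (exp (- real (44 * d * M)))"
      by (subst ennreal_mult[symmetric]) (auto simp flip: exp_add)
    finally show "(\<integral>\<^sup>+X. ennreal (exp (real (d * M))) * ((\<Prod>j<m. damping n Z (X j)) * (\<Sum>i<m. h (X i))) \<partial>sample_law n m)
        \<le> ?I * ennreal (exp (- real (44 * d * M)))" .
  qed
  also have "\<dots> = ?I * (of_nat (card ?Zs) * ennreal (exp (- real (44 * d * M))))" by (simp add: mult_ac)
  also have "\<dots> \<le> ?I * ennreal (exp (- real (42 * d * M)))"
  proof (rule mult_left_mono)
    \<comment> \<open>A window of \<open>2 * d\<close> cells has at most \<open>2 ^ (2 * d)\<close>
      subsets, and this is at most \<open>exp (2 * d * M)\<close>.\<close>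
    have "card ?Zs \<le> card (Pow (window n k d))" by (intro card_mono) auto
    then have "card ?Zs \<le> 2 ^ (2 * d)" using window_props(1)[OF d(2) k] by (simp add: card_Pow)
    then have "real (card ?Zs) \<le> 2 ^ (2 * d)" by (metis of_nat_le_iff of_nat_numeral of_nat_power)
    also have "\<dots> \<le> exp 1 ^ (2 * d)" using exp_ge_add_one_self[of 1] by (intro power_mono) auto
    also have "\<dots> = exp (real (2 * d))" by (simp flip: exp_of_nat_mult)
    also have "\<dots> \<le> exp (real (2 * d * M))" using M by (subst exp_le_cancel_iff, subst of_nat_le_iff) simp
    finally have "real (card ?Zs) * exp (- real (44 * d * M)) \<le> exp (real (2 * d * M)) * exp (- real (44 * d * M))"
      by (intro mult_right_mono) auto
    also have "\<dots> = exp (- real (42 * d * M))" by (auto simp flip: exp_add)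
    finally have "ennreal (real (card ?Zs) * exp (- real (44 * d * M))) \<le> ennreal (exp (- real (42 * d * M)))"
      by (rule ennreal_leI)
    then show "of_nat (card ?Zs) * ennreal (exp (- real (44 * d * M))) \<le> ennreal (exp (- real (42 * d * M)))"
      by (simp add: ennreal_mult ennreal_of_nat_eq_real_of_nat)
  qed auto
  finally show ?thesis .
qed

text \<open>\<open>5184 = 72\<^sup>2\<close> is the squared amplification per full cell. The weights \<open>edge n k + 1\<close> account
  for the sampling weight being proportional to the distance from the endpoints: near the centre an amplification exponential in \<open>d\<close> is harmless.\<close>
definition amplification :: "nat \<Rightarrow> nat \<Rightarrow> nat \<Rightarrow> (nat \<Rightarrow> real) \<Rightarrow> ennreal" where
  "amplification n m M X = ennreal (5184\<^sup>2) +
     (\<Sum>k<cells n. \<Sum>d | 1 \<le> d \<and> d < 2048 * n \<and> real (edge n k) + 1 \<le> 5184 ^ d.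
        ennreal (5184 ^ (d + 1) / (real (edge n k) + 1)) * sparse_weight n m M X k d)"

section \<open>Summation over positions and window sizes\<close>

lemma sum_inverse_squares_le: "(\<Sum>k<K. 1 / (real k + 1)\<^sup>2) \<le> 2"
proof -
  have "(\<Sum>k<K. 1 / (real k + 1)\<^sup>2) \<le> 2 - 1 / real K"
  proof (induction K)
    case (Suc K)
    \<comment> \<open>The telescoping comparison starts at K = 1: for K = 0 the term
      \<open>1 / real K\<close> is 0 by the convention for division.\<close>
    show ?case
    proof (cases "K = 0")
      case False
      then have "1 / (real K + 1)\<^sup>2 \<le> 1 / real K - 1 / (real K + 1)"
        by (simp add: divide_simps power2_eq_square)
      then show ?thesis using Suc by (simp add: add.commute)
    qed simp
  qed simp
  then show ?thesis by (smt (verit) divide_nonneg_nonneg of_nat_0_le_iff)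
qed

text \<open>The minimum is one of its two arguments, so each term is at most the sum of both values;
  reflection of the index identifies the two resulting sums.\<close>

lemma sum_min_reflect_le:
  fixes f :: "nat \<Rightarrow> real"
  assumes "\<And>k. 0 \<le> f k"
  shows "(\<Sum>k<K. f (min k (K - 1 - k))) \<le> 2 * (\<Sum>k<K. f k)"
proof -
  have "(\<Sum>k<K. f (min k (K - 1 - k))) \<le> (\<Sum>k<K. f k + f (K - Suc k))"
    using assms by (intro sum_mono) (auto simp: min_def)
  also have "\<dots> = (\<Sum>k<K. f k) + (\<Sum>k<K. f k)"
    using sum.nat_diff_reindex[of f K] by (simp add: sum.distrib)
  finally show ?thesis by simp
qed

lemma sum_edge_le: "(\<Sum>k<cells n. 1 / (real (edge n k) + 1)\<^sup>2) \<le> 4"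
  using sum_min_reflect_le[of "\<lambda>k. 1 / (real k + 1)\<^sup>2" "cells n"] sum_inverse_squares_le[of "cells n"]
  by (simp add: edge_def)

text \<open>The decay \<open>exp (- 42 * d * M)\<close> is at most \<open>5184 ^ d\<close> to the
  power -3. One of the three powers cancels the amplification, one is exchanged for a second factor
  \<open>1 / (edge n k + 1)\<close> by the restriction on \<open>d\<close>, and one makes the sum
  over \<open>d\<close> geometric. The 8 is 2 for that sum times 4 for the sum over
  positions.\<close>

lemma nn_integral_amplification_le:
  assumes n: "n \<ge> 1" and m: "m = 5898240 * n * M" and M: "M \<ge> 1" and h: "h \<in> borel_measurable (mu n)"
  shows "(\<integral>\<^sup>+X. amplification n m M X * (\<Sum>i<m. h (X i)) \<partial>sample_law n m)
    \<le> of_nat m * (\<integral>\<^sup>+x. h x \<partial>mu n) * ennreal (5184\<^sup>2 + 8)"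
proof -
  let ?I = "of_nat m * (\<integral>\<^sup>+x. h x \<partial>mu n)"
  let ?D = "\<lambda>k. {d. 1 \<le> d \<and> d < 2048 * n \<and> real (edge n k) + 1 \<le> 5184 ^ d}"
  let ?c = "\<lambda>k d. 5184 ^ (d + 1) / (real (edge n k) + 1)"
  have finD: "finite (?D k)" for k by (rule finite_subset[of _ "{..<2048 * n}"]) auto
  have sums: "(\<lambda>X. \<Sum>i<m. h (X i)) \<in> borel_measurable (sample_law n m)"
    by (intro borel_measurable_sum component_sample_law h) auto
  have sw: "(\<lambda>X. sparse_weight n m M X k d * (\<Sum>i<m. h (X i))) \<in> borel_measurable (sample_law n m)"
    if "k < cells n" "d \<in> ?D k" for k d
    using that by (intro borel_measurable_times_ennreal sums sparse_weight_measurable[OF n]) auto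
  have base: "(\<integral>\<^sup>+X. (\<Sum>i<m. h (X i)) \<partial>sample_law n m) \<le> ?I"
    using nn_integral_PiM_prod_sum_le[OF prob_space_mu[OF n] _ h, of "\<lambda>_. 1" m] 
      prob_space.emeasure_space_1[OF prob_space_mu[OF n]]
    by (simp add: sample_law_def)
  have summand: "(\<integral>\<^sup>+X. ennreal (?c k d) * (sparse_weight n m M X k d * (\<Sum>i<m. h (X i))) \<partial>sample_law n m)
      \<le> ?I * ennreal ((1/2) ^ (d - 1) * (1 / (real (edge n k) + 1)\<^sup>2))" if k: "k < cells n" and d: "d \<in> ?D k" for k d
  proof -
    let ?e = "real (edge n k) + 1"
    have d': "1 \<le> d" "d \<le> 2048 * n" "?e \<le> 5184 ^ d" using d by auto
    have real: "?c k d * exp (- real (42 * d * M)) \<le> (1/2) ^ (d - 1) * (1 / ?e\<^sup>2)"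
    proof -
      have "exp (- real (42 * d * M)) \<le> exp (- real (d * 42))"
        using M by (subst exp_le_cancel_iff, subst neg_le_iff_le, subst of_nat_le_iff) simp
      also have "\<dots> = inverse ((exp 1 ^ 42) ^ d)"
        by (simp add: exp_minus power_mult[symmetric] mult.commute flip: exp_of_nat_mult)
      also have "\<dots> \<le> inverse ((5184 ^ 3) ^ d)"
      proof (intro le_imp_inverse_le power_mono)
        \<comment> \<open>The exponent 42 enters here, with the crude bound exp 1 \<ge> 2.\<close>
        have "(5184::real) ^ 3 \<le> 2 ^ 42" by simp
        also have "\<dots> \<le> exp 1 ^ 42" using exp_ge_add_one_self[of 1] by (intro power_mono) auto
        finally show "(5184::real) ^ 3 \<le> exp 1 ^ 42" .
      qed auto
      also have "\<dots> = 1 / (5184 ^ d * 5184 ^ d * 5184 ^ d)"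
        by (simp only: power3_eq_cube power_mult_distrib inverse_eq_divide)
      finally have "?c k d * exp (- real (42 * d * M)) \<le> ?c k d * (1 / (5184 ^ d * 5184 ^ d * 5184 ^ d))"
        by (intro mult_left_mono) auto
      also have "\<dots> = 5184 / 5184 ^ d * (1 / (?e * 5184 ^ d))"
      proof -
        have "b * u / e * (1 / (u * u * u)) = b / u * (1 / (e * u))" if "u \<noteq> 0" for b u e :: real
          using that by (simp add: field_simps)
        from this[of "5184 ^ d" 5184 ?e] show ?thesis by (simp only: power_add) (simp add: mult.commute)
      qed
      also have "5184 / 5184 ^ d = (1 / 5184 :: real) ^ (d - 1)" using d'(1) by (cases d) (auto simp: power_one_over)
      also have "(1 / 5184 :: real) ^ (d - 1) * (1 / (?e * 5184 ^ d)) \<le> (1/2) ^ (d - 1) * (1 / (?e * ?e))"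
        using d'(3) by (intro mult_mono power_mono divide_left_mono mult_left_mono) auto
      finally show ?thesis by (simp add: power2_eq_square)
    qed
    have "(\<integral>\<^sup>+X. ennreal (?c k d) * (sparse_weight n m M X k d * (\<Sum>i<m. h (X i))) \<partial>sample_law n m)
        = ennreal (?c k d) * (\<integral>\<^sup>+X. sparse_weight n m M X k d * (\<Sum>i<m. h (X i)) \<partial>sample_law n m)"
      by (rule nn_integral_cmult[OF sw[OF k d]])
    also have "\<dots> \<le> ennreal (?c k d) * (?I * ennreal (exp (- real (42 * d * M))))"
      by (intro mult_left_mono nn_integral_sparse_weight_le n m M k d' h) auto
    also have "\<dots> = ?I * ennreal (?c k d * exp (- real (42 * d * M)))"
      by (subst ennreal_mult) (auto simp: mult_ac)
    also have "\<dots> \<le> ?I * ennreal ((1/2) ^ (d - 1) * (1 / ?e\<^sup>2))"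
      by (intro mult_left_mono ennreal_leI real) auto
    finally show ?thesis .
  qed
  have geo: "(\<Sum>d\<in>?D k. (1/2::real) ^ (d - 1)) \<le> 2" for k
  proof -
    have "(\<Sum>d\<in>?D k. (1/2::real) ^ (d - 1)) = (\<Sum>j\<in>(\<lambda>d. d - 1) ` ?D k. (1/2) ^ j)"
      by (subst sum.reindex) (auto simp: inj_on_def)
    also have "\<dots> \<le> (\<Sum>j. (1/2::real) ^ j)" using finD by (intro sum_le_suminf) auto
    also have "\<dots> = 2" by (subst suminf_geometric) auto
    finally show ?thesis .
  qed
  have "(\<integral>\<^sup>+X. amplification n m M X * (\<Sum>i<m. h (X i)) \<partial>sample_law n m)
      = (\<integral>\<^sup>+X. ennreal (5184\<^sup>2) * (\<Sum>i<m. h (X i)) + (\<Sum>k<cells n. \<Sum>d\<in>?D k.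
          ennreal (?c k d) * (sparse_weight n m M X k d * (\<Sum>i<m. h (X i)))) \<partial>sample_law n m)"
    by (intro nn_integral_cong) (simp only: amplification_def distrib_right sum_distrib_right mult.assoc)
  also have "\<dots> = (\<integral>\<^sup>+X. ennreal (5184\<^sup>2) * (\<Sum>i<m. h (X i)) \<partial>sample_law n m) + (\<integral>\<^sup>+X. (\<Sum>k<cells n. \<Sum>d\<in>?D k.
          ennreal (?c k d) * (sparse_weight n m M X k d * (\<Sum>i<m. h (X i)))) \<partial>sample_law n m)"
    by (intro nn_integral_add borel_measurable_sum borel_measurable_times_ennreal sums sw) auto
  also have "(\<integral>\<^sup>+X. ennreal (5184\<^sup>2) * (\<Sum>i<m. h (X i)) \<partial>sample_law n m) \<le> ennreal (5184\<^sup>2) * ?I"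
    by (subst nn_integral_cmult[OF sums]) (intro mult_left_mono base; simp)
  also have "(\<integral>\<^sup>+X. (\<Sum>k<cells n. \<Sum>d\<in>?D k.
          ennreal (?c k d) * (sparse_weight n m M X k d * (\<Sum>i<m. h (X i)))) \<partial>sample_law n m)
      = (\<Sum>k<cells n. \<Sum>d\<in>?D k. \<integral>\<^sup>+X.
          ennreal (?c k d) * (sparse_weight n m M X k d * (\<Sum>i<m. h (X i))) \<partial>sample_law n m)"
    by (subst nn_integral_sum, intro borel_measurable_sum borel_measurable_times_ennreal sw)
      (auto intro!: sum.cong nn_integral_sum borel_measurable_times_ennreal sw)
  also have "\<dots> \<le> (\<Sum>k<cells n. \<Sum>d\<in>?D k. ?I * ennreal ((1/2) ^ (d - 1) * (1 / (real (edge n k) + 1)\<^sup>2)))"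
    by (intro sum_mono summand) auto
  also have "\<dots> = ?I * ennreal (\<Sum>k<cells n. \<Sum>d\<in>?D k. (1/2) ^ (d - 1) * (1 / (real (edge n k) + 1)\<^sup>2))"
    by (simp add: sum_distrib_left[symmetric] sum_nonneg)
  also have "\<dots> \<le> ?I * ennreal 8"
  proof (intro mult_left_mono ennreal_leI)
    have "(\<Sum>k<cells n. \<Sum>d\<in>?D k. (1/2) ^ (d - 1) * (1 / (real (edge n k) + 1)\<^sup>2))
        \<le> (\<Sum>k<cells n. 2 * (1 / (real (edge n k) + 1)\<^sup>2))"
      unfolding sum_distrib_right[symmetric] by (intro sum_mono mult_right_mono geo) auto
    also have "\<dots> \<le> 8" using sum_edge_le[of n] unfolding sum_distrib_left[symmetric] by simp
    finally show "(\<Sum>k<cells n. \<Sum>d\<in>?D k. (1/2) ^ (d - 1) * (1 / (real (edge n k) + 1)\<^sup>2)) \<le> 8" .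
  qed auto
  also have "ennreal (5184\<^sup>2) * ?I + ?I * ennreal 8 = ?I * ennreal (5184\<^sup>2 + 8)"
    by (subst ennreal_plus) (simp_all only: distrib_left mult.commute, simp_all)
  finally show ?thesis by (simp add: add_mono)
qed

text \<open>The constant is \<open>8 * 16384 * 5898240\<close>.\<close>
lemma sup_norm_le_amplification:
  fixes p :: "complex poly"
  assumes n: "n \<ge> 1" and deg: "degree p < n" and m: "m = 5898240 * n * M" and M: "M \<ge> 1"
    and dense: "\<And>k. k < cells n \<Longrightarrow> \<not> sparse n m M X k (2048 * n)"
    and X: "\<And>i. i < m \<Longrightarrow> \<bar>X i\<bar> < radius n"
  obtains S where "0 \<le> S" "\<And>t. \<bar>t\<bar> \<le> 1 \<Longrightarrow> cmod (poly p (of_real t)) \<le> 2 * S"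
    "ennreal (S\<^sup>2) \<le> ennreal (773094113280 * (real n)\<^sup>2 / real m *
       (\<Sum>i<m. sample_weight n (X i) * (cmod (poly p (of_real (X i))))\<^sup>2)) * amplification n m M X"
proof -
  let ?\<Sigma> = "\<Sum>i<m. sample_weight n (X i) * (cmod (poly p (of_real (X i))))\<^sup>2"
  have r: "15/16 \<le> radius n" "radius n < 1" using radius_bounds[OF n] by auto
  define h where "h = pi / cells n"
  have cn: "cells n > 0" using n by (simp add: cells_def)
  have h: "h > 0" "real (cells n) * h = pi" using cn by (auto simp: h_def)
  define g where "g = (\<lambda>\<phi>. cmod (poly p (of_real (radius n * cos \<phi>))))"
  have "continuous_on {0..pi} g" unfolding g_def by (intro continuous_intros)
  then obtain \<phi> where \<phi>: "\<phi> \<in> {0..pi}" "\<And>t. t \<in> {0..pi} \<Longrightarrow> g t \<le> g \<phi>"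
    using continuous_attains_sup[of "{0..pi}" g] pi_gt_zero by fastforce
  define S where "S = g \<phi>"
  have S0: "0 \<le> S" by (simp add: S_def g_def)
  have S: "cmod (poly p (of_real x)) \<le> S" if "\<bar>x\<bar> \<le> radius n" for x
  proof -
    have x1: "-1 \<le> x / radius n" "x / radius n \<le> 1" using that r by (auto simp: field_simps)
    have "g (arccos (x / radius n)) = cmod (poly p (of_real x))"
      unfolding g_def using x1 r by (simp add: cos_arccos)
    moreover have "arccos (x / radius n) \<in> {0..pi}" using x1 by (simp add: arccos_lbound arccos_ubound)
    ultimately show ?thesis using \<phi>(2) unfolding S_def by metis
  qed
  \<comment> \<open>The minimum serves \<phi> = pi, for which the floor is one past the last
    index.\<close>
  define k where "k = min (nat \<lfloor>\<phi> / h\<rfloor>) (cells n - 1)"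
  have k: "k < cells n" using cn by (simp add: k_def)
  have fh: "0 \<le> \<phi> / h" "\<phi> / h \<le> cells n" using \<phi>(1) h by (auto simp: field_simps)
  have fl: "real (nat \<lfloor>\<phi> / h\<rfloor>) \<le> \<phi> / h" "\<phi> / h < real (nat \<lfloor>\<phi> / h\<rfloor>) + 1"
    using fh(1) by linarith+
  have "real k \<le> \<phi> / h" "\<phi> / h \<le> real k + 1" using fh fl cn by (auto simp: k_def min_def)
  then have k\<phi>: "real k * (pi / cells n) \<le> \<phi>" "\<phi> \<le> (real k + 1) * (pi / cells n)"
    unfolding h_def[symmetric] using h by (auto simp: field_simps)
  \<comment> \<open>The least full window; size \<open>2048 * n\<close> is full by assumption. By
    minimality the size \<open>d - 1\<close>, if positive, is sparse, which matches the shifted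
    power \<open>5184 ^ (d + 1)\<close> in \<open>amplification\<close>.\<close>
  define d where "d = (LEAST d. 1 \<le> d \<and> \<not> sparse n m M X k d)"
  have ex: "1 \<le> 2048 * n \<and> \<not> sparse n m M X k (2048 * n)" using n dense[OF k] by simp
  have d: "1 \<le> d" "\<not> sparse n m M X k d" using LeastI[of "\<lambda>d. 1 \<le> d \<and> \<not> sparse n m M X k d", OF ex] by (auto simp: d_def)
  have d2: "d \<le> 2048 * n" unfolding d_def by (rule Least_le[where P = "\<lambda>d. 1 \<le> d \<and> \<not> sparse n m M X k d", OF ex])
  have dmin: "sparse n m M X k d'" if "1 \<le> d'" "d' < d" for d'
    using not_less_Least[of d' "\<lambda>d. 1 \<le> d \<and> \<not> sparse n m M X k d"] that by (auto simp: d_def)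
  define e where "e = real (edge n k) + 1"
  have e: "e \<ge> 1" by (simp add: e_def)
  have sub: "{i. i < m \<and> \<bar>X i\<bar> < radius n} = {..<m}" using X by auto
  have "real M * (e / (2 * cells n)) * S\<^sup>2 \<le> 4 * 5184 ^ d * ?\<Sigma>"
    unfolding sub[symmetric] e_def
  proof (rule full_window_bound[OF n deg k k\<phi> d(1) d2])
    show "cmod (poly p (of_real (radius n * cos \<phi>))) = S" by (simp add: S_def g_def)
  qed (use S d in auto)
  then have "S\<^sup>2 \<le> 4 * 5184 ^ d * ?\<Sigma> / (real M * (e / (2 * cells n)))"
    using M e cn by (subst pos_le_divide_eq) (auto simp: mult.commute)
  also have "\<dots> = 773094113280 * (real n)\<^sup>2 / real m * ?\<Sigma> * (5184 ^ d / e)"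
    using M e cn n by (simp add: m cells_def field_simps power2_eq_square)
  finally have S2: "S\<^sup>2 \<le> 773094113280 * (real n)\<^sup>2 / real m * ?\<Sigma> * (5184 ^ d / e)" .
  \<comment> \<open>If \<open>e \<le> 5184 ^ (d - 1)\<close>, sparseness at size
    \<open>d - 1\<close> makes the corresponding summand large enough. Otherwise, and for
    \<open>d = 1\<close>, the ratio is at most 5184 and the constant term suffices.\<close>
  have amp: "ennreal (5184 ^ d / e) \<le> amplification n m M X"
  proof (cases "\<exists>d'\<ge>1. d = Suc d' \<and> e \<le> 5184 ^ d'")
    case True
    then obtain d' where d': "1 \<le> d'" "d = Suc d'" "e \<le> 5184 ^ d'" by auto
    have sp: "sparse n m M X k d'" using dmin d' by simp
    let ?D = "\<lambda>k. {d. 1 \<le> d \<and> d < 2048 * n \<and> real (edge n k) + 1 \<le> 5184 ^ d}"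
    let ?t = "\<lambda>k d. ennreal (5184 ^ (d + 1) / (real (edge n k) + 1)) * sparse_weight n m M X k d"
    have "ennreal (5184 ^ d / e) * 1 \<le> ennreal (5184 ^ d / e) * sparse_weight n m M X k d'"
      using one_le_sparse_weight[OF k _ sp] d2 d' by (intro mult_left_mono) auto
    also have "\<dots> = ?t k d'" by (simp add: d' e_def)
    also have "\<dots> \<le> (\<Sum>d\<in>?D k. ?t k d)"
      using d' d2 by (intro member_le_sum) (auto simp: e_def intro: finite_subset[of _ "{..<2048 * n}"])
    also have "\<dots> \<le> (\<Sum>k<cells n. \<Sum>d\<in>?D k. ?t k d)"
      using k by (intro member_le_sum) auto
    also have "\<dots> \<le> amplification n m M X" by (simp add: amplification_def)
    finally show ?thesis by simp
  next
    case False
    have "5184 ^ d / e \<le> 5184\<^sup>2"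
    proof (cases "d = 1")
      case True
      have "5184 / e \<le> 5184 / 1" using e by (intro divide_left_mono) auto
      then show ?thesis using True by simp
    next
      case d1: False
      then obtain d' where d': "d = Suc d'" "1 \<le> d'" using d(1) by (cases d) auto
      then have "5184 ^ d' \<le> e" using False by force
      then have "5184 ^ d / e \<le> 5184 * e / e" using e d' by (intro divide_right_mono) auto
      then show ?thesis using e by simp
    qed
    then have "ennreal (5184 ^ d / e) \<le> ennreal (5184\<^sup>2)" by (rule ennreal_leI)
    also have "\<dots> \<le> amplification n m M X" unfolding amplification_def by simp
    finally show ?thesis .
  qed
  have "?\<Sigma> \<ge> 0" using sample_weight_density(2)[OF n X] by (intro sum_nonneg mult_nonneg_nonneg) (auto intro: less_imp_le)
  then have "ennreal (S\<^sup>2) \<le> ennreal (773094113280 * (real n)\<^sup>2 / real m * ?\<Sigma>) * ennreal (5184 ^ d / e)"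
    using S2 e by (subst ennreal_mult[symmetric]) (auto intro: ennreal_leI)
  also have "\<dots> \<le> ennreal (773094113280 * (real n)\<^sup>2 / real m * ?\<Sigma>) * amplification n m M X"
    by (intro mult_left_mono amp) auto
  finally have 1: "ennreal (S\<^sup>2) \<le> ennreal (773094113280 * (real n)\<^sup>2 / real m * ?\<Sigma>) * amplification n m M X" .
  have 2: "cmod (poly p (of_real t)) \<le> 2 * S" if "\<bar>t\<bar> \<le> 1" for t
    using poly_bound_extend[OF n less_imp_le[OF deg] _ that, of S] S by (simp add: radius_def)
  show thesis using that[OF S0 2 1] by blast
qed

lemma amplification_measurable:
  assumes n: "n \<ge> 1" shows "amplification n m M \<in> borel_measurable (sample_law n m)"
  unfolding amplification_def[abs_def]
  by (intro borel_measurable_add borel_measurable_sum borel_measurable_times_ennreal sparse_weight_measurable n) auto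

section \<open>The good event\<close>

text \<open>For \<open>a = 0\<close> the threshold is 0 and the normalised form of Markov's
  inequality degenerates; then \<open>Y\<close> vanishes almost everywhere.\<close>

lemma markov_bound:
  fixes Y :: "'a \<Rightarrow> ennreal"
  assumes Y: "Y \<in> borel_measurable N" and le: "(\<integral>\<^sup>+x. Y x \<partial>N) \<le> ennreal a" and a: "0 \<le> a" and \<delta>: "0 < \<delta>"
  shows "emeasure N {x \<in> space N. \<not> Y x \<le> ennreal (a / \<delta>)} \<le> ennreal \<delta>"
proof (cases "a = 0")
  case True
  then have "AE x in N. Y x = 0" using le Y by (simp add: nn_integral_0_iff_AE)
  then have "AE x in N. x \<notin> {x \<in> space N. \<not> Y x \<le> ennreal (a / \<delta>)}" by eventually_elim simp
  moreover have "{x \<in> space N. \<not> Y x \<le> ennreal (a / \<delta>)} \<in> sets N" using Y by measurable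
  ultimately have "emeasure N {x \<in> space N. \<not> Y x \<le> ennreal (a / \<delta>)} = 0" by (simp add: AE_iff_measurable)
  then show ?thesis by simp
next
  case False
  then have a0: "a > 0" using a by simp
  have "emeasure N {x \<in> space N. \<not> Y x \<le> ennreal (a / \<delta>)} \<le> emeasure N {x \<in> space N. 1 \<le> ennreal (\<delta> / a) * Y x}"
  proof (rule emeasure_mono)
    show "{x \<in> space N. 1 \<le> ennreal (\<delta> / a) * Y x} \<in> sets N" using Y by measurable
    show "{x \<in> space N. \<not> Y x \<le> ennreal (a / \<delta>)} \<subseteq> {x \<in> space N. 1 \<le> ennreal (\<delta> / a) * Y x}"
    proof safe
      fix x assume "\<not> Y x \<le> ennreal (a / \<delta>)"
      then have "ennreal (\<delta> / a) * ennreal (a / \<delta>) \<le> ennreal (\<delta> / a) * Y x" by (intro mult_left_mono) auto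
      moreover have "ennreal (\<delta> / a) * ennreal (a / \<delta>) = 1"
        using a0 \<delta> by (subst ennreal_mult[symmetric]) auto
      ultimately show "1 \<le> ennreal (\<delta> / a) * Y x" by simp
    qed
  qed
  also have "\<dots> \<le> ennreal (\<delta> / a) * (\<integral>\<^sup>+x. Y x * indicator (space N) x \<partial>N)"
    using Y by (intro nn_integral_Markov_inequality) auto
  also have "(\<integral>\<^sup>+x. Y x * indicator (space N) x \<partial>N) = (\<integral>\<^sup>+x. Y x \<partial>N)"
    by (intro nn_integral_cong) auto
  also have "ennreal (\<delta> / a) * (\<integral>\<^sup>+x. Y x \<partial>N) \<le> ennreal (\<delta> / a) * ennreal a"
    by (intro mult_left_mono le) auto
  also have "\<dots> = ennreal \<delta>" using a0 \<delta> by (subst ennreal_mult[symmetric]) auto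
  finally show ?thesis .
qed

text \<open>At the largest window size no bigger window can take over, so failure at any position
  has to be excluded outright. Here the plain union bound is affordable: each position costs
  \<open>exp (- 86016 * n * M)\<close>, and the lower bound on \<open>n * M\<close> pays for the
  number of cells and for \<epsilon>.\<close>

lemma prob_sparse_top:
  assumes n: "n \<ge> 1" and m: "m = 5898240 * n * M" and M: "M \<ge> 1"
    and \<epsilon>: "0 < \<epsilon>" "\<epsilon> < 1" and nM: "real n * real M \<ge> real n + ln (1 / \<epsilon>)"
  shows "emeasure (sample_law n m) {X \<in> space (sample_law n m). \<not> (\<Sum>k<cells n. sparse_weight n m M X k (2048 * n)) < 1} \<le> ennreal (\<epsilon> / 4)"
proof -
  let ?Y = "\<lambda>X. \<Sum>k<cells n. sparse_weight n m M X k (2048 * n)"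
  let ?T = "2048 * n"
  have m0: "m > 0" using n M by (simp add: m)
  have sw: "(\<lambda>X. sparse_weight n m M X k ?T) \<in> borel_measurable (sample_law n m)" if "k < cells n" for k
    using sparse_weight_measurable[OF n that] by simp
  have Y: "?Y \<in> borel_measurable (sample_law n m)" by (intro borel_measurable_sum sw) auto
  interpret prob_space "mu n" by (rule prob_space_mu[OF n])
  have "(\<integral>\<^sup>+X. ?Y X \<partial>sample_law n m) = (\<Sum>k<cells n. \<integral>\<^sup>+X. sparse_weight n m M X k ?T \<partial>sample_law n m)"
    by (intro nn_integral_sum sw) auto
  also have "\<dots> \<le> (\<Sum>k<cells n. ennreal (exp (- real (42 * ?T * M))))"
  proof (rule sum_mono)
    fix k assume k: "k \<in> {..<cells n}"
    \<comment> \<open>Constant summands \<open>1 / m\<close> add up to 1, so the estimate for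
      products with a sum yields the plain expectation.\<close>
    have s1: "(\<Sum>i<m. ennreal (1 / real m)) = 1"
      using m0 by (subst sum_ennreal) auto
    have "(\<integral>\<^sup>+X. sparse_weight n m M X k ?T \<partial>sample_law n m)
        = (\<integral>\<^sup>+X. sparse_weight n m M X k ?T * (\<Sum>i<m. ennreal (1 / real m)) \<partial>sample_law n m)"
      unfolding s1 by simp
    also have "\<dots> \<le> of_nat m * (\<integral>\<^sup>+x. ennreal (1 / real m) \<partial>mu n) * ennreal (exp (- real (42 * ?T * M)))"
      using k n by (intro nn_integral_sparse_weight_le[OF n m M]) auto
    also have "of_nat m * (\<integral>\<^sup>+x. ennreal (1 / real m) \<partial>mu n) = 1"
      using m0 emeasure_space_1 by (simp add: ennreal_of_nat_eq_real_of_nat flip: ennreal_mult del: ennreal_1)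
    finally show "(\<integral>\<^sup>+X. sparse_weight n m M X k ?T \<partial>sample_law n m) \<le> ennreal (exp (- real (42 * ?T * M)))" by simp
  qed
  also have "\<dots> = ennreal (real (cells n) * exp (- real (42 * ?T * M)))"
    by (simp add: ennreal_of_nat_eq_real_of_nat ennreal_mult)
  also have "\<dots> \<le> ennreal (\<epsilon> / 4)"
  proof (rule ennreal_leI)
    have l: "ln (1 / \<epsilon>) \<ge> 0" using \<epsilon> by simp
    have "real (42 * ?T * M) = 86016 * (real n * real M)" by simp
    also have "\<dots> \<ge> 86016 * (real n + ln (1 / \<epsilon>))" using nM by simp
    finally have "- real (42 * ?T * M) \<le> - (86016 * real n) + - ln (1 / \<epsilon>)" using l by simp
    then have "exp (- real (42 * ?T * M)) \<le> exp (- (86016 * real n) + - ln (1 / \<epsilon>))" by simp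
    also have "\<dots> = exp (- (86016 * real n)) * \<epsilon>" using \<epsilon> by (simp only: exp_add) (simp add: ln_div)
    finally have "real (cells n) * exp (- real (42 * ?T * M)) \<le> real (cells n) * exp (- (86016 * real n)) * \<epsilon>"
      by (simp add: mult.assoc mult_left_mono)
    also have "real (cells n) * exp (- (86016 * real n)) \<le> 1 / 4"
    proof -
      have "4 * real (cells n) \<le> 1 + 86016 * real n" by (simp add: cells_def)
      also have "\<dots> \<le> exp (86016 * real n)" by (rule exp_ge_add_one_self)
      finally show ?thesis by (simp add: exp_minus field_simps)
    qed
    finally show "real (cells n) * exp (- real (42 * ?T * M)) \<le> \<epsilon> / 4" using \<epsilon> by simp
  qed
  finally have le: "(\<integral>\<^sup>+X. ?Y X \<partial>sample_law n m) \<le> ennreal (\<epsilon> / 4)" .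
  have "emeasure (sample_law n m) {X \<in> space (sample_law n m). \<not> ?Y X < 1}
      = emeasure (sample_law n m) {X \<in> space (sample_law n m). 1 \<le> 1 * ?Y X}"
    by (simp add: not_less)
  also have "\<dots> \<le> 1 * (\<integral>\<^sup>+X. ?Y X * indicator (space (sample_law n m)) X \<partial>sample_law n m)"
    using Y by (intro nn_integral_Markov_inequality) auto
  also have "\<dots> = (\<integral>\<^sup>+X. ?Y X \<partial>sample_law n m)" by (auto intro!: nn_integral_cong)
  finally show ?thesis using le by (rule order_trans)
qed

text \<open>Three exceptional events of probability at most \<epsilon> / 4 each, and a null set on
  which the weight differs from its explicit form or a sample leaves the support, are removed. The
  event is chosen from the samples and \<open>h\<close> before any noise is considered.\<close>

lemma good_event:
  assumes n: "n \<ge> 1" and m: "m = 5898240 * n * M" and M: "M \<ge> 1"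
    and \<epsilon>: "0 < \<epsilon>" "\<epsilon> < 1" and nM: "real n * real M \<ge> real n + ln (1 / \<epsilon>)"
    and h: "h \<in> borel_measurable (mu n)" "(\<integral>\<^sup>+x. h x \<partial>mu n) \<le> ennreal b" "0 \<le> b"
  obtains E where "E \<in> sets (sample_law n m)" "measure (sample_law n m) E \<ge> 1 - \<epsilon>"
    "\<And>X i. X \<in> E \<Longrightarrow> i < m \<Longrightarrow> \<bar>X i\<bar> < radius n \<and> weight n (X i) = ennreal (sample_weight n (X i))"
    "\<And>X k. X \<in> E \<Longrightarrow> k < cells n \<Longrightarrow> \<not> sparse n m M X k (2048 * n)"
    "\<And>X. X \<in> E \<Longrightarrow> amplification n m M X * (\<Sum>i<m. h (X i)) \<le> ennreal (real m * b * (5184\<^sup>2 + 8) / (\<epsilon> / 4))"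
    "\<And>X. X \<in> E \<Longrightarrow> amplification n m M X * of_nat m \<le> ennreal (real m * (5184\<^sup>2 + 8) / (\<epsilon> / 4))"
proof -
  let ?N = "sample_law n m"
  interpret mu: prob_space "mu n" by (rule prob_space_mu[OF n])
  interpret N: prob_space ?N unfolding sample_law_def by (intro prob_space_PiM prob_space_mu n)
  have \<epsilon>4: "\<epsilon> / 4 > 0" using \<epsilon> by simp
  define good where "good = (\<lambda>x. \<bar>x\<bar> < radius n \<and> weight n x = ennreal (sample_weight n x))"
  have ae: "AE x in mu n. good x" unfolding good_def by (rule weight_eq_sample_weight[OF n])
  have "AE X in ?N. \<forall>i\<in>{..<m}. good (X i)"
    unfolding sample_law_def by (intro AE_finite_allI AE_PiM_component prob_space_mu n ae) auto
  then obtain B0 where B0: "{X \<in> space ?N. \<not> (\<forall>i\<in>{..<m}. good (X i))} \<subseteq> B0" "emeasure ?N B0 = 0" "B0 \<in> sets ?N"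
    by (rule AE_E)
  define tw where "tw = (\<lambda>X. \<Sum>k<cells n. sparse_weight n m M X k (2048 * n))"
  define Y1 where "Y1 = (\<lambda>X. amplification n m M X * (\<Sum>i<m. h (X i)))"
  define Y2 where "Y2 = (\<lambda>X. amplification n m M X * of_nat m)"
  define B1 where "B1 = {X \<in> space ?N. \<not> tw X < 1}"
  define B2 where "B2 = {X \<in> space ?N. \<not> Y1 X \<le> ennreal (real m * b * (5184\<^sup>2 + 8) / (\<epsilon> / 4))}"
  define B3 where "B3 = {X \<in> space ?N. \<not> Y2 X \<le> ennreal (real m * (5184\<^sup>2 + 8) / (\<epsilon> / 4))}"
  have tw: "tw \<in> borel_measurable ?N"
    unfolding tw_def by (intro borel_measurable_sum sparse_weight_measurable[OF n]) auto
  have Y1: "Y1 \<in> borel_measurable ?N" unfolding Y1_def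
    by (intro borel_measurable_times_ennreal amplification_measurable[OF n] borel_measurable_sum component_sample_law h) auto
  have Y2: "Y2 \<in> borel_measurable ?N" unfolding Y2_def
    by (intro borel_measurable_times_ennreal amplification_measurable[OF n]) auto
  have sets: "B1 \<in> sets ?N" "B2 \<in> sets ?N" "B3 \<in> sets ?N"
    unfolding B1_def B2_def B3_def using tw Y1 Y2 by measurable
  have "emeasure ?N B1 \<le> ennreal (\<epsilon> / 4)"
    unfolding B1_def tw_def by (rule prob_sparse_top[OF n m M \<epsilon> nM])
  moreover have "emeasure ?N B2 \<le> ennreal (\<epsilon> / 4)" unfolding B2_def
  proof (rule markov_bound[OF Y1 _ _ \<epsilon>4])
    have "(\<integral>\<^sup>+X. Y1 X \<partial>?N) \<le> of_nat m * (\<integral>\<^sup>+x. h x \<partial>mu n) * ennreal (5184\<^sup>2 + 8)"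
      unfolding Y1_def by (rule nn_integral_amplification_le[OF n m M h(1)])
    also have "\<dots> \<le> of_nat m * ennreal b * ennreal (5184\<^sup>2 + 8)"
      by (intro mult_right_mono mult_left_mono h) auto
    also have "\<dots> = ennreal (real m * b * (5184\<^sup>2 + 8))"
      using h(3) by (simp only: ennreal_mult ennreal_of_nat_eq_real_of_nat mult_nonneg_nonneg of_nat_0_le_iff zero_le_power2 add_nonneg_nonneg zero_le_numeral)
    finally show "(\<integral>\<^sup>+X. Y1 X \<partial>?N) \<le> ennreal (real m * b * (5184\<^sup>2 + 8))" .
  qed (use h in auto)
  moreover have "emeasure ?N B3 \<le> ennreal (\<epsilon> / 4)" unfolding B3_def
  proof (rule markov_bound[OF Y2 _ _ \<epsilon>4])
    have "(\<integral>\<^sup>+X. Y2 X \<partial>?N) \<le> of_nat m * (\<integral>\<^sup>+x. 1 \<partial>mu n) * ennreal (5184\<^sup>2 + 8)"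
      using nn_integral_amplification_le[OF n m M, of "\<lambda>_. 1"] by (simp add: Y2_def)
    also have "\<dots> = of_nat m * ennreal (5184\<^sup>2 + 8)" using mu.emeasure_space_1 by simp
    also have "\<dots> = ennreal (real m * (5184\<^sup>2 + 8))"
      by (simp only: ennreal_mult ennreal_of_nat_eq_real_of_nat mult_nonneg_nonneg of_nat_0_le_iff zero_le_power2 add_nonneg_nonneg zero_le_numeral)
    finally show "(\<integral>\<^sup>+X. Y2 X \<partial>?N) \<le> ennreal (real m * (5184\<^sup>2 + 8))" .
  qed auto
  ultimately have b: "measure ?N B1 \<le> \<epsilon> / 4" "measure ?N B2 \<le> \<epsilon> / 4" "measure ?N B3 \<le> \<epsilon> / 4"
    using \<epsilon> by (auto simp: N.emeasure_eq_measure)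
  have b0: "measure ?N B0 = 0" using B0 by (simp add: measure_def)
  define E where "E = space ?N - (B0 \<union> B1 \<union> B2 \<union> B3)"
  have "measure ?N (B0 \<union> B1 \<union> B2 \<union> B3) \<le> measure ?N B0 + measure ?N B1 + measure ?N B2 + measure ?N B3"
    using B0 sets by (intro order_trans[OF measure_Un_le] add_mono order_refl) auto
  then have "measure ?N (B0 \<union> B1 \<union> B2 \<union> B3) \<le> \<epsilon>" using b b0 \<epsilon> by linarith
  then have "measure ?N E \<ge> 1 - \<epsilon>" unfolding E_def using B0 sets by (subst N.prob_compl) auto
  moreover have "E \<in> sets ?N" unfolding E_def using B0 sets by auto
  moreover have "\<bar>X i\<bar> < radius n \<and> weight n (X i) = ennreal (sample_weight n (X i))" if "X \<in> E" "i < m" for X i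
    using that B0(1) by (auto simp: E_def good_def)
  moreover have "\<not> sparse n m M X k (2048 * n)" if X: "X \<in> E" and k: "k < cells n" for X k
  proof
    assume "sparse n m M X k (2048 * n)"
    then have "1 \<le> sparse_weight n m M X k (2048 * n)" using one_le_sparse_weight[OF k] by simp
    also have "\<dots> \<le> tw X" unfolding tw_def using k by (intro member_le_sum) auto
    finally show False using X by (auto simp: E_def B1_def)
  qed
  moreover have "amplification n m M X * (\<Sum>i<m. h (X i)) \<le> ennreal (real m * b * (5184\<^sup>2 + 8) / (\<epsilon> / 4))" if "X \<in> E" for X
    using that unfolding E_def B2_def Y1_def by blast
  moreover have "amplification n m M X * of_nat m \<le> ennreal (real m * (5184\<^sup>2 + 8) / (\<epsilon> / 4))" if "X \<in> E" for X
    using that unfolding E_def B3_def Y2_def by blast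
  ultimately show thesis using that by blast
qed

section \<open>Weighted least squares\<close>

definition weighted_inner :: "nat \<Rightarrow> (nat \<Rightarrow> real) \<Rightarrow> (nat \<Rightarrow> complex) \<Rightarrow> (nat \<Rightarrow> complex) \<Rightarrow> complex" where
  "weighted_inner m w u v = (\<Sum>i<m. of_real (w i) * u i * cnj (v i))"

lemma weighted_inner_linear:
  "weighted_inner m w (\<lambda>i. u i + u' i) v = weighted_inner m w u v + weighted_inner m w u' v"
  "weighted_inner m w (\<lambda>i. u i - u' i) v = weighted_inner m w u v - weighted_inner m w u' v"
  "weighted_inner m w (\<lambda>i. a * u i) v = a * weighted_inner m w u v"
  "weighted_inner m w v (\<lambda>i. u i + u' i) = weighted_inner m w v u + weighted_inner m w v u'"
  "weighted_inner m w v (\<lambda>i. a * u i) = cnj a * weighted_inner m w v u"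
  by (simp_all add: weighted_inner_def algebra_simps sum.distrib sum_subtractf sum_distrib_left)

lemma weighted_inner_commute: "weighted_inner m w v u = cnj (weighted_inner m w u v)"
  by (simp add: weighted_inner_def mult_ac)

lemma weighted_inner_self: "weighted_inner m w u u = of_real (\<Sum>i<m. w i * (cmod (u i))\<^sup>2)"
  unfolding weighted_inner_def by (simp add: complex_norm_square[symmetric] mult.assoc)

text \<open>Gram--Schmidt along the degree; the zero polynomial is added because \<open>degree 0 = 0\<close>.\<close>
lemma weighted_projection_exists:
  fixes z :: "nat \<Rightarrow> complex"
  assumes definite: "\<And>p. p = 0 \<or> degree p < n \<Longrightarrow> (\<Sum>i<m. w i * (cmod (poly p (z i)))\<^sup>2) = 0 \<Longrightarrow> p = 0"
    and k: "k \<le> n"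
  shows "\<exists>p. (p = 0 \<or> degree p < k) \<and> (\<forall>q. q = 0 \<or> degree q < k \<longrightarrow>
    weighted_inner m w (\<lambda>i. y i - poly p (z i)) (\<lambda>i. poly q (z i)) = 0)"
  using k
proof (induction k arbitrary: y)
  case 0
  show ?case by (intro exI[of _ 0]) (simp add: weighted_inner_def)
next
  case (Suc k)
  let ?ip = "weighted_inner m w"
  have kn: "k \<le> n" using Suc by simp
  obtain p0 where p0: "p0 = 0 \<or> degree p0 < k"
    and o0: "\<And>q. q = 0 \<or> degree q < k \<Longrightarrow> ?ip (\<lambda>i. y i - poly p0 (z i)) (\<lambda>i. poly q (z i)) = 0"
    using Suc.IH[OF kn, of y] by blast
  obtain t where t: "t = 0 \<or> degree t < k"
    and ot: "\<And>q. q = 0 \<or> degree q < k \<Longrightarrow> ?ip (\<lambda>i. poly (monom 1 k) (z i) - poly t (z i)) (\<lambda>i. poly q (z i)) = 0"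
    using Suc.IH[OF kn, of "\<lambda>i. poly (monom 1 k) (z i)"] by blast
  \<comment> \<open>The monic orthogonal polynomial of degree \<open>k\<close>: the induction
    hypothesis is applied to the values of the monomial as data, which is why it is general in
    \<open>y\<close>.\<close>
  define u where "u = monom 1 k - t"
  have tk: "coeff t k = 0" using t by (auto simp: coeff_eq_0)
  have uk: "coeff u k = 1" by (simp add: u_def tk)
  have degu: "degree u \<le> k" unfolding u_def using t by (intro degree_diff_le) (auto simp: degree_monom_eq)
  have u0: "u \<noteq> 0" using uk by auto
  have ou: "?ip (\<lambda>i. poly u (z i)) (\<lambda>i. poly q (z i)) = 0" if "q = 0 \<or> degree q < k" for q
    using ot[OF that] by (simp add: u_def)
  define N where "N = ?ip (\<lambda>i. poly u (z i)) (\<lambda>i. poly u (z i))"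
  have N0: "N \<noteq> 0"
  proof
    assume "N = 0"
    then have "(\<Sum>i<m. w i * (cmod (poly u (z i)))\<^sup>2) = 0"
      unfolding N_def weighted_inner_self by (simp only: of_real_eq_0_iff)
    then show False using definite[of u] degu Suc.prems u0 by simp
  qed
  define c where "c = ?ip y (\<lambda>i. poly u (z i)) / N"
  define p where "p = p0 + smult c u"
  have pz: "(\<lambda>i. y i - poly p (z i)) = (\<lambda>i. (y i - poly p0 (z i)) - c * poly u (z i))"
    by (simp add: p_def algebra_simps)
  have "degree p < Suc k"
    using p0 degu degree_add_le[of p0 k "smult c u"] degree_smult_le[of c u] by (auto simp: p_def)
  moreover have "?ip (\<lambda>i. y i - poly p (z i)) (\<lambda>i. poly q (z i)) = 0" if q: "q = 0 \<or> degree q < Suc k" for q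
  proof -
    \<comment> \<open>Removing the leading coefficient by a multiple of \<open>u\<close> reduces the
      test to degree below \<open>k\<close> and to \<open>u\<close> itself.\<close>
    define q' where "q' = q - smult (coeff q k) u"
    have "degree q' \<le> k" unfolding q'_def using q degu by (intro degree_diff_le) (auto intro: order_trans[OF degree_smult_le])
    moreover have "coeff q' k = 0" by (simp add: q'_def uk)
    ultimately have q': "q' = 0 \<or> degree q' < k" using leading_coeff_0_iff[of q'] le_neq_implies_less by metis
    have qz: "(\<lambda>i. poly q (z i)) = (\<lambda>i. poly q' (z i) + coeff q k * poly u (z i))" by (simp add: q'_def)
    have 1: "?ip (\<lambda>i. y i - poly p (z i)) (\<lambda>i. poly q' (z i)) = 0"
      unfolding pz weighted_inner_linear(2)[of m w "\<lambda>i. y i - poly p0 (z i)"] weighted_inner_linear(3)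
        o0[OF q'] ou[OF q'] by simp
    have "?ip (\<lambda>i. poly p0 (z i)) (\<lambda>i. poly u (z i)) = 0"
      using ou[OF p0] weighted_inner_commute[of m w "\<lambda>i. poly p0 (z i)" "\<lambda>i. poly u (z i)"] by simp
    then have 2: "?ip (\<lambda>i. y i - poly p (z i)) (\<lambda>i. poly u (z i)) = 0"
      unfolding pz weighted_inner_linear N_def[symmetric] using N0 by (simp add: c_def)
    show ?thesis unfolding qz weighted_inner_linear(4,5) 1 2 by simp
  qed
  ultimately show ?case by blast
qed

lemma weighted_pythagoras:
  assumes "weighted_inner m w a b = 0"
  shows "(\<Sum>i<m. w i * (cmod (a i + b i))\<^sup>2) = (\<Sum>i<m. w i * (cmod (a i))\<^sup>2) + (\<Sum>i<m. w i * (cmod (b i))\<^sup>2)"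
proof -
  have "weighted_inner m w b a = 0" using assms by (subst weighted_inner_commute) simp
  then have "weighted_inner m w (\<lambda>i. a i + b i) (\<lambda>i. a i + b i) = weighted_inner m w a a + weighted_inner m w b b"
    unfolding weighted_inner_linear using assms by simp
  then show ?thesis unfolding weighted_inner_self by (simp only: of_real_add[symmetric] of_real_eq_iff)
qed

text \<open>By Pythagoras the objective at \<open>q\<close> exceeds that at the projection
  \<open>b\<close> by the squared norm of \<open>b - q\<close>. Definiteness makes \<open>b\<close>
  the only minimiser, and discarding the residual of \<open>b\<close> gives stability.\<close>

lemma wls_estimator_unique_and_stable:
  fixes y :: "nat \<Rightarrow> complex"
  assumes n: "n \<ge> 1" and m: "m \<ge> 1"
    and w: "\<And>i. i < m \<Longrightarrow> 0 < w i \<and> weight n (X i) = ennreal (w i)"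
    and definite: "\<And>p. p \<in> polys n \<Longrightarrow> (\<Sum>i<m. w i * (cmod (pfun p (X i)))\<^sup>2) = 0 \<Longrightarrow> p = 0"
  shows "\<exists>!p. wls_estimator n m X y p"
    and "wls_estimator n m X y p \<Longrightarrow> p \<in> polys n \<and>
      (\<forall>q\<in>polys n. (\<Sum>i<m. w i * (cmod (pfun (p - q) (X i)))\<^sup>2) \<le> (\<Sum>i<m. w i * (cmod (y i - pfun q (X i)))\<^sup>2))"
proof -
  have Q: "(p = 0 \<or> degree p < n) \<longleftrightarrow> p \<in> polys n" for p using n by (auto simp: polys_def)
  obtain b where b: "b \<in> polys n" and orth: "\<And>q. q \<in> polys n \<Longrightarrow>
      weighted_inner m w (\<lambda>i. y i - pfun b (X i)) (\<lambda>i. pfun q (X i)) = 0"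
    using weighted_projection_exists[where n = n and m = m and w = w and z = "\<lambda>i. of_real (X i)" and k = n and y = y] definite
    unfolding pfun_def[symmetric] Q by blast
  have diff: "p - q \<in> polys n" if "p \<in> polys n" "q \<in> polys n" for p q
    using that by (auto simp: polys_def intro: degree_diff_less)
  define s where "s = (\<lambda>q. \<Sum>i<m. w i * (cmod (y i - pfun q (X i)))\<^sup>2)"
  define t where "t = (\<lambda>q. \<Sum>i<m. w i * (cmod (pfun q (X i)))\<^sup>2)"
  have s0: "0 \<le> s q" for q unfolding s_def using w by (intro sum_nonneg mult_nonneg_nonneg) (auto intro: less_imp_le)
  have t0: "0 \<le> t q" for q unfolding t_def using w by (intro sum_nonneg mult_nonneg_nonneg) (auto intro: less_imp_le)
  have pyth: "s q = s b + t (b - q)" if q: "q \<in> polys n" for q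
    using weighted_pythagoras[OF orth[OF diff[OF b q]]] by (simp add: s_def t_def pfun_def)
  have obj: "ls_objective n m X y q = ennreal (s q / m)" for q
  proof -
    have "(\<Sum>i<m. weight n (X i) * ennreal ((cmod (y i - pfun q (X i)))\<^sup>2)) = (\<Sum>i<m. ennreal (w i * (cmod (y i - pfun q (X i)))\<^sup>2))"
      using w by (intro sum.cong) (auto simp: ennreal_mult less_imp_le)
    also have "\<dots> = ennreal (s q)" unfolding s_def using w by (intro sum_ennreal mult_nonneg_nonneg) (auto intro: less_imp_le)
    finally have "ls_objective n m X y q = (1 / of_nat m) * ennreal (s q)" by (simp add: ls_objective_def)
    also have "1 / of_nat m = ennreal (1 / m)"
      using m by (simp add: ennreal_of_nat_eq_real_of_nat divide_ennreal flip: ennreal_1)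
    finally show ?thesis using s0 by (simp flip: ennreal_mult)
  qed
  have less: "ls_objective n m X y q < ls_objective n m X y q' \<longleftrightarrow> s q < s q'" for q q'
    unfolding obj using s0 m by (subst ennreal_less_iff) (auto simp: divide_less_cancel)
  have bmin: "wls_estimator n m X y b"
  proof -
    have "\<not> s q < s b" if "q \<in> polys n" for q using pyth[OF that] t0[of "b - q"] by simp
    then show ?thesis unfolding wls_estimator_def is_arg_min_def less using b by blast
  qed
  have uniq: "q = b" if "wls_estimator n m X y q" for q
  proof -
    have q: "q \<in> polys n" "\<not> s b < s q" using that b unfolding wls_estimator_def is_arg_min_def less by auto
    then have "t (b - q) = 0" using pyth[OF q(1)] t0[of "b - q"] by simp
    then have "b - q = 0" using definite[OF diff[OF b q(1)]] by (simp add: t_def)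
    then show ?thesis by simp
  qed
  show "\<exists>!p. wls_estimator n m X y p" using bmin uniq by blast
  assume "wls_estimator n m X y p"
  then have "p = b" by (rule uniq)
  moreover have "t (b - q) \<le> s q" if "q \<in> polys n" for q using pyth[OF that] s0[of b] by simp
  ultimately show "p \<in> polys n \<and>
      (\<forall>q\<in>polys n. (\<Sum>i<m. w i * (cmod (pfun (p - q) (X i)))\<^sup>2) \<le> (\<Sum>i<m. w i * (cmod (y i - pfun q (X i)))\<^sup>2))"
    using b by (simp add: t_def s_def)
qed

section \<open>Expected cost\<close>

lemma sum_inverse_le_ln: "n \<ge> 1 \<Longrightarrow> (\<Sum>k<n. 1 / (real k + 1)) \<le> 1 + ln (real n)"
proof (induction n rule: nat_induct_at_least)
  case (Suc n)
  have "ln (real n / (real n + 1)) \<le> real n / (real n + 1) - 1" using Suc by (intro ln_le_minus_one) auto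
  also have "\<dots> = - 1 / (real n + 1)" by (simp add: field_simps)
  finally have "1 / (real n + 1) \<le> ln (real n + 1) - ln (real n)" using Suc by (simp add: ln_div)
  then show ?case using Suc by (simp add: add.commute)
qed simp

text \<open>\<open>1 - x\<^sup>2\<close> is the sum of \<open>1 - (radius n)\<^sup>2\<close> and
  \<open>(radius n * sin \<theta>)\<^sup>2\<close>. The sine controls the inner arcs; on the two
  extreme arcs it may vanish, and the first term, at least \<open>sigma n\<close>, takes
  over.\<close>

lemma one_minus_square_ge:
  assumes n: "n \<ge> 1" and k: "k < n"
    and x: "radius n * cos ((real k + 1) * (pi / n)) < x" "x \<le> radius n * cos (real k * (pi / n))"
  shows "(real (min k (n - 1 - k)) + 1)\<^sup>2 / (128 * (real n)\<^sup>2) \<le> 1 - x\<^sup>2"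
proof -
  have r: "15/16 \<le> radius n" "radius n < 1" using radius_bounds[OF n] by auto
  define h where "h = pi / n"
  have h: "h > 0" "real n * h = pi" using n by (auto simp: h_def)
  have k1: "real k + 1 \<le> n" using k by linarith
  have b: "0 \<le> real k * h" "(real k + 1) * h \<le> pi"
    using h mult_right_mono[OF k1, of h] by auto
  define \<theta> where "\<theta> = arccos (x / radius n)"
  have xx: "cos ((real k + 1) * h) < x / radius n" "x / radius n \<le> cos (real k * h)"
    using x r by (auto simp: h_def field_simps)
  have x1: "-1 \<le> x / radius n" "x / radius n \<le> 1"
    using xx cos_ge_minus_one[of "(real k + 1) * h"] cos_le_one[of "real k * h"] by linarith+
  have \<theta>: "cos \<theta> = x / radius n" "0 \<le> \<theta>" "\<theta> \<le> pi"
    unfolding \<theta>_def using x1 by (auto simp: cos_arccos arccos_lbound arccos_ubound)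
  have k2: "real k * h \<le> pi" using b h by (simp add: distrib_right)
  have lo: "real k * h \<le> \<theta>"
    using xx(2) \<theta> b k2 by (subst cos_mono_le_eq[symmetric]) auto
  have "\<theta> < (real k + 1) * h"
    using xx(1) \<theta> b h by (subst cos_mono_less_eq[symmetric]) auto
  moreover have "real (n - 1 - k) = real n - 1 - real k" using k by auto
  ultimately have up: "real (n - 1 - k) * h \<le> pi - \<theta>" using h by (simp add: left_diff_distrib distrib_right)
  define e where "e = real (min k (n - 1 - k))"
  have e: "e \<le> real k" "e \<le> real (n - 1 - k)" "0 \<le> e" by (auto simp: e_def)
  have "e * h \<le> \<theta>" "e * h \<le> pi - \<theta>"
    using lo up mult_right_mono[OF e(1), of h] mult_right_mono[OF e(2), of h] h by linarith+
  then have "e * h / 3 \<le> sin \<theta>"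
    using sin_ge_third[of \<theta>] sin_ge_third[of "pi - \<theta>"] \<theta> by (cases "\<theta> \<le> pi / 2") auto
  moreover have "e * 3 \<le> e * pi" using e pi_gt3 by (intro mult_left_mono) auto
  then have "e / n \<le> e * h / 3" using n by (simp add: h_def field_simps)
  ultimately have "e / n \<le> sin \<theta>" by linarith
  then have s: "(e / n)\<^sup>2 \<le> (sin \<theta>)\<^sup>2" using e by (intro power_mono) auto
  have "x = radius n * cos \<theta>" using \<theta> r by simp
  then have "1 - x\<^sup>2 = (1 - (radius n)\<^sup>2) + (radius n)\<^sup>2 * (sin \<theta>)\<^sup>2"
    by (simp add: power_mult_distrib sin_squared_eq algebra_simps)
  moreover have "sigma n \<le> 1 - (radius n)\<^sup>2"
  proof -
    have "1 - (radius n)\<^sup>2 = (1 - radius n) * (1 + radius n)" by (simp add: power2_eq_square algebra_simps)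
    also have "\<dots> \<ge> (1 - radius n) * 1" using r by (intro mult_left_mono) auto
    finally show ?thesis by (simp add: radius_def)
  qed
  moreover have "(1/2) * (e / n)\<^sup>2 \<le> (radius n)\<^sup>2 * (sin \<theta>)\<^sup>2"
  proof (rule mult_mono[OF _ s])
    have "(15/16)\<^sup>2 \<le> (radius n)\<^sup>2" using r by (intro power_mono) auto
    then show "1/2 \<le> (radius n)\<^sup>2" by (simp add: power2_eq_square)
  qed auto
  ultimately have "1 / (64 * (real n)\<^sup>2) + (1/2) * (e / n)\<^sup>2 \<le> 1 - x\<^sup>2" using sigma_lower[OF n] by linarith
  moreover have "(e + 1)\<^sup>2 / (128 * (real n)\<^sup>2) \<le> 1 / (64 * (real n)\<^sup>2) + (1/2) * (e / n)\<^sup>2"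
  proof -
    have "(e + 1)\<^sup>2 = 2 + 64 * e\<^sup>2 - (e - 1)\<^sup>2 - 62 * e\<^sup>2"
      by (simp add: power2_eq_square algebra_simps)
    then have "(e + 1)\<^sup>2 \<le> 2 + 64 * e\<^sup>2" using zero_le_power2[of "e - 1"] zero_le_power2[of e] by linarith
    then have "(e + 1)\<^sup>2 / (128 * (real n)\<^sup>2) \<le> (2 + 64 * e\<^sup>2) / (128 * (real n)\<^sup>2)" by (intro divide_right_mono) auto
    also have "\<dots> = 1 / (64 * (real n)\<^sup>2) + (1/2) * (e / n)\<^sup>2" using n by (simp add: field_simps)
    finally show ?thesis .
  qed
  ultimately show ?thesis by (simp add: e_def)
qed

text \<open>The support is cut into \<open>n\<close> arcs of measure 1 / n, on each of which the
  cost is bounded through the distance to the nearer endpoint. Counting from both ends gives the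
  factor 2.\<close>

lemma cost_integral_le:
  assumes n: "n \<ge> 1" and \<alpha>: "\<alpha> \<ge> 0" and K: "K > 0"
    and c: "\<And>x. x \<in> unit_ivl \<Longrightarrow> c x \<le> K * (1 - x\<^sup>2) powr (- \<alpha>)"
  shows "(\<integral>\<^sup>+x. ennreal (c x) \<partial>mu n)
    \<le> ennreal (2 * (K * 128 powr \<alpha>) * (\<Sum>k<n. (real n / (real k + 1)) powr (2 * \<alpha>) / n))"
proof -
  define f where "f = (\<lambda>k. (K * 128 powr \<alpha>) * ((real n / (real k + 1)) powr (2 * \<alpha>)))"
  have f0: "0 \<le> f k" for k using K by (simp add: f_def)
  let ?e = "\<lambda>k. min k (n - 1 - k)"
  define J where "J = (\<lambda>k::nat. {radius n * cos ((real k + 1) * (pi / n))<..radius n * cos (real k * (pi / n))})"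
  have r: "0 < radius n" "radius n < 1" using radius_bounds[OF n] by auto
  have ang: "0 \<le> real k * (pi / n)" "real k * (pi / n) < (real k + 1) * (pi / n)" "(real k + 1) * (pi / n) \<le> pi" if "k < n" for k
  proof -
    have "(real k + 1) * (pi / n) \<le> real n * (pi / n)" using that by (intro mult_right_mono) auto
    then show "0 \<le> real k * (pi / n)" "real k * (pi / n) < (real k + 1) * (pi / n)" "(real k + 1) * (pi / n) \<le> pi"
      using n by (auto simp: field_simps)
  qed
  have muJ: "emeasure (mu n) (J k) = ennreal (1 / n)" if "k < n" for k
  proof -
    have "emeasure (mu n) (J k) = ennreal (((real k + 1) * (pi / n) - real k * (pi / n)) / pi)"
      unfolding J_def by (rule emeasure_mu_interval[OF n ang[OF that]])
    also have "((real k + 1) * (pi / n) - real k * (pi / n)) / pi = 1 / n" by (simp only: left_diff_distrib[symmetric]) simp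
    finally show ?thesis .
  qed
  have Js: "J k \<in> sets (mu n)" for k
  proof (rule borel_sets_mu)
    show "J k \<subseteq> unit_ivl"
    proof
      fix x assume "x \<in> J k"
      moreover have "radius n * cos (real k * (pi / n)) \<le> radius n * 1" 
        "radius n * (-1) \<le> radius n * cos ((real k + 1) * (pi / n))"
        using r by (intro mult_left_mono; simp)+
      ultimately have "-1 < x" "x < 1" using r unfolding J_def greaterThanAtMost_iff by linarith+
      then show "x \<in> unit_ivl" by (simp add: unit_ivl_def)
    qed
  qed (simp add: J_def)
  have bound: "c x \<le> f (?e k)" if x: "x \<in> J k" and k: "k < n" for x k
  proof -
    have xu: "x \<in> unit_ivl" using sets.sets_into_space[OF Js[of k]] x by auto
    have q: "(real (?e k) + 1)\<^sup>2 / (128 * (real n)\<^sup>2) \<le> 1 - x\<^sup>2"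
      using x by (intro one_minus_square_ge[OF n k]) (auto simp: J_def)
    have p: "0 < (real (?e k) + 1)\<^sup>2 / (128 * (real n)\<^sup>2)" using n by (intro divide_pos_pos) auto
    have "(1 - x\<^sup>2) powr (- \<alpha>) \<le> ((real (?e k) + 1)\<^sup>2 / (128 * (real n)\<^sup>2)) powr (- \<alpha>)"
      using q p \<alpha> by (intro powr_mono2') auto
    also have "\<dots> = (128 * (real n / (real (?e k) + 1))\<^sup>2) powr \<alpha>"
      using n by (simp add: powr_minus_divide powr_divide power_divide)
    also have "\<dots> = 128 powr \<alpha> * (real n / (real (?e k) + 1)) powr (2 * \<alpha>)"
      using n by (simp add: powr_mult powr_powr flip: powr_numeral)
    finally have "K * (1 - x\<^sup>2) powr (- \<alpha>) \<le> f (?e k)" using K by (simp add: f_def mult.assoc)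
    then show ?thesis using c[OF xu] by linarith
  qed
  have cover: "\<exists>k<n. x \<in> J k" if x: "\<bar>x\<bar> < radius n" for x
  proof -
    have x1: "-1 < x / radius n" "x / radius n < 1" using x r by (auto simp: field_simps)
    define \<theta> where "\<theta> = arccos (x / radius n)"
    have \<theta>: "cos \<theta> = x / radius n" "0 \<le> \<theta>" "\<theta> < pi"
      unfolding \<theta>_def using x1 arccos_lt_bounded[of "x / radius n"] by (auto simp: cos_arccos arccos_lbound)
    define k where "k = nat \<lfloor>\<theta> / (pi / n)\<rfloor>"
    have t0: "0 \<le> \<theta> / (pi / n)" "\<theta> / (pi / n) < n" using \<theta> n by (auto simp: field_simps)
    have kb: "real k \<le> \<theta> / (pi / n)" "\<theta> / (pi / n) < real k + 1" unfolding k_def using t0(1) by linarith+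
    then have kn: "k < n" using t0(2) by linarith
    have "real k * (pi / n) \<le> \<theta>" "\<theta> < (real k + 1) * (pi / n)"
      using kb n by (auto simp: field_simps)
    then have "cos \<theta> \<le> cos (real k * (pi / n))" "cos ((real k + 1) * (pi / n)) < cos \<theta>"
      using \<theta>(2,3) ang[OF kn] by (auto intro!: cos_monotone_0_pi_le cos_monotone_0_pi)
    then have "x \<in> J k" using \<theta> r by (auto simp: J_def field_simps)
    with kn show ?thesis by blast
  qed
  have "(\<integral>\<^sup>+x. ennreal (c x) \<partial>mu n) \<le> (\<integral>\<^sup>+x. (\<Sum>k<n. ennreal (f (?e k)) * indicator (J k) x) \<partial>mu n)"
  proof (intro nn_integral_mono_AE)
    show "AE x in mu n. ennreal (c x) \<le> (\<Sum>k<n. ennreal (f (?e k)) * indicator (J k) x)"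
      using AE_mu_inside[OF n]
    proof eventually_elim
      case (elim x)
      then obtain k where k: "k < n" "x \<in> J k" using cover by blast
      have "ennreal (c x) \<le> ennreal (f (?e k)) * indicator (J k) x" using bound[OF k(2,1)] k by (simp add: ennreal_leI)
      also have "\<dots> \<le> (\<Sum>k<n. ennreal (f (?e k)) * indicator (J k) x)"
        using k by (intro member_le_sum) auto
      finally show ?case .
    qed
  qed
  also have "\<dots> = (\<Sum>k<n. ennreal (f (?e k)) * emeasure (mu n) (J k))"
    using Js by (subst nn_integral_sum) (auto simp: nn_integral_cmult_indicator)
  also have "\<dots> = (\<Sum>k<n. ennreal (f (?e k) * (1 / n)))"
    using f0 by (intro sum.cong) (auto simp: muJ simp flip: ennreal_mult)
  also have "\<dots> = ennreal (\<Sum>k<n. f (?e k) * (1 / n))" using f0 by (intro sum_ennreal) auto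
  also have "\<dots> \<le> ennreal (2 * (\<Sum>k<n. f k * (1 / n)))"
    using sum_min_reflect_le[of "\<lambda>k. f k * (1 / n)" n] f0 by (intro ennreal_leI) auto
  also have "2 * (\<Sum>k<n. f k * (1 / n)) = 2 * (K * 128 powr \<alpha>) * (\<Sum>k<n. (real n / (real k + 1)) powr (2 * \<alpha>) / n)"
    by (simp add: f_def sum_distrib_left mult_ac)
  finally show ?thesis .
qed

text \<open>For \<open>\<alpha> = 1/2\<close> the integral of the cost is genuinely of order \<open>ln n\<close>, so the bound
  relies on the number of samples being linear in \<open>n\<close> for fixed \<open>\<epsilon>\<close>.\<close>
lemma expected_cost_bound:
  assumes \<alpha>: "\<alpha> \<ge> 0" and K: "K > 0"
  obtains C where "C > 0" "\<And>n M c \<epsilon>. n \<ge> 1 \<Longrightarrow> 0 < \<epsilon> \<Longrightarrow> \<epsilon> < 1 \<Longrightarrow> real n * real M \<le> 2 * real n + ln (1 / \<epsilon>) \<Longrightarrow>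
      (\<And>x. x \<in> unit_ivl \<Longrightarrow> c x \<le> K * (1 - x\<^sup>2) powr (- \<alpha>)) \<Longrightarrow>
      expected_cost n (5898240 * n * M) c \<le> ennreal (C * real n powr max 1 (2 * \<alpha>) * ln (3 * real n / \<epsilon>))"
proof -
  \<comment> \<open>For \<alpha> > 1/2 the sum over the arcs is governed by this convergent series;
    for smaller \<alpha> it is at most harmonic and is treated by a logarithm.\<close>
  define Z where "Z = (if \<alpha> \<le> 1/2 then 1 else \<Sum>k. (real k + 1) powr (- (2 * \<alpha>)))"
  have sm: "summable (\<lambda>k. (real k + 1) powr (- (2 * \<alpha>)))" if "\<alpha> > 1/2"
  proof -
    have "summable (\<lambda>k. real k powr (- (2 * \<alpha>)))" using that by (subst summable_real_powr_iff) auto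
    then show ?thesis by (subst (asm) summable_Suc_iff[symmetric]) (simp add: add.commute)
  qed
  have Z: "Z \<ge> 1"
  proof (cases "\<alpha> \<le> 1/2")
    case False
    then have "(\<Sum>k\<in>{0}. (real k + 1) powr (- (2 * \<alpha>))) \<le> (\<Sum>k. (real k + 1) powr (- (2 * \<alpha>)))"
      by (intro sum_le_suminf sm) auto
    then show ?thesis using False by (simp add: Z_def)
  qed (simp add: Z_def)
  define A where "A = 2 * (K * 128 powr \<alpha>)"
  have A: "A > 0" using K by (simp add: A_def)
  define C where "C = 5898240 * 3 * A * Z"
  have "C > 0" using A Z by (simp add: C_def)
  moreover have "expected_cost n (5898240 * n * M) c \<le> ennreal (C * real n powr max 1 (2 * \<alpha>) * ln (3 * real n / \<epsilon>))"
    if n: "n \<ge> 1" and \<epsilon>: "0 < \<epsilon>" "\<epsilon> < 1" and nM: "real n * real M \<le> 2 * real n + ln (1 / \<epsilon>)"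
      and c: "\<And>x. x \<in> unit_ivl \<Longrightarrow> c x \<le> K * (1 - x\<^sup>2) powr (- \<alpha>)" for n M c \<epsilon>
  proof -
    define L where "L = ln (1 / \<epsilon>)"
    define B where "B = ln (3 * real n)"
    have L: "L \<ge> 0" using \<epsilon> by (simp add: L_def)
    have lnsum: "ln (3 * real n / \<epsilon>) = B + L" using n \<epsilon> by (simp add: B_def L_def ln_div)
    have B1: "1 + ln (real n) \<le> B"
    proof -
      have "1 \<le> ln (3::real)" using exp_le by (subst ln_ge_iff) auto
      then show ?thesis using n by (simp add: B_def ln_mult)
    qed
    have B: "1 \<le> B" using B1 n by (smt (verit) ln_ge_zero of_nat_1 of_nat_le_iff)
    have B3: "B \<le> 3 * real n" unfolding B_def using n ln_le_minus_one[of "3 * real n"] by simp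
    let ?s = "\<Sum>k<n. (real n / (real k + 1)) powr (2 * \<alpha>) / n"
    have s0: "0 \<le> ?s" by (intro sum_nonneg) auto
    have main: "(2 * real n + L) * ?s \<le> 3 * Z * real n powr max 1 (2 * \<alpha>) * (B + L)"
    proof (cases "\<alpha> \<le> 1/2")
      case True
      have "?s \<le> (\<Sum>k<n. 1 / (real k + 1))"
      proof (rule sum_mono)
        fix k assume k: "k \<in> {..<n}"
        have "1 \<le> real n / (real k + 1)" using k by (auto simp: field_simps)
        then have "(real n / (real k + 1)) powr (2 * \<alpha>) \<le> (real n / (real k + 1)) powr 1"
          using True by (intro powr_mono) auto
        also have "\<dots> = real n / (real k + 1)" using n by simp
        finally have "(real n / (real k + 1)) powr (2 * \<alpha>) / n \<le> real n / (real k + 1) / n"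
          by (intro divide_right_mono) auto
        then show "(real n / (real k + 1)) powr (2 * \<alpha>) / n \<le> 1 / (real k + 1)" using n by simp
      qed
      also have "\<dots> \<le> B" using sum_inverse_le_ln[OF n] B1 by linarith
      finally have "(2 * real n + L) * ?s \<le> (2 * real n + L) * B" using L by (intro mult_left_mono) auto
      \<comment> \<open>The target contains no product of \<open>ln (1 / \<epsilon>)\<close> with
        \<open>ln n\<close>; in the term with \<open>L\<close> the logarithm \<open>B\<close> is
        replaced by the crude \<open>3 * n\<close>, which the power of \<open>n\<close>
        absorbs.\<close>
      also have "\<dots> \<le> 3 * real n * B + L * (3 * real n)" 
      proof -
        have "0 \<le> real n * B" using B by simp
        then show ?thesis using mult_left_mono[OF B3 L] unfolding distrib_right by linarith
      qed
      also have "\<dots> = 3 * Z * real n powr max 1 (2 * \<alpha>) * (B + L)"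
        using True n by (simp add: Z_def max_def algebra_simps)
      finally show ?thesis .
    next
      case False
      have "?s = real n powr (2 * \<alpha>) / n * (\<Sum>k<n. (real k + 1) powr (- (2 * \<alpha>)))"
        by (simp add: sum_distrib_left powr_divide powr_minus_divide mult.commute)
      also have "\<dots> \<le> real n powr (2 * \<alpha>) / n * Z"
        using False sm unfolding Z_def by (intro mult_left_mono) (auto intro!: sum_le_suminf)
      finally have "(2 * real n + L) * ?s \<le> (2 * real n + L) * (real n powr (2 * \<alpha>) / n * Z)"
        using L by (intro mult_left_mono) auto
      also have "\<dots> \<le> (3 * real n * (B + L)) * (real n powr (2 * \<alpha>) / n * Z)"
      proof (rule mult_right_mono)
        have "2 * real n * 1 \<le> 2 * real n * B" using B by (intro mult_left_mono) auto
        moreover have "1 * L \<le> 3 * real n * L" using n L by (intro mult_right_mono) auto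
        moreover have "0 \<le> real n * B" using B by simp
        ultimately show "2 * real n + L \<le> 3 * real n * (B + L)" by (simp add: distrib_left)
      qed (use Z in auto)
      also have "\<dots> = 3 * Z * real n powr max 1 (2 * \<alpha>) * (B + L)"
        using False n by (simp add: max_def)
      finally show ?thesis .
    qed
    have "expected_cost n (5898240 * n * M) c \<le> of_nat (5898240 * n * M) * ennreal (A * ?s)"
      unfolding expected_cost_def A_def by (intro mult_left_mono cost_integral_le[OF n \<alpha> K c]) auto
    also have "\<dots> = ennreal (real (5898240 * n * M) * (A * ?s))"
      using A s0 by (subst ennreal_mult) (auto simp: ennreal_of_nat_eq_real_of_nat)
    also have "\<dots> \<le> ennreal (C * real n powr max 1 (2 * \<alpha>) * ln (3 * real n / \<epsilon>))"
    proof (rule ennreal_leI)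
      have "real (5898240 * n * M) * (A * ?s) = (real n * real M) * (5898240 * A * ?s)" by simp
      also have "\<dots> \<le> (2 * real n + L) * (5898240 * A * ?s)"
        using nM A s0 unfolding L_def by (intro mult_right_mono) auto
      also have "\<dots> = 5898240 * A * ((2 * real n + L) * ?s)" by (simp add: mult_ac)
      also have "\<dots> \<le> 5898240 * A * (3 * Z * real n powr max 1 (2 * \<alpha>) * (B + L))"
        using A by (intro mult_left_mono main) auto
      also have "\<dots> = C * real n powr max 1 (2 * \<alpha>) * ln (3 * real n / \<epsilon>)" unfolding C_def lnsum by (simp add: mult_ac)
      finally show "real (5898240 * n * M) * (A * ?s) \<le> C * real n powr max 1 (2 * \<alpha>) * ln (3 * real n / \<epsilon>)" .
    qed
    finally show ?thesis .
  qed
  ultimately show thesis using that by blast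
qed

section \<open>Error bounds\<close>

lemma degree_diff_polys: "p \<in> polys n \<Longrightarrow> q \<in> polys n \<Longrightarrow> p - q \<in> polys n"
  by (auto simp: polys_def intro: degree_diff_less)

lemma pfun_diff: "pfun (p - q) t = pfun p t - pfun q t"
  by (simp add: pfun_def)

lemma pfun_rho_measurable: "pfun p \<in> borel_measurable rho"
proof -
  have "continuous_on UNIV (pfun p)" unfolding pfun_def by (intro continuous_intros)
  then show ?thesis
    unfolding measurable_cong_sets[OF sets_rho refl]
    by (intro borel_imp_lebesgue_on borel_measurable_continuous_onI)
qed

lemma L2_diff_pfun:
  assumes f: "f \<in> L2_space rho"
  shows "(\<lambda>t. f t - pfun p t) \<in> borel_measurable rho" "integrable rho (\<lambda>t. (cmod (f t - pfun p t))\<^sup>2)"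
proof -
  interpret prob_space rho by (rule prob_space_rho)
  have fm: "f \<in> borel_measurable rho" and fi: "integrable rho (\<lambda>t. (cmod (f t))\<^sup>2)"
    using f by (auto simp: L2_space_def)
  have "compact ((\<lambda>t. cmod (pfun p t)) ` {-1..1})"
    unfolding pfun_def by (intro compact_continuous_image continuous_intros) auto
  then have "bounded ((\<lambda>t. cmod (pfun p t)) ` {-1..1})" by (rule compact_imp_bounded)
  then obtain b where "\<forall>y\<in>(\<lambda>t. cmod (pfun p t)) ` {-1..1}. norm y \<le> b"
    unfolding bounded_iff by (rule exE)
  then have b: "cmod (pfun p t) \<le> b" if "t \<in> {-1..1}" for t using that by simp
  show m: "(\<lambda>t. f t - pfun p t) \<in> borel_measurable rho"
    using fm pfun_rho_measurable by measurable
  show "integrable rho (\<lambda>t. (cmod (f t - pfun p t))\<^sup>2)"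
  proof (rule Bochner_Integration.integrable_bound)
    show "integrable rho (\<lambda>t. 2 * (cmod (f t))\<^sup>2 + 2 * b\<^sup>2)" using fi by (intro Bochner_Integration.integrable_add) auto
    show "AE t in rho. norm ((cmod (f t - pfun p t))\<^sup>2) \<le> norm (2 * (cmod (f t))\<^sup>2 + 2 * b\<^sup>2)"
    proof (rule AE_I2)
      fix t assume "t \<in> space rho"
      then have "cmod (pfun p t) \<le> b" by (intro b) (auto simp: unit_ivl_def)
      then have "cmod (f t - pfun p t) \<le> cmod (f t) + b"
        using norm_triangle_ineq4[of "f t" "pfun p t"] by linarith
      then have "(cmod (f t - pfun p t))\<^sup>2 \<le> (cmod (f t) + b)\<^sup>2" by (intro power_mono) auto
      also have "\<dots> \<le> 2 * (cmod (f t))\<^sup>2 + 2 * b\<^sup>2"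
        using zero_le_power2[of "cmod (f t) - b"] by (simp add: power2_eq_square algebra_simps)
      finally show "norm ((cmod (f t - pfun p t))\<^sup>2) \<le> norm (2 * (cmod (f t))\<^sup>2 + 2 * b\<^sup>2)" by simp
    qed
  qed (use m in measurable)
qed

text \<open>\<open>rho\<close> has mass one, so the constant \<open>s\<close> has norm
  \<open>s\<close>; the factor 2 comes from bounding the square of a sum by twice the sum of the
  squares.\<close>

lemma L2_norm_le_add_sup:
  assumes g: "(\<lambda>t. (cmod (g t))\<^sup>2) \<in> borel_measurable rho" "integrable rho (\<lambda>t. (cmod (g t))\<^sup>2)"
    and s: "\<And>t. t \<in> unit_ivl \<Longrightarrow> cmod (h t) \<le> cmod (g t) + s" "0 \<le> s"
    and h: "integrable rho (\<lambda>t. (cmod (h t))\<^sup>2)"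
  shows "L2_norm rho h \<le> 2 * (L2_norm rho g + s)"
proof -
  interpret prob_space rho by (rule prob_space_rho)
  have G: "0 \<le> (\<integral>t. (cmod (g t))\<^sup>2 \<partial>rho)" by (rule Bochner_Integration.integral_nonneg) simp
  have "(\<integral>t. (cmod (h t))\<^sup>2 \<partial>rho) \<le> (\<integral>t. 2 * (cmod (g t))\<^sup>2 + 2 * s\<^sup>2 \<partial>rho)"
  proof (rule integral_mono[OF h])
    show "integrable rho (\<lambda>t. 2 * (cmod (g t))\<^sup>2 + 2 * s\<^sup>2)" using g by (intro Bochner_Integration.integrable_add) auto
    fix t assume "t \<in> space rho"
    then have "(cmod (h t))\<^sup>2 \<le> (cmod (g t) + s)\<^sup>2" using s by (intro power_mono) auto
    also have "\<dots> \<le> 2 * (cmod (g t))\<^sup>2 + 2 * s\<^sup>2"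
      using zero_le_power2[of "cmod (g t) - s"] by (simp add: power2_eq_square algebra_simps)
    finally show "(cmod (h t))\<^sup>2 \<le> 2 * (cmod (g t))\<^sup>2 + 2 * s\<^sup>2" .
  qed
  also have "\<dots> = 2 * (\<integral>t. (cmod (g t))\<^sup>2 \<partial>rho) + 2 * s\<^sup>2"
    using g prob_space by (subst Bochner_Integration.integral_add) auto
  also have "\<dots> \<le> (2 * (L2_norm rho g + s))\<^sup>2"
  proof -
    have "(L2_norm rho g)\<^sup>2 = (\<integral>t. (cmod (g t))\<^sup>2 \<partial>rho)" using G by (simp add: L2_norm_def)
    moreover have "0 \<le> L2_norm rho g * s" using s G by (simp add: L2_norm_def)
    moreover have "0 \<le> (L2_norm rho g)\<^sup>2" "0 \<le> s\<^sup>2" by auto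
    moreover have "(2 * (L2_norm rho g + s))\<^sup>2 = 4 * (L2_norm rho g)\<^sup>2 + 8 * (L2_norm rho g * s) + 4 * s\<^sup>2"
      by (simp add: power2_eq_square algebra_simps)
    ultimately show ?thesis by linarith
  qed
  finally have "sqrt (\<integral>t. (cmod (h t))\<^sup>2 \<partial>rho) \<le> sqrt ((2 * (L2_norm rho g + s))\<^sup>2)"
    by (rule real_sqrt_le_mono)
  moreover have "0 \<le> L2_norm rho g" using G by (simp add: L2_norm_def)
  ultimately show ?thesis using s by (simp add: L2_norm_def)
qed

text \<open>Relies on \<open>rho\<close> having positive mass. Nonnegativity permits multiplying the
  extended-real norm by a constant \<ge> 1.\<close>

lemma Linf_norm_nonneg: "g \<in> borel_measurable rho \<Longrightarrow> 0 \<le> Linf_norm rho g"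
proof -
  assume g: "g \<in> borel_measurable rho"
  interpret prob_space rho by (rule prob_space_rho)
  have "esssup rho (\<lambda>x. 0::ereal) = 0" using emeasure_space_1 by (intro esssup_const) simp
  moreover have "esssup rho (\<lambda>x. 0::ereal) \<le> esssup rho (\<lambda>x. ereal (cmod (g x)))"
    using g by (intro esssup_mono) auto
  ultimately show ?thesis by (simp add: Linf_norm_def)
qed

lemma Linf_norm_le_add_sup:
  assumes g: "g \<in> borel_measurable rho" and h: "h \<in> borel_measurable rho"
    and s: "\<And>t. t \<in> unit_ivl \<Longrightarrow> cmod (h t) \<le> cmod (g t) + s"
  shows "Linf_norm rho h \<le> Linf_norm rho g + ereal s"
proof -
  have "AE t in rho. ereal (cmod (g t)) \<le> Linf_norm rho g"
    unfolding Linf_norm_def using g by (intro esssup_AE)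
  then have "AE t in rho. ereal (cmod (h t)) \<le> Linf_norm rho g + ereal s"
    using AE_space
  proof eventually_elim
    case (elim t)
    then have "ereal (cmod (h t)) \<le> ereal (cmod (g t)) + ereal s" using s[of t] by simp
    also have "\<dots> \<le> Linf_norm rho g + ereal s" using elim by (intro add_right_mono)
    finally show ?case .
  qed
  then show ?thesis unfolding Linf_norm_def[of _ h] using h by (intro esssup_I) auto
qed

lemma poly_zero_if_pfun_zero:
  assumes "\<And>t. \<bar>t\<bar> \<le> 1 \<Longrightarrow> pfun p t = 0" shows "p = 0"
proof (rule ccontr)
  assume "p \<noteq> 0"
  then have "finite {z. poly p z = 0}" by (rule poly_roots_finite)
  moreover have "complex_of_real ` {0..1} \<subseteq> {z. poly p z = 0}" using assms by (auto simp: pfun_def)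
  ultimately have "finite (complex_of_real ` {0..1})" by (rule finite_subset[rotated])
  then have "finite {0..1::real}" by (rule finite_imageD) (auto simp: inj_on_def)
  then show False by (simp add: infinite_Icc)
qed

section \<open>From the good event to the estimator\<close>

text \<open>Least squares bounds the empirical norm of \<open>q\<close> by that of
  \<open>g + e\<close>. Multiplied by the amplification, the part of \<open>g\<close> is covered by
  the joint bound \<open>amp1\<close>, the part of \<open>e\<close> by \<open>amp2\<close> and by
  the weights being at most 2.\<close>

lemma sup_error_bound:
  fixes A b G E \<epsilon> :: real
  assumes n: "n \<ge> 1" and m: "m = 5898240 * n * M" and M: "M \<ge> 1" and \<epsilon>: "0 < \<epsilon>" "\<epsilon> < 1"
    and X: "\<And>i. i < m \<Longrightarrow> \<bar>X i\<bar> < radius n"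
    and dense: "\<And>k. k < cells n \<Longrightarrow> \<not> sparse n m M X k (2048 * n)"
    and amp1: "amplification n m M X * (\<Sum>i<m. ennreal (sample_weight n (X i)) * ennreal ((cmod (g (X i)))\<^sup>2))
       \<le> ennreal (real m * G\<^sup>2 * (5184\<^sup>2 + 8) / (\<epsilon> / 4))"
    and amp2: "amplification n m M X * of_nat m \<le> ennreal (real m * (5184\<^sup>2 + 8) / (\<epsilon> / 4))"
    and q: "q \<in> polys n" and G: "0 \<le> G"
    and ls: "(\<Sum>i<m. sample_weight n (X i) * (cmod (pfun q (X i)))\<^sup>2) \<le> (\<Sum>i<m. sample_weight n (X i) * (cmod (g (X i) + e i))\<^sup>2)"
    and t: "\<bar>t\<bar> \<le> 1"
  shows "cmod (pfun q t) \<le> (8 * sqrt (773094113280 * (5184\<^sup>2 + 8))) * (real n / sqrt \<epsilon> * (G + L2_set (\<lambda>i. cmod (e i)) {..<m}))"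
proof -
  define c :: real where "c = 5184\<^sup>2 + 8"
  have c0: "c > 0" by (simp add: c_def)
  define E where "E = L2_set (\<lambda>i. cmod (e i)) {..<m}"
  have E0: "0 \<le> E" by (simp add: E_def L2_set_nonneg)
  have m1: "m \<ge> 1" using n M by (simp add: m)
  have w: "0 < sample_weight n (X i)" "sample_weight n (X i) \<le> 2" if "i < m" for i
    using sample_weight_density(2,3)[OF n X[OF that]] by auto
  define W where "W = (\<Sum>i<m. sample_weight n (X i) * (cmod (g (X i)))\<^sup>2)"
  have W0: "0 \<le> W" unfolding W_def using w by (intro sum_nonneg mult_nonneg_nonneg) (auto intro: less_imp_le)
  have We: "(\<Sum>i<m. ennreal (sample_weight n (X i)) * ennreal ((cmod (g (X i)))\<^sup>2)) = ennreal W"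
  proof -
    have "(\<Sum>i<m. ennreal (sample_weight n (X i)) * ennreal ((cmod (g (X i)))\<^sup>2)) = (\<Sum>i<m. ennreal (sample_weight n (X i) * (cmod (g (X i)))\<^sup>2))"
      using w by (intro sum.cong) (auto simp: ennreal_mult less_imp_le)
    also have "\<dots> = ennreal W" unfolding W_def using w by (intro sum_ennreal mult_nonneg_nonneg) (auto intro: less_imp_le)
    finally show ?thesis .
  qed
  \<comment> \<open>Finiteness, needed to continue with real numbers, follows from
    \<open>amp2\<close> because m is positive.\<close>
  have "amplification n m M X \<noteq> top"
  proof
    assume "amplification n m M X = top"
    then have "amplification n m M X * of_nat m = top" using m1 by (simp add: ennreal_top_mult ennreal_of_nat_eq_real_of_nat)
    then show False using amp2 by (simp add: top_unique)
  qed
  then obtain a where a: "amplification n m M X = ennreal a" "0 \<le> a" by (cases "amplification n m M X") auto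
  have aW: "a * W \<le> real m * G\<^sup>2 * c / (\<epsilon> / 4)"
    using amp1 a W0 \<epsilon> c0 unfolding We c_def[symmetric] by (simp add: ennreal_le_iff flip: ennreal_mult)
  have am: "a * real m \<le> real m * c / (\<epsilon> / 4)"
    using amp2 a \<epsilon> c0 unfolding c_def[symmetric] by (simp add: ennreal_of_nat_eq_real_of_nat ennreal_le_iff flip: ennreal_mult)
  have "a * real m \<le> c / (\<epsilon> / 4) * real m" using am by (simp add: mult_ac)
  then have ac: "a \<le> c / (\<epsilon> / 4)" by (rule mult_right_le_imp_le) (use m1 in simp)
  define T where "T = (\<Sum>i<m. sample_weight n (X i) * (cmod (pfun q (X i)))\<^sup>2)"
  have T0: "0 \<le> T" unfolding T_def using w by (intro sum_nonneg mult_nonneg_nonneg) (auto intro: less_imp_le)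
  have Tle: "T \<le> 2 * W + 4 * E\<^sup>2"
  proof -
    have "T \<le> (\<Sum>i<m. sample_weight n (X i) * (cmod (g (X i) + e i))\<^sup>2)" unfolding T_def by (rule ls)
    also have "\<dots> \<le> (\<Sum>i<m. 2 * (sample_weight n (X i) * (cmod (g (X i)))\<^sup>2) + 4 * (cmod (e i))\<^sup>2)"
    proof (rule sum_mono)
      fix i assume i: "i \<in> {..<m}"
      have "(cmod (g (X i) + e i))\<^sup>2 \<le> (cmod (g (X i)) + cmod (e i))\<^sup>2"
        using norm_triangle_ineq by (intro power_mono) auto
      also have "\<dots> \<le> 2 * (cmod (g (X i)))\<^sup>2 + 2 * (cmod (e i))\<^sup>2"
        using zero_le_power2[of "cmod (g (X i)) - cmod (e i)"] by (simp add: power2_eq_square algebra_simps)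
      finally have "sample_weight n (X i) * (cmod (g (X i) + e i))\<^sup>2
          \<le> sample_weight n (X i) * (2 * (cmod (g (X i)))\<^sup>2 + 2 * (cmod (e i))\<^sup>2)"
        using w i by (intro mult_left_mono) (auto intro: less_imp_le)
      also have "\<dots> = 2 * (sample_weight n (X i) * (cmod (g (X i)))\<^sup>2) + 2 * (sample_weight n (X i) * (cmod (e i))\<^sup>2)"
        by (simp add: algebra_simps)
      also have "sample_weight n (X i) * (cmod (e i))\<^sup>2 \<le> 2 * (cmod (e i))\<^sup>2" using w i by (intro mult_right_mono) auto
      finally show "sample_weight n (X i) * (cmod (g (X i) + e i))\<^sup>2
          \<le> 2 * (sample_weight n (X i) * (cmod (g (X i)))\<^sup>2) + 4 * (cmod (e i))\<^sup>2" by simp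
    qed
    also have "\<dots> = 2 * W + 4 * (\<Sum>i<m. (cmod (e i))\<^sup>2)" by (simp add: sum.distrib W_def sum_distrib_left)
    also have "(\<Sum>i<m. (cmod (e i))\<^sup>2) = E\<^sup>2" by (simp add: E_def L2_set_def sum_nonneg)
    finally show ?thesis .
  qed
  define B :: real where "B = 773094113280"
  obtain S where S: "0 \<le> S" "\<And>t. \<bar>t\<bar> \<le> 1 \<Longrightarrow> cmod (poly q (of_real t)) \<le> 2 * S"
    and S2: "ennreal (S\<^sup>2) \<le> ennreal (773094113280 * (real n)\<^sup>2 / real m *
       (\<Sum>i<m. sample_weight n (X i) * (cmod (poly q (of_real (X i))))\<^sup>2)) * amplification n m M X"
    using sup_norm_le_amplification[OF n _ m M dense X, of q] q by (auto simp: polys_def)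
  have "ennreal (S\<^sup>2) \<le> ennreal (B * (real n)\<^sup>2 / real m * T) * ennreal a"
    using S2 unfolding a T_def pfun_def B_def .
  also have "\<dots> = ennreal (B * (real n)\<^sup>2 / real m * T * a)"
    using a T0 by (simp add: B_def flip: ennreal_mult)
  finally have "S\<^sup>2 \<le> B * (real n)\<^sup>2 / real m * T * a"
    using a T0 by (subst (asm) ennreal_le_iff) (auto simp: B_def)
  also have "\<dots> = B * (real n)\<^sup>2 / real m * (a * T)" by simp
  also have "\<dots> \<le> B * (real n)\<^sup>2 / real m * (real m * (16 * c / \<epsilon> * (G\<^sup>2 + E\<^sup>2)))"
  proof (rule mult_left_mono)
    have "a * T \<le> a * (2 * W + 4 * E\<^sup>2)" using Tle a by (intro mult_left_mono)
    also have "\<dots> = 2 * (a * W) + 4 * (a * E\<^sup>2)" by (simp add: algebra_simps)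
    also have "\<dots> \<le> 2 * (real m * G\<^sup>2 * c / (\<epsilon> / 4)) + 4 * (c / (\<epsilon> / 4) * E\<^sup>2)"
      using aW ac by (intro add_mono mult_left_mono mult_right_mono) auto
    \<comment> \<open>The noise part is enlarged by a factor \<open>m \<ge> 1\<close> so that both
      parts cancel the 1 / m in front.\<close>
    also have "\<dots> \<le> 4 * (real m * G\<^sup>2 * c / (\<epsilon> / 4)) + real m * (4 * (c / (\<epsilon> / 4) * E\<^sup>2))"
    proof (rule add_mono)
      show "2 * (real m * G\<^sup>2 * c / (\<epsilon> / 4)) \<le> 4 * (real m * G\<^sup>2 * c / (\<epsilon> / 4))"
        using c0 \<epsilon> by (intro mult_right_mono) auto
      have "1 * (4 * (c / (\<epsilon> / 4) * E\<^sup>2)) \<le> real m * (4 * (c / (\<epsilon> / 4) * E\<^sup>2))"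
        using m1 c0 \<epsilon> by (intro mult_right_mono) auto
      then show "4 * (c / (\<epsilon> / 4) * E\<^sup>2) \<le> real m * (4 * (c / (\<epsilon> / 4) * E\<^sup>2))" by simp
    qed
    also have "\<dots> = real m * (16 * c / \<epsilon> * (G\<^sup>2 + E\<^sup>2))" using \<epsilon> by (simp add: field_simps)
    finally show "a * T \<le> real m * (16 * c / \<epsilon> * (G\<^sup>2 + E\<^sup>2))" .
  qed (simp add: B_def)
  also have "\<dots> = 16 * (B * c) * ((real n)\<^sup>2 / \<epsilon>) * (G\<^sup>2 + E\<^sup>2)" using m1 by simp
  also have "\<dots> \<le> 16 * (B * c) * ((real n)\<^sup>2 / \<epsilon>) * (G + E)\<^sup>2"
    using G E0 c0 \<epsilon> by (intro mult_left_mono) (auto simp: B_def power2_sum)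
  also have "\<dots> = (4 * sqrt (B * c) * (real n / sqrt \<epsilon> * (G + E)))\<^sup>2"
    using c0 \<epsilon> by (simp add: power_mult_distrib power_divide B_def)
  finally have "S \<le> 4 * sqrt (B * c) * (real n / sqrt \<epsilon> * (G + E))"
    using G E0 c0 \<epsilon> by (rule_tac power2_le_imp_le) (auto simp: B_def)
  then show ?thesis using S(2)[OF t] by (simp add: pfun_def B_def c_def E_def)
qed

text \<open>The inner 8 is the square root of 16 times the factor 2 for the extension to [-1, 1].
  The outer factor 2 and summand 2 come from the estimate in the L2 norm.\<close>

definition error_constant :: real where
  "error_constant = 2 * (8 * sqrt (773094113280 * (5184\<^sup>2 + 8))) + 2"

text \<open>The event is fixed through \<open>g = f - fn\<close> before the noise is introduced, so
  the conclusion holds on it for all noise vectors at once, also those depending on the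
  samples.\<close>

lemma wls_guarantee:
  fixes c :: "real \<Rightarrow> real" and f :: "real \<Rightarrow> complex" and fn :: "complex poly"
  assumes n: "n \<ge> 1" and f: "f \<in> L2_space rho" and fnp: "fn \<in> polys n" and \<epsilon>: "0 < \<epsilon>" "\<epsilon> < 1"
    and cost: "\<And>M. real n * real M \<le> 2 * real n + ln (1 / \<epsilon>) \<Longrightarrow> expected_cost n (5898240 * n * M) c \<le> D"
  shows "\<exists>m\<ge>n. expected_cost n m c \<le> D \<and>
    holds_with_prob_ge (sample_law n m) (1 - \<epsilon>) (\<lambda>x. \<forall>e::nat \<Rightarrow> complex.
      (\<exists>!p. wls_estimator n m x (\<lambda>i. f (x i) + e i) p) \<and>
      (\<forall>p. wls_estimator n m x (\<lambda>i. f (x i) + e i) p \<longrightarrow>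
        L2_norm rho (\<lambda>t. f t - pfun p t)
          \<le> error_constant * (real n / sqrt \<epsilon> *
              (L2_norm rho (\<lambda>t. f t - pfun fn t) + L2_set (\<lambda>i. cmod (e i)) {..<m})) \<and>
        Linf_norm rho (\<lambda>t. f t - pfun p t)
          \<le> ereal error_constant * (Linf_norm rho (\<lambda>t. f t - pfun fn t) +
              ereal (real n / sqrt \<epsilon> *
                (L2_norm rho (\<lambda>t. f t - pfun fn t) + L2_set (\<lambda>i. cmod (e i)) {..<m})))))"
    (is "\<exists>m\<ge>n. _ \<and> holds_with_prob_ge _ _ (?good m)")
proof -
  define C0 where "C0 = 8 * sqrt (773094113280 * (5184\<^sup>2 + 8))"
  have C0: "C0 \<ge> 0" by (simp add: C0_def)
  define C where "C = error_constant"
  have C_eq: "C = 2 * C0 + 2" by (simp add: C_def error_constant_def C0_def)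
  have C: "C > 0" "C \<ge> 1" "C \<ge> C0" using C0 by (auto simp: C_eq)
  \<comment> \<open>Rounding places \<open>n * M\<close> between
    \<open>n + ln (1 / \<epsilon>)\<close>, needed for the union bound at the largest windows, and
    \<open>2 * n + ln (1 / \<epsilon>)\<close>, needed for the cost.\<close>
  define M where "M = 1 + nat \<lceil>ln (1 / \<epsilon>) / real n\<rceil>"
  define m where "m = 5898240 * n * M"
  have M1: "M \<ge> 1" by (simp add: M_def)
  have l0: "0 \<le> ln (1 / \<epsilon>) / real n" using \<epsilon> n by simp
  have Mb: "1 + ln (1 / \<epsilon>) / real n \<le> real M" "real M \<le> 2 + ln (1 / \<epsilon>) / real n"
    unfolding M_def using l0 by linarith+
  have nM: "real n + ln (1 / \<epsilon>) \<le> real n * real M" "real n * real M \<le> 2 * real n + ln (1 / \<epsilon>)"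
    using mult_left_mono[OF Mb(1), of "real n"] mult_left_mono[OF Mb(2), of "real n"] n
    by (auto simp: distrib_left mult.commute)
  have mn: "m \<ge> n" "m \<ge> 1" using n M1 by (auto simp: m_def)
  define g where "g = (\<lambda>t. f t - pfun fn t)"
  define G where "G = L2_norm rho g"
  have gm: "g \<in> borel_measurable rho" and gi: "integrable rho (\<lambda>t. (cmod (g t))\<^sup>2)"
    unfolding g_def using L2_diff_pfun[OF f] by auto
  have G0: "0 \<le> G" by (simp add: G_def L2_norm_def)
  have G2: "(\<integral>\<^sup>+t. ennreal ((cmod (g t))\<^sup>2) \<partial>rho) = ennreal (G\<^sup>2)"
    using gi by (subst nn_integral_eq_integral) (auto simp: G_def L2_norm_def)
  define h where "h = (\<lambda>x. ennreal (sample_weight n x) * ennreal ((cmod (g x))\<^sup>2))"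
  have gs: "(\<lambda>t. ennreal ((cmod (g t))\<^sup>2)) \<in> borel_measurable rho" using gm by measurable
  have hm: "h \<in> borel_measurable (mu n)"
  proof -
    have "(\<lambda>x. ennreal (sample_weight n x)) \<in> borel_measurable (lebesgue_on unit_ivl)"
      by (intro borel_imp_lebesgue_on) measurable
    moreover have "(\<lambda>t. ennreal ((cmod (g t))\<^sup>2)) \<in> borel_measurable (lebesgue_on unit_ivl)"
      using gs measurable_cong_sets[OF sets_rho refl] by blast
    ultimately have "h \<in> borel_measurable (lebesgue_on unit_ivl)"
      unfolding h_def by (rule borel_measurable_times_ennreal)
    then show ?thesis using measurable_cong_sets[OF sets_mu refl] by blast
  qed
  have hG: "(\<integral>\<^sup>+x. h x \<partial>mu n) \<le> ennreal (G\<^sup>2)"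
    unfolding h_def using nn_integral_sample_weight_le[OF n gs] unfolding G2 .
  obtain E where E: "E \<in> sets (sample_law n m)" "measure (sample_law n m) E \<ge> 1 - \<epsilon>"
    and good: "\<And>X i. X \<in> E \<Longrightarrow> i < m \<Longrightarrow> \<bar>X i\<bar> < radius n \<and> weight n (X i) = ennreal (sample_weight n (X i))"
    and dense: "\<And>X k. X \<in> E \<Longrightarrow> k < cells n \<Longrightarrow> \<not> sparse n m M X k (2048 * n)"
    and amp1: "\<And>X. X \<in> E \<Longrightarrow> amplification n m M X * (\<Sum>i<m. h (X i)) \<le> ennreal (real m * G\<^sup>2 * (5184\<^sup>2 + 8) / (\<epsilon> / 4))"
    and amp2: "\<And>X. X \<in> E \<Longrightarrow> amplification n m M X * of_nat m \<le> ennreal (real m * (5184\<^sup>2 + 8) / (\<epsilon> / 4))"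
    using good_event[OF n m_def M1 \<epsilon> nM(1) hm hG] by auto
  have ne1: "1 \<le> real n / sqrt \<epsilon>"
  proof -
    have "sqrt \<epsilon> \<le> 1" using \<epsilon> by simp
    then have "sqrt \<epsilon> \<le> real n" using n by linarith
    then show ?thesis using \<epsilon> by (simp add: field_simps)
  qed
  have sup: "cmod (pfun q t) \<le> C0 * (real n / sqrt \<epsilon> * (G + L2_set (\<lambda>i. cmod (e i)) {..<m}))"
    if "X \<in> E" "q \<in> polys n" "\<bar>t\<bar> \<le> 1"
      "(\<Sum>i<m. sample_weight n (X i) * (cmod (pfun q (X i)))\<^sup>2) \<le> (\<Sum>i<m. sample_weight n (X i) * (cmod (g (X i) + e i))\<^sup>2)"
    for X q e t
    unfolding C0_def
  proof (rule sup_error_bound[OF n m_def M1 \<epsilon> _ dense[OF that(1)] _ amp2[OF that(1)] that(2) G0 that(4,3)])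
    show "\<bar>X i\<bar> < radius n" if "i < m" for i using good[OF \<open>X \<in> E\<close> that] by simp
    show "amplification n m M X * (\<Sum>i<m. ennreal (sample_weight n (X i)) * ennreal ((cmod (g (X i)))\<^sup>2))
      \<le> ennreal (real m * G\<^sup>2 * (5184\<^sup>2 + 8) / (\<epsilon> / 4))"
      using amp1[OF that(1)] by (simp only: h_def)
  qed
  have main: "?good m X" if X: "X \<in> E" for X
    unfolding g_def[symmetric] C_def[symmetric]
  proof
    fix e :: "nat \<Rightarrow> complex"
    have w: "0 < sample_weight n (X i) \<and> weight n (X i) = ennreal (sample_weight n (X i))" if "i < m" for i
      using good[OF X that] sample_weight_density(2)[OF n, of "X i"] by simp
    have definite: "p = 0" if p: "p \<in> polys n" and z: "(\<Sum>i<m. sample_weight n (X i) * (cmod (pfun p (X i)))\<^sup>2) = 0" for p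
    proof (rule poly_zero_if_pfun_zero)
      fix t :: real assume t: "\<bar>t\<bar> \<le> 1"
      have degp: "degree p < n" using p by (simp add: polys_def)
      have Xr: "\<And>i. i < m \<Longrightarrow> \<bar>X i\<bar> < radius n" using good[OF X] by simp
      obtain S where S: "0 \<le> S" "\<And>t. \<bar>t\<bar> \<le> 1 \<Longrightarrow> cmod (poly p (of_real t)) \<le> 2 * S"
        and S2: "ennreal (S\<^sup>2) \<le> ennreal (773094113280 * (real n)\<^sup>2 / real m *
          (\<Sum>i<m. sample_weight n (X i) * (cmod (poly p (of_real (X i))))\<^sup>2)) * amplification n m M X"
        using sup_norm_le_amplification[OF n degp m_def M1 dense[OF X] Xr] by auto
      \<comment> \<open>A vanishing empirical norm gives \<open>S = 0\<close>, whatever the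
        amplification, because 0 times infinity is 0 in \<open>ennreal\<close>.\<close>
      have "ennreal (S\<^sup>2) \<le> 0" using S2 z by (simp add: pfun_def)
      then have "S = 0" by simp
      then show "pfun p t = 0" using S(2)[OF t] by (simp add: pfun_def)
    qed
    note wls = wls_estimator_unique_and_stable[where w = "\<lambda>i. sample_weight n (X i)" and X = X
        and y = "\<lambda>i. f (X i) + e i", OF n mn(2)]
    have unique: "\<exists>!p. wls_estimator n m X (\<lambda>i. f (X i) + e i) p"
      by (rule wls(1)) (erule w, erule (1) definite)
    have "L2_norm rho (\<lambda>t. f t - pfun p t)
              \<le> C * (real n / sqrt \<epsilon> * (L2_norm rho g + L2_set (\<lambda>i. cmod (e i)) {..<m})) \<and>
            Linf_norm rho (\<lambda>t. f t - pfun p t)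
              \<le> ereal C * (Linf_norm rho g +
                  ereal (real n / sqrt \<epsilon> * (L2_norm rho g + L2_set (\<lambda>i. cmod (e i)) {..<m})))" (is "?goal p")
      if p: "wls_estimator n m X (\<lambda>i. f (X i) + e i) p" for p
    proof -
      define s where "s = real n / sqrt \<epsilon> * (G + L2_set (\<lambda>i. cmod (e i)) {..<m})"
      have GE: "0 \<le> L2_set (\<lambda>i. cmod (e i)) {..<m}" by (rule L2_set_nonneg)
      have s0: "0 \<le> s" using G0 GE \<epsilon> by (simp add: s_def)
      \<comment> \<open>The factor \<open>n / sqrt \<epsilon>\<close> is at least 1, so the bare
        approximation error can be absorbed in \<open>s\<close>.\<close>
      have Gs: "G \<le> s"
      proof -
        have "1 * G \<le> real n / sqrt \<epsilon> * (G + L2_set (\<lambda>i. cmod (e i)) {..<m})"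
          using ne1 G0 GE by (intro mult_mono) auto
        then show ?thesis by (simp add: s_def)
      qed
      have "p \<in> polys n \<and> (\<forall>q\<in>polys n. (\<Sum>i<m. sample_weight n (X i) * (cmod (pfun (p - q) (X i)))\<^sup>2)
          \<le> (\<Sum>i<m. sample_weight n (X i) * (cmod ((f (X i) + e i) - pfun q (X i)))\<^sup>2))"
        by (rule wls(2)) (erule w, erule (1) definite, rule p)
      then have pp: "p \<in> polys n" and ls: "(\<Sum>i<m. sample_weight n (X i) * (cmod (pfun (p - fn) (X i)))\<^sup>2)
          \<le> (\<Sum>i<m. sample_weight n (X i) * (cmod ((f (X i) + e i) - pfun fn (X i)))\<^sup>2)"
        using fnp by blast+
      have ge: "f (X i) + e i - pfun fn (X i) = g (X i) + e i" for i by (simp add: g_def)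
      have ls': "(\<Sum>i<m. sample_weight n (X i) * (cmod (pfun (p - fn) (X i)))\<^sup>2)
          \<le> (\<Sum>i<m. sample_weight n (X i) * (cmod (g (X i) + e i))\<^sup>2)" using ls by (simp only: ge)
      have pt: "cmod (f t - pfun p t) \<le> cmod (g t) + C0 * s" if "t \<in> unit_ivl" for t
      proof -
        have "cmod (pfun (p - fn) t) \<le> C0 * s"
          unfolding s_def using that by (intro sup[OF X degree_diff_polys[OF pp fnp] _ ls']) (auto simp: unit_ivl_def)
        moreover have "f t - pfun p t = g t - pfun (p - fn) t" by (simp add: g_def pfun_diff)
        ultimately show ?thesis using norm_triangle_ineq4[of "g t" "pfun (p - fn) t"] by simp
      qed
      have "L2_norm rho (\<lambda>t. f t - pfun p t) \<le> 2 * (L2_norm rho g + C0 * s)"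
        using gm C0 s0 pt L2_diff_pfun(2)[OF f] by (intro L2_norm_le_add_sup gi) auto
      also have "\<dots> \<le> C * s" using Gs by (simp add: G_def C_eq algebra_simps)
      finally have 1: "L2_norm rho (\<lambda>t. f t - pfun p t) \<le> C * s" .
      have "Linf_norm rho (\<lambda>t. f t - pfun p t) \<le> Linf_norm rho g + ereal (C0 * s)"
        by (intro Linf_norm_le_add_sup gm L2_diff_pfun(1)[OF f] pt)
      also have "\<dots> \<le> ereal C * Linf_norm rho g + ereal (C * s)"
      proof (rule add_mono)
        have "ereal 1 * Linf_norm rho g \<le> ereal C * Linf_norm rho g"
          using C Linf_norm_nonneg[OF gm] by (intro ereal_mult_right_mono) auto
        then show "Linf_norm rho g \<le> ereal C * Linf_norm rho g" by (simp add: one_ereal_def[symmetric])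
        show "ereal (C0 * s) \<le> ereal (C * s)" using C s0 by (simp add: mult_right_mono)
      qed
      also have "\<dots> = ereal C * (Linf_norm rho g + ereal s)"
        using Linf_norm_nonneg[OF gm] s0 by (subst ereal_right_distrib) auto
      finally have 2: "Linf_norm rho (\<lambda>t. f t - pfun p t) \<le> ereal C * (Linf_norm rho g + ereal s)" .
      show ?thesis using 1 2 unfolding s_def G_def by blast
    qed
    then show "(\<exists>!p. wls_estimator n m X (\<lambda>i. f (X i) + e i) p) \<and>
      (\<forall>p. wls_estimator n m X (\<lambda>i. f (X i) + e i) p \<longrightarrow> ?goal p)" using unique by blast
  qed
  have "holds_with_prob_ge (sample_law n m) (1 - \<epsilon>) (?good m)"
    unfolding holds_with_prob_ge_def using E main by blast
  moreover have "expected_cost n m c \<le> D" unfolding m_def by (rule cost[OF nM(2)])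
  ultimately show ?thesis using mn(1) by blast
qed

theorem theorem4:
  shows "\<exists>C_err::real. C_err > 0 \<and>
    (\<forall>(\<alpha>::real) K::real. \<alpha> \<ge> 0 \<longrightarrow> K > 0 \<longrightarrow>
      (\<exists>C_cost::real. C_cost > 0 \<and>
        (\<forall>(n::nat) (c::real \<Rightarrow> real) (f::real \<Rightarrow> complex) (f\<^sub>n::complex poly) (\<epsilon>::real).
          n \<ge> 1 \<longrightarrow>
          c \<in> borel_measurable (lebesgue_on unit_ivl) \<longrightarrow>
          (\<forall>x\<in>unit_ivl. 0 < c x \<and> c x \<le> K * (1 - x\<^sup>2) powr (- \<alpha>)) \<longrightarrow>
          f \<in> L2_space rho \<longrightarrow>
          best_L2_approx n f f\<^sub>n \<longrightarrow>
          0 < \<epsilon> \<longrightarrow> \<epsilon> < 1 \<longrightarrow>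
          (\<exists>m\<ge>n.
            expected_cost n m c
              \<le> ennreal (C_cost * real n powr max 1 (2 * \<alpha>) * ln (3 * real n / \<epsilon>)) \<and>
            holds_with_prob_ge (sample_law n m) (1 - \<epsilon>) (\<lambda>x. \<forall>e::nat \<Rightarrow> complex.
              (\<exists>!p. wls_estimator n m x (\<lambda>i. f (x i) + e i) p) \<and>
              (\<forall>p. wls_estimator n m x (\<lambda>i. f (x i) + e i) p \<longrightarrow>
                L2_norm rho (\<lambda>t. f t - pfun p t)
                  \<le> C_err * (real n / sqrt \<epsilon> *
                      (L2_norm rho (\<lambda>t. f t - pfun f\<^sub>n t) + L2_set (\<lambda>i. cmod (e i)) {..<m})) \<and>
                Linf_norm rho (\<lambda>t. f t - pfun p t)
                  \<le> ereal C_err * (Linf_norm rho (\<lambda>t. f t - pfun f\<^sub>n t) +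
                      ereal (real n / sqrt \<epsilon> *
                        (L2_norm rho (\<lambda>t. f t - pfun f\<^sub>n t)
                          + L2_set (\<lambda>i. cmod (e i)) {..<m})))))))))"
proof (rule exI[of _ error_constant], intro conjI allI impI, goal_cases)
  case 1
  show ?case unfolding error_constant_def by (intro add_nonneg_pos mult_nonneg_nonneg) auto
next
  case (2 \<alpha> K)
  obtain D where D: "D > 0" and cost: "\<And>n M c \<epsilon>. n \<ge> 1 \<Longrightarrow> 0 < \<epsilon> \<Longrightarrow> \<epsilon> < 1 \<Longrightarrow>
      real n * real M \<le> 2 * real n + ln (1 / \<epsilon>) \<Longrightarrow>
      (\<And>x. x \<in> unit_ivl \<Longrightarrow> c x \<le> K * (1 - x\<^sup>2) powr (- \<alpha>)) \<Longrightarrow>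
      expected_cost n (5898240 * n * M) c \<le> ennreal (D * real n powr max 1 (2 * \<alpha>) * ln (3 * real n / \<epsilon>))"
    using expected_cost_bound[OF 2] by metis
  show ?case
  proof (rule exI[of _ D], intro conjI allI impI, goal_cases)
    case 1
    show ?case by (rule D)
  next
    case (2 n c f fn \<epsilon>)
    have "fn \<in> polys n" using 2(5) by (simp add: best_L2_approx_def is_arg_min_def)
    then show ?case using 2 by (intro wls_guarantee cost) auto
  qed
qed

end
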